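(* Let $(P,\theta,\nabla,h)$ be a $G$-invariant exact symplectic Hamiltonian system with respect to an exact symplectic Lie group action $\Phi\colon G\times P\to P$, let $\mu\in\mathfrak{g}^*$ be a regular value of the exact symplectic momentum map $\mathbf{J}^\Phi_\theta\colon P\to\mathfrak{g}^*$ associated with $\Phi$, and assume that $\Phi$ is quotientable on $(\mathbf{J}^\Phi_\theta)^{-1}(\mathbb{R}^\times\mu)$ by $K_{[\mu]}$. Let $c\in\mathbb{R}$ be a regular value of $h$ such that $\nabla\pitchfork h^{-1}(c)$. Let $(P_{[\mu]},\theta_{[\mu]},\nabla_{[\mu]},h_{[\mu]})$ be the reduced exact symplectic Hamiltonian system. Then $(S_{[\mu]}:=h_{[\mu]}^{-1}(c),\ \widetilde{\eta}_{[\mu]}:=\jmath^*\theta_{[\mu]})$ is an energy hypersurface of $(P_{[\mu]},\theta_{[\mu]},\nabla_{[\mu]},h_{[\mu]})$, where $\jmath\colon S_{[\mu]}\hookrightarrow P_{[\mu]}$ is the natural embedding.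
   Context: All structures are smooth and real; manifolds are Hausdorff, paracompact and finite-dimensional, and $P$ and $G$ are connected (connectedness is not required of level sets and their quotients). $G$ is a Lie group with Lie algebra $\mathfrak{g}$, and $\langle\cdot,\cdot\rangle$ is the pairing of $\mathfrak{g}^*$ and $\mathfrak{g}$. An exact symplectic manifold $(P,\theta)$ is a manifold $P$ with $\theta\in\Omega^1(P)$ such that $\omega=-\mathrm{d}\theta$ is symplectic. Its Liouville vector field $\nabla$ is the unique vector field with $\iota_\nabla\omega=\theta$. An exact symplectic Hamiltonian system $(P,\theta,\nabla,h)$ is such a triple $(P,\theta,\nabla)$ together with $h\in C^\infty(P)$; it is $G$-invariant if $h\circ\Phi_g=h$ for all $g\in G$. A Lie group action $\Phi\colon G\times P\to P$ is exact symplectic if $\Phi_g^*\theta=\theta$ for all $g\in G$. The fundamental vector field of $\xi\in\mathfrak{g}$ is $\xi_P(p)=\frac{\mathrm{d}}{\mathrm{d}t}|_{t=0}\Phi(\exp(t\xi),p)$. The exact symplectic momentum map $\mathbf{J}^\Phi_\theta\colon P\to\mathfrak{g}^*$ is given by $\iota_{\xi_P}\theta=\langle\mathbf{J}^\Phi_\theta,\xi\rangle$ for all $\xi\in\mathfrak{g}$. A (co-oriented) contact manifold $(M,\eta)$ is a $(2n-1)$-dimensional manifold with a one-form $\eta$ such that $\eta\wedge(\mathrm{d}\eta)^{n-1}$ is a volume form. A vector field $Y$ on $M$ is transverse to a submanifold $N\subset M$, written $Y\pitchfork N$, if $\langle Y_x\rangle+\mathrm{T}_xN=\mathrm{T}_xM$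 for all $x\in N$. For an exact symplectic Hamiltonian system $(P',\theta',\nabla',h')$, if $c\in\mathbb{R}$ is a regular value of $h'$ with $\nabla'\pitchfork h'^{-1}(c)$ and $i'\colon h'^{-1}(c)\hookrightarrow P'$ is the natural embedding, then $(h'^{-1}(c),i'^*\theta')$ is a contact manifold; contact manifolds arising in this way (from a regular value $c$ with the transversality property) are called energy hypersurfaces of $(P',\theta',\nabla',h')$. Write $\mathbb{R}^\times=\mathbb{R}\setminus\{0\}$ and $\mathbb{R}^\times\mu=\{\lambda\mu\mid\lambda\in\mathbb{R}^\times\}$. For $\mu$ a regular value, $(\mathbf{J}^\Phi_\theta)^{-1}(\mathbb{R}^\times\mu)$ is regarded as a submanifold of $P$. Put $\ker\mu=\{\xi\in\mathfrak{g}\mid\langle\mu,\xi\rangle=0\}$, $\mathfrak{g}_{[\mu]}=\{\xi\in\mathfrak{g}\mid\mathrm{ad}^*_\xi\mu\wedge\mu=0\}$ and $\mathfrak{k}_{[\mu]}=\ker\mu\cap\mathfrak{g}_{[\mu]}$, which is a Lie subalgebra; $K_{[\mu]}$ is the connected Lie subgroup of $G$ with Lie algebra $\mathfrak{k}_{[\mu]}$. An action is quotientable on $N$ by $K_{[\mu]}$ if the orbit space $N/K_{[\mu]}$ of the restricted action of $K_{[\mu]}$ on $N$ is a manifold and the projection $N\to N/K_{[\mu]}$ is a submersion. Reduced system (modified Marsden–Meyer–Weinstein reduction, known): let $P_{[\mu]}=(\mathbf{J}^\Phi_\theta)^{-1}(\mathbb{R}^\times\mu)/K_{[\mu]}$,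 with projection $\tau_{[\mu]}\colon(\mathbf{J}^\Phi_\theta)^{-1}(\mathbb{R}^\times\mu)\to P_{[\mu]}$ and immersion $\jmath_{[\mu]}\colon(\mathbf{J}^\Phi_\theta)^{-1}(\mathbb{R}^\times\mu)\hookrightarrow P$. Then $\nabla$ is tangent to $(\mathbf{J}^\Phi_\theta)^{-1}(\mathbb{R}^\times\mu)$, and $(P_{[\mu]},\theta_{[\mu]},\nabla_{[\mu]},h_{[\mu]})$ is the exact symplectic Hamiltonian system with $\omega_{[\mu]}=-\mathrm{d}\theta_{[\mu]}$, $\tau_{[\mu]}^*\omega_{[\mu]}=\jmath_{[\mu]}^*\omega$, $\tau_{[\mu]*}\nabla=\nabla_{[\mu]}$ and $\tau_{[\mu]}^*h_{[\mu]}=\jmath_{[\mu]}^*h$. *)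

theory Defs
  imports "HOL-Analysis.Analysis" "HOL-Combinatorics.Permutations" "HOL-Algebra.Coset"
begin

section \<open>Smooth functions and smooth manifolds\<close>

primrec Ck_on :: "nat \<Rightarrow> 'e::real_normed_vector set \<Rightarrow> ('e \<Rightarrow> 'f::real_normed_vector) \<Rightarrow> bool" where
  "Ck_on 0 W g \<longleftrightarrow> continuous_on W g"
| "Ck_on (Suc k) W g \<longleftrightarrow> (\<forall>x\<in>W. g differentiable (at x)) \<and>
     (\<forall>v. Ck_on k W (\<lambda>x. frechet_derivative g (at x) v))"

text \<open>Smoothness on an arbitrary set, by local smooth extension. Below it is applied to sets that are
  open in a linear subspace, where it is the usual notion.\<close>

definition smooth_on :: "'e::real_normed_vector set \<Rightarrow> ('e \<Rightarrow> 'f::real_normed_vector) \<Rightarrow> bool" where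
  "smooth_on A f \<longleftrightarrow> (\<forall>x\<in>A. \<exists>W g. open W \<and> x \<in> W \<and> (\<forall>k. Ck_on k W g) \<and> (\<forall>y\<in>A \<inter> W. g y = f y))"

definition paracompact_space :: "'a topology \<Rightarrow> bool" where
  "paracompact_space X \<longleftrightarrow>
     (\<forall>\<U>. (\<forall>U\<in>\<U>. openin X U) \<and> \<Union>\<U> = topspace X \<longrightarrow>
        (\<exists>\<V>. (\<forall>V\<in>\<V>. openin X V \<and> (\<exists>U\<in>\<U>. V \<subseteq> U)) \<and> \<Union>\<V> = topspace X \<and> locally_finite_in X \<V>))"

text \<open>A chart is a triple \<open>(U, \<phi>, E)\<close>: \<open>\<phi>\<close> is a homeomorphism from \<open>U\<close> onto an open subset of
  the linear subspace \<open>E\<close> of a Euclidean space type. An \<open>n\<close>-dimensional subspace \<open>E\<close> plays the role of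
  \<open>\<real>\<^sup>n\<close>; this allows every dimension, including 0, and lets submanifolds and
  their ambient manifold share one type.\<close>

type_synonym ('a, 'e) chart = "'a set \<times> ('a \<Rightarrow> 'e) \<times> 'e set"

record ('a, 'e) mfd =
  mtop :: "'a topology"
  charts :: "('a, 'e) chart set"

abbreviation points :: "('a, 'e) mfd \<Rightarrow> 'a set" where
  "points M \<equiv> topspace (mtop M)"

definition is_chart :: "'a topology \<Rightarrow> ('a, 'e::euclidean_space) chart \<Rightarrow> bool" where
  "is_chart X = (\<lambda>(U, \<phi>, E). openin X U \<and> subspace E \<and> openin (top_of_set E) (\<phi> ` U) \<and>
     homeomorphic_map (subtopology X U) (top_of_set (\<phi> ` U)) \<phi>)"

definition smooth_transition :: "('a, 'e::euclidean_space) chart \<Rightarrow> ('a, 'e) chart \<Rightarrow> bool" where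
  "smooth_transition = (\<lambda>(U, \<phi>, E) (V, \<psi>, E'). smooth_on (\<phi> ` (U \<inter> V)) (\<psi> \<circ> inv_into U \<phi>))"

definition manifold_of_dim :: "nat \<Rightarrow> ('a, 'e::euclidean_space) mfd \<Rightarrow> bool" where
  "manifold_of_dim n M \<longleftrightarrow>
     Hausdorff_space (mtop M) \<and> paracompact_space (mtop M) \<and>
     (\<forall>c\<in>charts M. is_chart (mtop M) c) \<and>
     (\<forall>(U, \<phi>, E)\<in>charts M. U \<noteq> {} \<longrightarrow> dim E = n) \<and>
     (\<Union>(U, \<phi>, E)\<in>charts M. U) = points M \<and>
     (\<forall>c\<in>charts M. \<forall>d\<in>charts M. smooth_transition c d)"

definition smooth_manifold :: "('a, 'e::euclidean_space) mfd \<Rightarrow> bool" where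
  "smooth_manifold M \<longleftrightarrow> (\<exists>n. manifold_of_dim n M)"

definition maximal_atlas :: "('a, 'e::euclidean_space) mfd \<Rightarrow> ('a, 'e) chart set" where
  "maximal_atlas M = {c. is_chart (mtop M) c \<and>
     (\<forall>d\<in>charts M. smooth_transition c d \<and> smooth_transition d c)}"

definition euclid_mfd :: "'e::euclidean_space set \<Rightarrow> ('e, 'e) mfd" where
  "euclid_mfd A = \<lparr>mtop = top_of_set A, charts = {(A, id, UNIV)}\<rparr>"

definition prod_mfd :: "('a, 'e::euclidean_space) mfd \<Rightarrow> ('b, 'f::euclidean_space) mfd \<Rightarrow> ('a \<times> 'b, 'e \<times> 'f) mfd" where
  "prod_mfd M M' = \<lparr>mtop = prod_topology (mtop M) (mtop M'),
     charts = {(U \<times> V, map_prod \<phi> \<psi>, E \<times> F) | U \<phi> E V \<psi> F. (U, \<phi>, E) \<in> charts M \<and> (V, \<psi>, F) \<in> charts M'}\<rparr>"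

definition smooth_map :: "('a, 'e::euclidean_space) mfd \<Rightarrow> ('b, 'f::euclidean_space) mfd \<Rightarrow> ('a \<Rightarrow> 'b) \<Rightarrow> bool" where
  "smooth_map M M' F \<longleftrightarrow> continuous_map (mtop M) (mtop M') F \<and>
     (\<forall>(U, \<phi>, E)\<in>charts M. \<forall>(V, \<psi>, E')\<in>charts M'.
        smooth_on (\<phi> ` (U \<inter> F -` V)) (\<psi> \<circ> F \<circ> inv_into U \<phi>))"

definition smooth_fun_on :: "('a, 'e::euclidean_space) mfd \<Rightarrow> 'a set \<Rightarrow> ('a \<Rightarrow> real) \<Rightarrow> bool" where
  "smooth_fun_on M W f \<longleftrightarrow> (\<forall>(U, \<phi>, E)\<in>charts M. smooth_on (\<phi> ` (U \<inter> W)) (f \<circ> inv_into U \<phi>))"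

definition smooth_near :: "('a, 'e::euclidean_space) mfd \<Rightarrow> 'a \<Rightarrow> ('a \<Rightarrow> real) \<Rightarrow> bool" where
  "smooth_near M p f \<longleftrightarrow> (\<exists>W. openin (mtop M) W \<and> p \<in> W \<and> smooth_fun_on M W f)"

text \<open>The set \<open>A\<close> with the subspace topology and all charts obtained by restricting slice charts of \<open>M\<close>.
  \<open>A\<close> is an embedded submanifold iff these cover \<open>A\<close>, and then this is its submanifold structure.\<close>

definition submfd :: "('a, 'e::euclidean_space) mfd \<Rightarrow> 'a set \<Rightarrow> ('a, 'e) mfd" where
  "submfd M A = \<lparr>mtop = subtopology (mtop M) A,
     charts = {(U \<inter> A, \<phi>, F) | U \<phi> E F. (U, \<phi>, E) \<in> maximal_atlas M \<and>
        subspace F \<and> F \<subseteq> E \<and> \<phi> ` (U \<inter> A) = \<phi> ` U \<inter> F}\<rparr>"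

definition embedded_submanifold :: "('a, 'e::euclidean_space) mfd \<Rightarrow> 'a set \<Rightarrow> bool" where
  "embedded_submanifold M A \<longleftrightarrow> A \<subseteq> points M \<and> smooth_manifold (submfd M A)"


section \<open>Tangent vectors and vector fields\<close>

text \<open>A tangent vector at \<open>p\<close> is represented by its action on functions that are smooth near \<open>p\<close>
  (extended by 0 to all other functions); tangent vectors are the velocities of smooth curves.\<close>

type_synonym 'a tvec = "('a \<Rightarrow> real) \<Rightarrow> real"

definition tadd :: "'a tvec \<Rightarrow> 'a tvec \<Rightarrow> 'a tvec" where
  "tadd u v = (\<lambda>f. u f + v f)"

definition tscale :: "real \<Rightarrow> 'a tvec \<Rightarrow> 'a tvec" where
  "tscale r v = (\<lambda>f. r * v f)"

definition tzero :: "'a tvec" where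
  "tzero = (\<lambda>f. 0)"

definition velocity :: "('a, 'e::euclidean_space) mfd \<Rightarrow> (real \<Rightarrow> 'a) \<Rightarrow> 'a tvec" where
  "velocity M \<gamma> = (\<lambda>f. if smooth_near M (\<gamma> 0) f then deriv (\<lambda>t. f (\<gamma> t)) 0 else 0)"

definition tangent_space :: "('a, 'e::euclidean_space) mfd \<Rightarrow> 'a \<Rightarrow> 'a tvec set" where
  "tangent_space M p = {velocity M \<gamma> | \<gamma>. \<gamma> 0 = p \<and> (\<exists>\<epsilon>>0. smooth_map (euclid_mfd {-\<epsilon><..<\<epsilon>}) M \<gamma>)}"

text \<open>The tangent map \<open>T\<^sub>p F\<close> of a smooth map \<open>F\<close> into \<open>M'\<close>. For the inclusion of a submanifold
  take \<open>F = id\<close>.\<close>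

definition tmap :: "('b, 'f::euclidean_space) mfd \<Rightarrow> ('a \<Rightarrow> 'b) \<Rightarrow> 'a \<Rightarrow> 'a tvec \<Rightarrow> 'b tvec" where
  "tmap M' F p v = (\<lambda>f. if smooth_near M' (F p) f then v (\<lambda>q. f (F q)) else 0)"

definition vector_field :: "('a, 'e::euclidean_space) mfd \<Rightarrow> ('a \<Rightarrow> 'a tvec) \<Rightarrow> bool" where
  "vector_field M X \<longleftrightarrow> (\<forall>p\<in>points M. X p \<in> tangent_space M p) \<and>
     (\<forall>W f. openin (mtop M) W \<and> smooth_fun_on M W f \<longrightarrow> smooth_fun_on M W (\<lambda>p. X p f))"

definition submersion :: "('a, 'e::euclidean_space) mfd \<Rightarrow> ('b, 'f::euclidean_space) mfd \<Rightarrow> ('a \<Rightarrow> 'b) \<Rightarrow> bool" where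
  "submersion M M' F \<longleftrightarrow> smooth_map M M' F \<and>
     (\<forall>p\<in>points M. tmap M' F p ` tangent_space M p = tangent_space M' (F p))"

definition level_set :: "('a, 'e) mfd \<Rightarrow> ('a \<Rightarrow> real) \<Rightarrow> real \<Rightarrow> 'a set" where
  "level_set M h c = {p \<in> points M. h p = c}"

text \<open>Under the identification of the tangent spaces of \<open>\<real>\<close> with \<open>\<real>\<close>, \<open>T\<^sub>p h\<close> is \<open>v \<mapsto> v h\<close>.\<close>

definition regular_value :: "('a, 'e::euclidean_space) mfd \<Rightarrow> ('a \<Rightarrow> real) \<Rightarrow> real \<Rightarrow> bool" where
  "regular_value M h c \<longleftrightarrow> (\<forall>p\<in>level_set M h c. (\<lambda>v. v h) ` tangent_space M p = UNIV)"

definition transverse :: "('a, 'e::euclidean_space) mfd \<Rightarrow> ('a \<Rightarrow> 'a tvec) \<Rightarrow> 'a set \<Rightarrow> bool" where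
  "transverse M Y A \<longleftrightarrow> (\<forall>p\<in>A.
     {tadd (tscale r (Y p)) (tmap M id p w) | r w. w \<in> tangent_space (submfd M A) p} = tangent_space M p)"


section \<open>Differential forms\<close>

text \<open>A \<open>k\<close>-form takes a point and a list of \<open>k\<close> tangent vectors at that point; its
  values on other arguments are irrelevant.\<close>

type_synonym 'a form = "'a \<Rightarrow> 'a tvec list \<Rightarrow> real"

text \<open>The constant-coefficient vector field of a chart with coordinate vector \<open>a\<close>, and
  the coordinate vector of a tangent vector.\<close>

definition coord_field :: "('a, 'e::euclidean_space) mfd \<Rightarrow> ('a, 'e) chart \<Rightarrow> 'e \<Rightarrow> 'a \<Rightarrow> 'a tvec" where
  "coord_field M = (\<lambda>(U, \<phi>, E) a q. velocity M (\<lambda>t. inv_into U \<phi> (\<phi> q + t *\<^sub>R a)))"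

definition coord_vec :: "('a, 'e::euclidean_space) chart \<Rightarrow> 'a tvec \<Rightarrow> 'e" where
  "coord_vec = (\<lambda>(U, \<phi>, E) v. \<Sum>b\<in>Basis. v (\<lambda>q. \<phi> q \<bullet> b) *\<^sub>R b)"

definition differential_form :: "('a, 'e::euclidean_space) mfd \<Rightarrow> nat \<Rightarrow> 'a form \<Rightarrow> bool" where
  "differential_form M k \<alpha> \<longleftrightarrow>
     (\<forall>p\<in>points M. \<forall>vs. length vs = k \<and> set vs \<subseteq> tangent_space M p \<longrightarrow>
        (\<forall>i<k. \<forall>r. \<forall>u\<in>tangent_space M p. \<forall>w\<in>tangent_space M p.
           \<alpha> p (vs[i := tadd (tscale r u) w]) = r * \<alpha> p (vs[i := u]) + \<alpha> p (vs[i := w])) \<and>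
        (\<forall>i<k. \<forall>j<k. i \<noteq> j \<and> vs ! i = vs ! j \<longrightarrow> \<alpha> p vs = 0)) \<and>
     (\<forall>(U, \<phi>, E)\<in>charts M. \<forall>as. length as = k \<and> set as \<subseteq> E \<longrightarrow>
        smooth_fun_on M U (\<lambda>q. \<alpha> q (map (\<lambda>a. coord_field M (U, \<phi>, E) a q) as)))"

definition form_eq :: "('a, 'e::euclidean_space) mfd \<Rightarrow> nat \<Rightarrow> 'a form \<Rightarrow> 'a form \<Rightarrow> bool" where
  "form_eq M k \<alpha> \<beta> \<longleftrightarrow> (\<forall>p\<in>points M. \<forall>vs. length vs = k \<and> set vs \<subseteq> tangent_space M p \<longrightarrow> \<alpha> p vs = \<beta> p vs)"

definition pullback :: "('b, 'f::euclidean_space) mfd \<Rightarrow> ('a \<Rightarrow> 'b) \<Rightarrow> 'b form \<Rightarrow> 'a form" where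
  "pullback M' F \<beta> = (\<lambda>p vs. \<beta> (F p) (map (tmap M' F p) vs))"

text \<open>\<open>d\<alpha>(v\<^sub>0, \<dots>, v\<^sub>k) = \<Sum>\<^sub>i (-1)\<^sup>i v\<^sub>i(\<alpha>(V\<^sub>0, \<dots>, V\<^sub>k))\<close> with \<open>V\<^sub>i\<close> omitted, where the \<open>V\<^sub>j\<close> extend the \<open>v\<^sub>j\<close> with
  constant coefficients in some chart at \<open>p\<close>. The bracket terms of the
  invariant formula vanish for such fields, and the value does not depend on the chart.\<close>

definition ext_d :: "('a, 'e::euclidean_space) mfd \<Rightarrow> 'a form \<Rightarrow> 'a form" where
  "ext_d M \<alpha> = (\<lambda>p vs.
     let c = (SOME c. c \<in> charts M \<and> p \<in> fst c);
         Vs = map (\<lambda>v. coord_field M c (coord_vec c v)) vs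
     in \<Sum>i<length vs. (-1) ^ i * (vs ! i) (\<lambda>q. \<alpha> q (map (\<lambda>V. V q) (take i Vs @ drop (Suc i) Vs))))"

text \<open>Wedge product of an alternating \<open>k\<close>-linear and an alternating \<open>l\<close>-linear form on a vector space,
  normalised so that \<open>(\<alpha> \<and> \<beta>)(u, v) = \<alpha>(u) \<beta>(v) - \<alpha>(v) \<beta>(u)\<close> for \<open>k = l = 1\<close>.\<close>

definition wedge :: "nat \<Rightarrow> nat \<Rightarrow> ('v list \<Rightarrow> real) \<Rightarrow> ('v list \<Rightarrow> real) \<Rightarrow> 'v list \<Rightarrow> real" where
  "wedge k l \<alpha> \<beta> vs = (\<Sum>\<sigma> | \<sigma> permutes {..<k + l}. of_int (sign \<sigma>) *
      \<alpha> (map (\<lambda>i. vs ! \<sigma> i) [0..<k]) * \<beta> (map (\<lambda>i. vs ! \<sigma> i) [k..<k + l])) / (fact k * fact l)"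

primrec wedge_power :: "nat \<Rightarrow> ('v list \<Rightarrow> real) \<Rightarrow> nat \<Rightarrow> 'v list \<Rightarrow> real" where
  "wedge_power l \<beta> 0 = (\<lambda>vs. 1)"
| "wedge_power l \<beta> (Suc m) = wedge l (m * l) \<beta> (wedge_power l \<beta> m)"

definition volume_form :: "('a, 'e::euclidean_space) mfd \<Rightarrow> nat \<Rightarrow> 'a form \<Rightarrow> bool" where
  "volume_form M n \<alpha> \<longleftrightarrow> manifold_of_dim n M \<and> differential_form M n \<alpha> \<and>
     (\<forall>p\<in>points M. \<exists>vs. length vs = n \<and> set vs \<subseteq> tangent_space M p \<and> \<alpha> p vs \<noteq> 0)"


section \<open>Symplectic and contact structures\<close>

definition symplectic_form :: "('a, 'e::euclidean_space) mfd \<Rightarrow> 'a form \<Rightarrow> bool" where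
  "symplectic_form M \<omega> \<longleftrightarrow> differential_form M 2 \<omega> \<and> form_eq M 3 (ext_d M \<omega>) (\<lambda>p vs. 0) \<and>
     (\<forall>p\<in>points M. \<forall>u\<in>tangent_space M p. (\<forall>v\<in>tangent_space M p. \<omega> p [u, v] = 0) \<longrightarrow> u = tzero)"

definition neg_d :: "('a, 'e::euclidean_space) mfd \<Rightarrow> 'a form \<Rightarrow> 'a form" where
  "neg_d M \<theta> = (\<lambda>p vs. - ext_d M \<theta> p vs)"

definition exact_symplectic_manifold :: "('a, 'e::euclidean_space) mfd \<Rightarrow> 'a form \<Rightarrow> bool" where
  "exact_symplectic_manifold M \<theta> \<longleftrightarrow>
     smooth_manifold M \<and> differential_form M 1 \<theta> \<and> symplectic_form M (neg_d M \<theta>)"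

definition Liouville_field :: "('a, 'e::euclidean_space) mfd \<Rightarrow> 'a form \<Rightarrow> ('a \<Rightarrow> 'a tvec) \<Rightarrow> bool" where
  "Liouville_field M \<theta> X \<longleftrightarrow> vector_field M X \<and> form_eq M 1 (\<lambda>p vs. neg_d M \<theta> p (X p # vs)) \<theta>"

definition exact_symplectic_Hamiltonian_system ::
  "('a, 'e::euclidean_space) mfd \<Rightarrow> 'a form \<Rightarrow> ('a \<Rightarrow> 'a tvec) \<Rightarrow> ('a \<Rightarrow> real) \<Rightarrow> bool" where
  "exact_symplectic_Hamiltonian_system M \<theta> X h \<longleftrightarrow>
     exact_symplectic_manifold M \<theta> \<and> Liouville_field M \<theta> X \<and> smooth_fun_on M (points M) h"

definition contact_manifold :: "('a, 'e::euclidean_space) mfd \<Rightarrow> 'a form \<Rightarrow> bool" where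
  "contact_manifold M \<eta> \<longleftrightarrow> (\<exists>n\<ge>1. manifold_of_dim (2 * n - 1) M \<and> differential_form M 1 \<eta> \<and>
     volume_form M (2 * n - 1)
       (\<lambda>p. wedge 1 (2 * (n - 1)) (\<eta> p) (wedge_power 2 (ext_d M \<eta> p) (n - 1))))"

definition energy_hypersurface ::
  "('a, 'e::euclidean_space) mfd \<Rightarrow> 'a form \<Rightarrow> ('a \<Rightarrow> 'a tvec) \<Rightarrow> ('a \<Rightarrow> real) \<Rightarrow> 'a set \<Rightarrow> 'a form \<Rightarrow> bool" where
  "energy_hypersurface M \<theta> X h S \<eta> \<longleftrightarrow>
     (\<exists>c. regular_value M h c \<and> S = level_set M h c \<and> transverse M X S \<and> \<eta> = pullback M id \<theta>) \<and>
     embedded_submanifold M S \<and> contact_manifold (submfd M S) \<eta>"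


section \<open>Lie groups\<close>

definition lie_group :: "('g, 'd::euclidean_space) mfd \<Rightarrow> 'g monoid \<Rightarrow> bool" where
  "lie_group L G \<longleftrightarrow> smooth_manifold L \<and> group G \<and> carrier G = points L \<and>
     smooth_map (prod_mfd L L) L (\<lambda>(x, y). x \<otimes>\<^bsub>G\<^esub> y) \<and> smooth_map L L (m_inv G)"

definition lie_algebra :: "('g, 'd::euclidean_space) mfd \<Rightarrow> 'g monoid \<Rightarrow> 'g tvec set" where
  "lie_algebra L G = tangent_space L \<one>\<^bsub>G\<^esub>"

definition left_invariant_field :: "('g, 'd::euclidean_space) mfd \<Rightarrow> 'g monoid \<Rightarrow> 'g tvec \<Rightarrow> 'g \<Rightarrow> 'g tvec" where
  "left_invariant_field L G \<xi> g = tmap L (\<lambda>x. g \<otimes>\<^bsub>G\<^esub> x) \<one>\<^bsub>G\<^esub> \<xi>"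

definition lie_bracket :: "('g, 'd::euclidean_space) mfd \<Rightarrow> 'g monoid \<Rightarrow> 'g tvec \<Rightarrow> 'g tvec \<Rightarrow> 'g tvec" where
  "lie_bracket L G \<xi> \<zeta> = (\<lambda>f. if smooth_near L \<one>\<^bsub>G\<^esub> f
     then \<xi> (\<lambda>g. left_invariant_field L G \<zeta> g f) - \<zeta> (\<lambda>g. left_invariant_field L G \<xi> g f) else 0)"

text \<open>\<open>exp \<xi> = \<gamma>(1)\<close> for the one-parameter subgroup \<open>\<gamma>\<close> with \<open>\<gamma>'(0) = \<xi>\<close>.\<close>

definition lie_exp :: "('g, 'd::euclidean_space) mfd \<Rightarrow> 'g monoid \<Rightarrow> 'g tvec \<Rightarrow> 'g" where
  "lie_exp L G \<xi> = (THE \<gamma>. smooth_map (euclid_mfd UNIV) L \<gamma> \<and>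
     (\<forall>s t. \<gamma> (s + t) = \<gamma> s \<otimes>\<^bsub>G\<^esub> \<gamma> t) \<and> velocity L \<gamma> = \<xi>) (1 :: real)"

text \<open>Elements of the dual of the Lie algebra vanish outside the Lie algebra, so that equality
  is equality on it.\<close>

definition lie_dual :: "('g, 'd::euclidean_space) mfd \<Rightarrow> 'g monoid \<Rightarrow> ('g tvec \<Rightarrow> real) set" where
  "lie_dual L G = {\<mu>. (\<forall>\<xi>. \<xi> \<notin> lie_algebra L G \<longrightarrow> \<mu> \<xi> = 0) \<and>
     (\<forall>\<xi>\<in>lie_algebra L G. \<forall>\<zeta>\<in>lie_algebra L G. \<forall>r. \<mu> (tadd (tscale r \<xi>) \<zeta>) = r * \<mu> \<xi> + \<mu> \<zeta>)}"

text \<open>\<open>\<langle>ad*\<^sub>\<xi> \<mu>, \<zeta>\<rangle> = \<langle>\<mu>, [\<xi>, \<zeta>]\<rangle>\<close>; the sets below do not depend on the sign convention.\<close>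

definition ad_star :: "('g, 'd::euclidean_space) mfd \<Rightarrow> 'g monoid \<Rightarrow> 'g tvec \<Rightarrow> ('g tvec \<Rightarrow> real) \<Rightarrow> 'g tvec \<Rightarrow> real" where
  "ad_star L G \<xi> \<mu> = (\<lambda>\<zeta>. if \<zeta> \<in> lie_algebra L G then \<mu> (lie_bracket L G \<xi> \<zeta>) else 0)"

definition ker_covector :: "('g, 'd::euclidean_space) mfd \<Rightarrow> 'g monoid \<Rightarrow> ('g tvec \<Rightarrow> real) \<Rightarrow> 'g tvec set" where
  "ker_covector L G \<mu> = {\<xi> \<in> lie_algebra L G. \<mu> \<xi> = 0}"

definition g_ray :: "('g, 'd::euclidean_space) mfd \<Rightarrow> 'g monoid \<Rightarrow> ('g tvec \<Rightarrow> real) \<Rightarrow> 'g tvec set" where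
  "g_ray L G \<mu> = {\<xi> \<in> lie_algebra L G. \<forall>\<zeta>\<^sub>1\<in>lie_algebra L G. \<forall>\<zeta>\<^sub>2\<in>lie_algebra L G.
     wedge 1 1 (\<lambda>vs. ad_star L G \<xi> \<mu> (hd vs)) (\<lambda>vs. \<mu> (hd vs)) [\<zeta>\<^sub>1, \<zeta>\<^sub>2] = 0}"

definition k_ray :: "('g, 'd::euclidean_space) mfd \<Rightarrow> 'g monoid \<Rightarrow> ('g tvec \<Rightarrow> real) \<Rightarrow> 'g tvec set" where
  "k_ray L G \<mu> = ker_covector L G \<mu> \<inter> g_ray L G \<mu>"

text \<open>Lie subgroups are immersed: \<open>K\<close> carries its own connected Lie group structure.\<close>

definition connected_lie_subgroup ::
  "('g, 'd::euclidean_space) mfd \<Rightarrow> 'g monoid \<Rightarrow> 'g set \<Rightarrow> 'g tvec set \<Rightarrow> bool" where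
  "connected_lie_subgroup L G K \<kk> \<longleftrightarrow> subgroup K G \<and>
     (\<exists>LK :: ('g, 'd) mfd. lie_group LK (G\<lparr>carrier := K\<rparr>) \<and> connected_space (mtop LK) \<and>
        smooth_map LK L id \<and> (\<forall>x\<in>K. inj_on (tmap L id x) (tangent_space LK x)) \<and>
        tmap L id \<one>\<^bsub>G\<^esub> ` tangent_space LK \<one>\<^bsub>G\<^esub> = \<kk>)"


section \<open>Actions, momentum maps and reduction\<close>

definition lie_group_action ::
  "('g, 'd::euclidean_space) mfd \<Rightarrow> 'g monoid \<Rightarrow> ('p, 'e::euclidean_space) mfd \<Rightarrow> ('g \<Rightarrow> 'p \<Rightarrow> 'p) \<Rightarrow> bool" where
  "lie_group_action L G P \<Phi> \<longleftrightarrow> smooth_map (prod_mfd L P) P (\<lambda>(g, p). \<Phi> g p) \<and>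
     (\<forall>p\<in>points P. \<Phi> \<one>\<^bsub>G\<^esub> p = p) \<and>
     (\<forall>g\<in>carrier G. \<forall>k\<in>carrier G. \<forall>p\<in>points P. \<Phi> (g \<otimes>\<^bsub>G\<^esub> k) p = \<Phi> g (\<Phi> k p))"

definition exact_symplectic_action ::
  "('g, 'd::euclidean_space) mfd \<Rightarrow> 'g monoid \<Rightarrow> ('p, 'e::euclidean_space) mfd \<Rightarrow> 'p form \<Rightarrow> ('g \<Rightarrow> 'p \<Rightarrow> 'p) \<Rightarrow> bool" where
  "exact_symplectic_action L G P \<theta> \<Phi> \<longleftrightarrow> lie_group_action L G P \<Phi> \<and>
     (\<forall>g\<in>carrier G. form_eq P 1 (pullback P (\<Phi> g) \<theta>) \<theta>)"

definition invariant_function :: "'g monoid \<Rightarrow> ('p, 'e) mfd \<Rightarrow> ('g \<Rightarrow> 'p \<Rightarrow> 'p) \<Rightarrow> ('p \<Rightarrow> real) \<Rightarrow> bool" where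
  "invariant_function G P \<Phi> h \<longleftrightarrow> (\<forall>g\<in>carrier G. \<forall>p\<in>points P. h (\<Phi> g p) = h p)"

definition fundamental_field ::
  "('g, 'd::euclidean_space) mfd \<Rightarrow> 'g monoid \<Rightarrow> ('p, 'e::euclidean_space) mfd \<Rightarrow> ('g \<Rightarrow> 'p \<Rightarrow> 'p) \<Rightarrow> 'g tvec \<Rightarrow> 'p \<Rightarrow> 'p tvec" where
  "fundamental_field L G P \<Phi> \<xi> p = velocity P (\<lambda>t. \<Phi> (lie_exp L G (tscale t \<xi>)) p)"

definition momentum_map ::
  "('g, 'd::euclidean_space) mfd \<Rightarrow> 'g monoid \<Rightarrow> ('p, 'e::euclidean_space) mfd \<Rightarrow> 'p form \<Rightarrow> ('g \<Rightarrow> 'p \<Rightarrow> 'p) \<Rightarrow> 'p \<Rightarrow> 'g tvec \<Rightarrow> real" where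
  "momentum_map L G P \<theta> \<Phi> p = (\<lambda>\<xi>. if \<xi> \<in> lie_algebra L G then \<theta> p [fundamental_field L G P \<Phi> \<xi> p] else 0)"

text \<open>The tangent map at \<open>p\<close> of a map \<open>J\<close> from \<open>P\<close> to the dual \<open>\<gg>*\<close> of the Lie algebra, with the tangent spaces of the vector
  space \<open>\<gg>*\<close> identified with \<open>\<gg>*\<close>; it differentiates \<open>J\<close> componentwise.\<close>

definition tmap_dual ::
  "('g, 'd::euclidean_space) mfd \<Rightarrow> 'g monoid \<Rightarrow> ('p \<Rightarrow> 'g tvec \<Rightarrow> real) \<Rightarrow> 'p tvec \<Rightarrow> 'g tvec \<Rightarrow> real" where
  "tmap_dual L G J v = (\<lambda>\<xi>. if \<xi> \<in> lie_algebra L G then v (\<lambda>q. J q \<xi>) else 0)"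

definition regular_value_dual ::
  "('g, 'd::euclidean_space) mfd \<Rightarrow> 'g monoid \<Rightarrow> ('p, 'e::euclidean_space) mfd \<Rightarrow> ('p \<Rightarrow> 'g tvec \<Rightarrow> real) \<Rightarrow> ('g tvec \<Rightarrow> real) \<Rightarrow> bool" where
  "regular_value_dual L G P J \<mu> \<longleftrightarrow> \<mu> \<in> lie_dual L G \<and>
     (\<forall>p\<in>points P. J p = \<mu> \<longrightarrow> tmap_dual L G J ` tangent_space P p = lie_dual L G)"

definition momentum_level :: "('p, 'e) mfd \<Rightarrow> ('p \<Rightarrow> 'g tvec \<Rightarrow> real) \<Rightarrow> ('g tvec \<Rightarrow> real) \<Rightarrow> 'p set" where
  "momentum_level P J \<mu> = {p \<in> points P. \<exists>r. r \<noteq> 0 \<and> J p = (\<lambda>\<xi>. r * \<mu> \<xi>)}"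

definition orbit_proj :: "('g \<Rightarrow> 'p \<Rightarrow> 'p) \<Rightarrow> 'g set \<Rightarrow> 'p \<Rightarrow> 'p set" where
  "orbit_proj \<Phi> K p = (\<lambda>k. \<Phi> k p) ` K"

text \<open>\<open>Q\<close> is a manifold structure on the orbit space \<open>N/K\<close> for which the projection is a submersion.
  As surjective submersions are quotient maps, \<open>Q\<close> carries the quotient topology.\<close>

definition quotient_manifold ::
  "('p, 'e::euclidean_space) mfd \<Rightarrow> 'p set \<Rightarrow> ('g \<Rightarrow> 'p \<Rightarrow> 'p) \<Rightarrow> 'g set \<Rightarrow> ('p set, 'q::euclidean_space) mfd \<Rightarrow> bool" where
  "quotient_manifold P N \<Phi> K Q \<longleftrightarrow> smooth_manifold Q \<and> points Q = orbit_proj \<Phi> K ` N \<and>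
     submersion (submfd P N) Q (orbit_proj \<Phi> K)"

text \<open>The reduced data on \<open>Q = N/K\<close>. The push-forward condition includes that \<open>X\<close> is tangent to \<open>N\<close>: the vector
  \<open>w\<close> is \<open>X p\<close> regarded as a tangent vector of \<open>N\<close>.\<close>

definition reduced_system ::
  "('p, 'e::euclidean_space) mfd \<Rightarrow> 'p form \<Rightarrow> ('p \<Rightarrow> 'p tvec) \<Rightarrow> ('p \<Rightarrow> real) \<Rightarrow> 'p set \<Rightarrow> ('g \<Rightarrow> 'p \<Rightarrow> 'p) \<Rightarrow> 'g set \<Rightarrow>
   ('p set, 'q::euclidean_space) mfd \<Rightarrow> 'p set form \<Rightarrow> ('p set \<Rightarrow> 'p set tvec) \<Rightarrow> ('p set \<Rightarrow> real) \<Rightarrow> bool" where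
  "reduced_system P \<theta> X h N \<Phi> K Q \<theta>Q XQ hQ \<longleftrightarrow>
     exact_symplectic_Hamiltonian_system Q \<theta>Q XQ hQ \<and>
     form_eq (submfd P N) 2 (pullback Q (orbit_proj \<Phi> K) (neg_d Q \<theta>Q)) (pullback P id (neg_d P \<theta>)) \<and>
     (\<forall>p\<in>N. \<exists>w\<in>tangent_space (submfd P N) p.
        tmap P id p w = X p \<and> tmap Q (orbit_proj \<Phi> K) p w = XQ (orbit_proj \<Phi> K p)) \<and>
     (\<forall>p\<in>N. hQ (orbit_proj \<Phi> K p) = h p)"

end

theory Submission
  imports Defs
begin

text \<open>Only the scalar \<open>X h\<close> along \<open>h = c\<close> matters. Since \<open>c\<close> is a regular value of \<open>h\<close> and the tangent vectors of
  the level set are annihilated by \<open>dh\<close>, transversality of \<open>X\<close> means \<open>X h \<noteq> 0\<close> on the level set. The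
  reduced field is the push-forward of \<open>X\<close> and the reduced Hamiltonian pulls back to \<open>h\<close>, hence
  \<open>XQ hQ = X h \<noteq> 0\<close> on the reduced level set.

  For any exact symplectic Hamiltonian system with Liouville field \<open>X\<close>, the condition \<open>X h \<noteq> 0\<close> on
  \<open>S = h\<^sup>-\<^sup>1(c)\<close> makes \<open>S\<close> an energy hypersurface: \<open>c\<close> is a regular value, the inverse function theorem provides slice
  charts, and \<open>TM = \<langle>X\<rangle> + TS\<close> along \<open>S\<close>. The kernel of \<open>\<omega>\<close> restricted to \<open>TS\<close> is spanned by a vector \<open>R\<close> with
  \<open>\<eta>(R) = \<omega>(X, R) \<noteq> 0\<close>, and the \<open>\<omega>\<close>-complement of \<open>X, R\<close> is a symplectic subspace of \<open>ker \<eta>\<close> in \<open>TS\<close>; so \<open>R\<close>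
  followed by a symplectic basis of it is a basis on which \<open>\<eta> \<and> (d\<eta>)\<^sup>n\<^sup>-\<^sup>1\<close> does not vanish.\<close>

section \<open>Smooth functions on subsets of normed spaces\<close>

text \<open>Two features of the encoding shape the work. Charts take values in a linear subspace and
  smoothness means local extension to the ambient space, so a function determines only its
  derivatives in directions of the subspace; they are taken along lines as \<open>dderiv\<close>,
  and coordinates come from a basis of the subspace. Moreover \<open>ext_d\<close> evaluates in an
  arbitrarily chosen chart. Comparing it on a level set and on the surrounding manifold needs its
  chart independence, which rests on the symmetry of second derivatives.

  The contact volume is shown to be nonzero without evaluating the wedge power: on a suitable basis
  all signed terms share one sign, and the identity permutation contributes a nonzero one. Parity
  comes from linear algebra: a nondegenerate alternating form forces even dimension, so a hyperplane
  always contains a kernel vector.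

  Reduction uses that a tangent vector of a submanifold, being the velocity of a curve inside it,
  sees only the values of a function there; hence \<open>hQ\<close> composed with the projection may
  be replaced by \<open>h\<close>.\<close>

lemma Ck_on_subset: "Ck_on k W g \<Longrightarrow> V \<subseteq> W \<Longrightarrow> Ck_on k V g"
  by (induction k arbitrary: g) (auto intro: continuous_on_subset)

text \<open>On an open set a derivative depends only on nearby values, so agreement of the functions
  passes to every derivative in the recursion.\<close>

lemma Ck_on_cong:
  assumes "open W" "Ck_on k W g" "\<And>x. x \<in> W \<Longrightarrow> f x = g x"
  shows "Ck_on k W f"
  using assms(2,3)
proof (induction k arbitrary: f g)
  case 0
  then show ?case by (simp cong: continuous_on_cong)
next
  case (Suc k)
  have D: "(f has_derivative frechet_derivative g (at x)) (at x)" if "x \<in> W" for x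
  proof (rule has_derivative_transform_within_open[OF _ \<open>open W\<close> that])
    show "(g has_derivative frechet_derivative g (at x)) (at x)"
      using Suc.prems(1) that by (simp add: frechet_derivative_works)
  qed (use Suc.prems in auto)
  have "Ck_on k W (\<lambda>x. frechet_derivative f (at x) v)" for v
    using Suc.prems(1) by - (rule Suc.IH[of "\<lambda>x. frechet_derivative g (at x) v"],
      simp_all add: frechet_derivative_at[OF D, symmetric])
  then show ?case
    using D by (auto simp: differentiable_def)
qed

text \<open>Lets an explicitly known derivative \<open>g'\<close> replace
  \<open>frechet_derivative\<close>; all closure properties below are proved through this
  rule.\<close>

lemma Ck_on_SucI:
  assumes "open W" "\<And>x. x \<in> W \<Longrightarrow> (g has_derivative g' x) (at x)" "\<And>v. Ck_on k W (\<lambda>x. g' x v)"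
  shows "Ck_on (Suc k) W g"
proof -
  have "Ck_on k W (\<lambda>x. frechet_derivative g (at x) v)" for v
    by (rule Ck_on_cong[OF assms(1) assms(3)[of v]]) (simp add: frechet_derivative_at[OF assms(2), symmetric])
  then show ?thesis
    using assms(2) by (auto simp: differentiable_def)
qed

lemma Ck_on_has_derivative:
  assumes "Ck_on (Suc k) W g" "x \<in> W"
  shows "(g has_derivative frechet_derivative g (at x)) (at x)"
  using assms by (simp add: frechet_derivative_works)

lemma Ck_on_SucD: "Ck_on (Suc k) W g \<Longrightarrow> Ck_on k W g"
proof (induction k arbitrary: g)
  case 0
  then show ?case
    by (auto simp: continuous_on_eq_continuous_at intro!: differentiable_imp_continuous_within
        continuous_at_imp_continuous_on)
next
  case (Suc k)
  then show ?case by simp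
qed

lemma Ck_on_continuous: "Ck_on k W g \<Longrightarrow> continuous_on W g"
  by (induction k) (auto dest: Ck_on_SucD simp del: Ck_on.simps(2))

lemma Ck_on_const: "open W \<Longrightarrow> Ck_on k W (\<lambda>x. c)"
proof (induction k arbitrary: c)
  case (Suc k)
  show ?case by (rule Ck_on_SucI[where g' = "\<lambda>x v. 0"]) (use Suc in auto)
qed simp

lemma Ck_on_bounded_linear:
  assumes "open W" "bounded_linear f"
  shows "Ck_on k W f"
proof (cases k)
  case 0
  then show ?thesis using assms by (simp add: linear_continuous_on)
next
  case (Suc m)
  show ?thesis unfolding Suc
    by (rule Ck_on_SucI[where g' = "\<lambda>x. f"])
      (use assms in \<open>auto intro: bounded_linear_imp_has_derivative Ck_on_const\<close>)
qed

lemma Ck_on_add: "open W \<Longrightarrow> Ck_on k W f \<Longrightarrow> Ck_on k W g \<Longrightarrow> Ck_on k W (\<lambda>x. f x + g x)"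
proof (induction k arbitrary: f g)
  case 0
  then show ?case by (auto intro: continuous_on_add)
next
  case (Suc k)
  show ?case
    by (rule Ck_on_SucI[OF \<open>open W\<close> has_derivative_add[OF Ck_on_has_derivative Ck_on_has_derivative]])
      (use Suc in auto)
qed

lemma Ck_on_sum:
  assumes "open W" "\<And>i. i \<in> I \<Longrightarrow> Ck_on k W (f i)"
  shows "Ck_on k W (\<lambda>x. \<Sum>i\<in>I. f i x)"
  using assms(2)
proof (induction I rule: infinite_finite_induct)
  case (insert i I)
  then show ?case using Ck_on_add[OF assms(1), of k "f i" "\<lambda>x. \<Sum>i\<in>I. f i x"] by simp
qed (simp_all add: Ck_on_const assms)

text \<open>By the Leibniz rule the derivative is a sum of two products of the same kind, with one
  factor differentiated and the other demoted by one order. Scaling, multiplication and inner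
  product are instances.\<close>

lemma Ck_on_bilinear:
  assumes bil: "bounded_bilinear pr" and "open W"
  shows "Ck_on k W f \<Longrightarrow> Ck_on k W g \<Longrightarrow> Ck_on k W (\<lambda>x. pr (f x) (g x))"
proof (induction k arbitrary: f g)
  case 0
  then show ?case by (auto intro: bounded_bilinear.continuous_on[OF bil])
next
  case (Suc k)
  show ?case
  proof (rule Ck_on_SucI[OF \<open>open W\<close>])
    show "((\<lambda>x. pr (f x) (g x)) has_derivative
       (\<lambda>v. pr (f x) (frechet_derivative g (at x) v) + pr (frechet_derivative f (at x) v) (g x))) (at x)"
      if "x \<in> W" for x
      using bounded_bilinear.FDERIV[OF bil Ck_on_has_derivative Ck_on_has_derivative] Suc.prems that by blast
    show "Ck_on k W (\<lambda>x. pr (f x) (frechet_derivative g (at x) v) + pr (frechet_derivative f (at x) v) (g x))" for v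
      using Suc.prems Suc.IH[OF Ck_on_SucD[OF Suc.prems(1)]] Suc.IH[OF _ Ck_on_SucD[OF Suc.prems(2)]]
      by (intro Ck_on_add \<open>open W\<close>) simp_all
  qed
qed

lemmas Ck_on_scaleR = Ck_on_bilinear[OF bounded_bilinear_scaleR]
lemmas Ck_on_mult = Ck_on_bilinear[OF bounded_bilinear_mult]
lemmas Ck_on_inner = Ck_on_bilinear[OF bounded_bilinear_inner]

text \<open>The derivative is a product of the inverse itself with the derivative of
  \<open>f\<close>, so regularity of the inverse climbs one order at a time.\<close>

lemma Ck_on_inverse:
  fixes f :: "'e::real_normed_vector \<Rightarrow> real"
  assumes "open W" "\<And>x. x \<in> W \<Longrightarrow> f x \<noteq> 0"
  shows "Ck_on k W f \<Longrightarrow> Ck_on k W (\<lambda>x. inverse (f x))"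
proof (induction k)
  case 0
  then show ?case using assms by (auto intro: continuous_on_inverse)
next
  case (Suc k)
  show ?case
  proof (rule Ck_on_SucI[OF \<open>open W\<close>])
    show "((\<lambda>x. inverse (f x)) has_derivative
       (\<lambda>v. (- 1) * (inverse (f x) * frechet_derivative f (at x) v * inverse (f x)))) (at x)" if "x \<in> W" for x
      using Deriv.has_derivative_inverse[OF _ Ck_on_has_derivative[OF Suc.prems that]] assms that by simp
    have "Ck_on k W (\<lambda>x. inverse (f x))" using Suc Ck_on_SucD by blast
    moreover have "Ck_on k W (\<lambda>x. frechet_derivative f (at x) v)" for v using Suc.prems by simp
    ultimately show "Ck_on k W (\<lambda>x. (- 1) * (inverse (f x) * frechet_derivative f (at x) v * inverse (f x)))" for v
      by (intro Ck_on_mult Ck_on_const assms(1))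
  qed
qed

text \<open>The recursion in \<open>Ck_on\<close> controls derivatives in a fixed direction only,
  whereas the chain rule differentiates \<open>g\<close> in a direction that moves with
  \<open>x\<close>. Expanding that direction in the standard basis separates the moving coefficients
  from derivatives in fixed directions.\<close>

lemma Ck_on_compose:
  fixes f :: "'e::real_normed_vector \<Rightarrow> 'f::euclidean_space" and g :: "'f \<Rightarrow> 'h::real_normed_vector"
  assumes "open W" "open V" "f ` W \<subseteq> V"
  shows "Ck_on k W f \<Longrightarrow> Ck_on k V g \<Longrightarrow> Ck_on k W (\<lambda>x. g (f x))"
proof (induction k arbitrary: g)
  case 0
  then show ?case using assms by (auto intro: continuous_on_compose2)
next
  case (Suc k)
  note df = Ck_on_has_derivative[OF Suc.prems(1)] and dg = Ck_on_has_derivative[OF Suc.prems(2)]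
  show ?case
  proof (rule Ck_on_SucI[OF \<open>open W\<close>])
    fix x assume x: "x \<in> W"
    then have "f x \<in> V" using assms by auto
    from diff_chain_at[OF df[OF x] dg[OF this]]
    have D: "((\<lambda>x. g (f x)) has_derivative (\<lambda>v. frechet_derivative g (at (f x)) (frechet_derivative f (at x) v))) (at x)"
      by (simp add: o_def)
    have E: "frechet_derivative g (at (f x)) = (\<lambda>w. \<Sum>b\<in>Basis. (w \<bullet> b) *\<^sub>R frechet_derivative g (at (f x)) b)"
    proof
      fix w
      interpret linear "frechet_derivative g (at (f x))"
        using dg[OF \<open>f x \<in> V\<close>] has_derivative_linear by blast
      have "frechet_derivative g (at (f x)) w = frechet_derivative g (at (f x)) (\<Sum>b\<in>Basis. (w \<bullet> b) *\<^sub>R b)"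
        by (simp add: euclidean_representation)
      then show "frechet_derivative g (at (f x)) w = (\<Sum>b\<in>Basis. (w \<bullet> b) *\<^sub>R frechet_derivative g (at (f x)) b)"
        by (simp add: sum scaleR)
    qed
    show "((\<lambda>x. g (f x)) has_derivative
      (\<lambda>v. \<Sum>b\<in>Basis. (frechet_derivative f (at x) v \<bullet> b) *\<^sub>R frechet_derivative g (at (f x)) b)) (at x)"
      using D by (subst (asm) E)
  next
    fix v
    have "Ck_on k W (\<lambda>x. frechet_derivative f (at x) v)" using Suc.prems by simp
    moreover have "Ck_on k W (\<lambda>x. frechet_derivative g (at (f x)) b)" for b
      using Suc.prems(2) by (intro Suc.IH[of "\<lambda>y. frechet_derivative g (at y) b"] Ck_on_SucD[OF Suc.prems(1)]) simp
    ultimately show "Ck_on k W (\<lambda>x. \<Sum>b\<in>Basis. (frechet_derivative f (at x) v \<bullet> b) *\<^sub>R frechet_derivative g (at (f x)) b)"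
      by (intro Ck_on_sum Ck_on_scaleR Ck_on_inner Ck_on_const assms(1))
  qed
qed

text \<open>Openness is part of the notion, so that a single predicate carries both the
  neighbourhood and the extension that \<open>smooth_on\<close> asks for.\<close>

definition Cinf :: "'e::real_normed_vector set \<Rightarrow> ('e \<Rightarrow> 'f::real_normed_vector) \<Rightarrow> bool" where
  "Cinf W f \<longleftrightarrow> open W \<and> (\<forall>k. Ck_on k W f)"

lemma smooth_on_iff_Cinf:
  "smooth_on A f \<longleftrightarrow> (\<forall>x\<in>A. \<exists>W g. Cinf W g \<and> x \<in> W \<and> (\<forall>y\<in>A \<inter> W. g y = f y))"
  unfolding smooth_on_def Cinf_def by blast

lemma Cinf_open: "Cinf W f \<Longrightarrow> open W"
  by (simp add: Cinf_def)

lemma Cinf_subset: "Cinf W f \<Longrightarrow> open V \<Longrightarrow> V \<subseteq> W \<Longrightarrow> Cinf V f"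
  unfolding Cinf_def by (blast intro: Ck_on_subset)

lemma Cinf_derivative: "Cinf W f \<Longrightarrow> x \<in> W \<Longrightarrow> (f has_derivative frechet_derivative f (at x)) (at x)"
  unfolding Cinf_def using Ck_on_has_derivative[of 0] by blast

lemma Cinf_deriv: "Cinf W f \<Longrightarrow> Cinf W (\<lambda>x. frechet_derivative f (at x) v)"
  unfolding Cinf_def by (metis Ck_on.simps(2))

lemma Cinf_continuous: "Cinf W f \<Longrightarrow> continuous_on W f"
  unfolding Cinf_def using Ck_on_continuous by blast

lemma Cinf_const: "open W \<Longrightarrow> Cinf W (\<lambda>x. c)"
  by (simp add: Cinf_def Ck_on_const)

lemma Cinf_bounded_linear: "open W \<Longrightarrow> bounded_linear f \<Longrightarrow> Cinf W f"
  by (simp add: Cinf_def Ck_on_bounded_linear)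

lemma Cinf_add: "Cinf W f \<Longrightarrow> Cinf W g \<Longrightarrow> Cinf W (\<lambda>x. f x + g x)"
  by (simp add: Cinf_def Ck_on_add)

lemma Cinf_scaleR: "Cinf W f \<Longrightarrow> Cinf W g \<Longrightarrow> Cinf W (\<lambda>x. f x *\<^sub>R g x)"
  by (simp add: Cinf_def Ck_on_scaleR)

lemma Cinf_compose:
  fixes f :: "'e::real_normed_vector \<Rightarrow> 'f::euclidean_space"
  shows "Cinf W f \<Longrightarrow> Cinf V g \<Longrightarrow> f ` W \<subseteq> V \<Longrightarrow> Cinf W (\<lambda>x. g (f x))"
  unfolding Cinf_def by (blast intro: Ck_on_compose)

section \<open>Closure properties of smoothness by local extension\<close>

lemma smooth_on_subset: "smooth_on A f \<Longrightarrow> B \<subseteq> A \<Longrightarrow> smooth_on B f"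
  unfolding smooth_on_iff_Cinf by blast

lemma smooth_on_cong: "smooth_on A f \<Longrightarrow> (\<And>x. x \<in> A \<Longrightarrow> g x = f x) \<Longrightarrow> smooth_on A g"
  unfolding smooth_on_iff_Cinf by (metis IntE)

text \<open>An extension of the piece in \<open>A \<inter> T\<close>, restricted to its domain
  intersected with \<open>T\<close>, is an extension for \<open>A\<close>.\<close>

lemma smooth_on_local:
  assumes "\<And>x. x \<in> A \<Longrightarrow> \<exists>T. open T \<and> x \<in> T \<and> smooth_on (A \<inter> T) f"
  shows "smooth_on A f"
  unfolding smooth_on_iff_Cinf
proof
  fix x assume "x \<in> A"
  with assms obtain T where T: "open T" "x \<in> T" "smooth_on (A \<inter> T) f" by blast
  then obtain W g where W: "Cinf W g" "x \<in> W" "\<forall>y\<in>A \<inter> T \<inter> W. g y = f y"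
    unfolding smooth_on_iff_Cinf using \<open>x \<in> A\<close> by blast
  have "Cinf (T \<inter> W) g" using W T by (auto intro: Cinf_subset dest: Cinf_open)
  then show "\<exists>W g. Cinf W g \<and> x \<in> W \<and> (\<forall>y\<in>A \<inter> W. g y = f y)" using W T by blast
qed

lemma smooth_on_Cinf: "Cinf W f \<Longrightarrow> A \<subseteq> W \<Longrightarrow> smooth_on A f"
  unfolding smooth_on_iff_Cinf by blast

lemma smooth_on_continuous: "smooth_on A f \<Longrightarrow> continuous_on A f"
  unfolding continuous_on_eq_continuous_within
proof
  fix x assume A: "smooth_on A f" "x \<in> A"
  then obtain W g where W: "Cinf W g" "x \<in> W" "\<forall>y\<in>A \<inter> W. g y = f y"
    unfolding smooth_on_iff_Cinf by blast
  have "continuous (at x) g" using W Cinf_continuous[OF W(1)] Cinf_open[OF W(1)] by (simp add: continuous_on_eq_continuous_at)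
  then have "continuous (at x within A) g" by (rule continuous_at_imp_continuous_at_within)
  moreover have "open W" using W by (simp add: Cinf_def)
  ultimately show "continuous (at x within A) f"
    using A W continuous_transform_within_openin[of x A g "A \<inter> W" f]
    by (meson IntD1 IntI openin_open_Int)
qed

lemma smooth_on_const: "smooth_on A (\<lambda>x. c)"
  by (rule smooth_on_Cinf[OF Cinf_const[OF open_UNIV]]) simp

lemma smooth_on_linear: "bounded_linear f \<Longrightarrow> smooth_on A f"
  by (rule smooth_on_Cinf[OF Cinf_bounded_linear[OF open_UNIV]]) simp_all

text \<open>Handles sums and products at once: the two extensions are combined on the intersection
  of their domains.\<close>

lemma smooth_on_pointwise:
  fixes A :: "'e::real_normed_vector set"
  assumes "smooth_on A f" "smooth_on A g"
    and "\<And>(W :: 'e set) f g. Cinf W f \<Longrightarrow> Cinf W g \<Longrightarrow> Cinf W (\<lambda>x. H (f x) (g x))"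
  shows "smooth_on A (\<lambda>x. H (f x) (g x))"
  unfolding smooth_on_iff_Cinf
proof
  fix x assume "x \<in> A"
  with assms(1,2) obtain W f' V g' where W: "Cinf W f'" "x \<in> W" "\<forall>y\<in>A \<inter> W. f' y = f y"
    "Cinf V g'" "x \<in> V" "\<forall>y\<in>A \<inter> V. g' y = g y"
    unfolding smooth_on_iff_Cinf by metis
  then have "Cinf (W \<inter> V) f'" "Cinf (W \<inter> V) g'" by (auto intro: Cinf_subset dest: Cinf_open)
  then have "Cinf (W \<inter> V) (\<lambda>x. H (f' x) (g' x))" by (rule assms(3))
  then show "\<exists>W h. Cinf W h \<and> x \<in> W \<and> (\<forall>y\<in>A \<inter> W. h y = H (f y) (g y))"
    using W by (intro exI[of _ "W \<inter> V"]) auto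
qed

lemma smooth_on_add: "smooth_on A f \<Longrightarrow> smooth_on A g \<Longrightarrow> smooth_on A (\<lambda>x. f x + g x)"
  by (rule smooth_on_pointwise) (auto intro: Cinf_add)

lemma smooth_on_scaleR: "smooth_on A f \<Longrightarrow> smooth_on A g \<Longrightarrow> smooth_on A (\<lambda>x. f x *\<^sub>R g x)"
  by (rule smooth_on_pointwise) (auto intro: Cinf_scaleR)

lemma smooth_on_mult:
  fixes f :: "'e::real_normed_vector \<Rightarrow> real"
  shows "smooth_on A f \<Longrightarrow> smooth_on A g \<Longrightarrow> smooth_on A (\<lambda>x. f x * g x)"
  using smooth_on_scaleR[of A f g] by simp

lemma smooth_on_sum: "(\<And>i. i \<in> I \<Longrightarrow> smooth_on A (f i)) \<Longrightarrow> smooth_on A (\<lambda>x. \<Sum>i\<in>I. f i x)"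
  by (induction I rule: infinite_finite_induct) (auto intro: smooth_on_const smooth_on_add)

lemma smooth_on_prod:
  fixes f :: "'i \<Rightarrow> 'e::real_normed_vector \<Rightarrow> real"
  shows "(\<And>i. i \<in> I \<Longrightarrow> smooth_on A (f i)) \<Longrightarrow> smooth_on A (\<lambda>x. \<Prod>i\<in>I. f i x)"
  by (induction I rule: infinite_finite_induct) (auto intro: smooth_on_const smooth_on_mult)

lemma smooth_on_compose:
  fixes f :: "'e::real_normed_vector \<Rightarrow> 'f::euclidean_space"
  assumes "smooth_on A f" "smooth_on B g" "f ` A \<subseteq> B"
  shows "smooth_on A (\<lambda>x. g (f x))"
  unfolding smooth_on_iff_Cinf
proof
  fix x assume "x \<in> A"
  with assms(1) obtain W f' where W: "Cinf W f'" "x \<in> W" "\<forall>y\<in>A \<inter> W. f' y = f y"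
    unfolding smooth_on_iff_Cinf by metis
  obtain V g' where V: "Cinf V g'" "f x \<in> V" "\<forall>y\<in>B \<inter> V. g' y = g y"
    using assms \<open>x \<in> A\<close> unfolding smooth_on_iff_Cinf by (metis image_subset_iff)
  \<comment> \<open>The extension of \<open>g\<close> is usable only where the extension of
    \<open>f\<close> takes values in \<open>V\<close>, and continuity makes this an open
    set.\<close>
  have "open (W \<inter> f' -` V)"
    by (rule continuous_open_preimage[OF Cinf_continuous[OF W(1)] Cinf_open[OF W(1)] Cinf_open[OF V(1)]])
  then have "Cinf (W \<inter> f' -` V) (\<lambda>x. g' (f' x))"
    by (intro Cinf_compose[OF Cinf_subset[OF W(1)] V(1)]) auto
  moreover have "g' (f' y) = g (f y)" if "y \<in> A \<inter> (W \<inter> f' -` V)" for y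
    using W(3) V(3) assms(3) that by (metis IntD1 IntD2 IntI imageI subsetD vimageD)
  moreover have "x \<in> W \<inter> f' -` V"
    using W V \<open>x \<in> A\<close> by (metis IntI vimageI2)
  ultimately show "\<exists>W h. Cinf W h \<and> x \<in> W \<and> (\<forall>y\<in>A \<inter> W. h y = g (f y))"
    by blast
qed

section \<open>Second derivatives and directional derivatives\<close>

lemma Cinf_derivative_line:
  fixes g :: "'e::real_normed_vector \<Rightarrow> real"
  assumes "Cinf W g" "x + s *\<^sub>R v \<in> W"
  shows "((\<lambda>s. g (x + s *\<^sub>R v)) has_real_derivative frechet_derivative g (at (x + s *\<^sub>R v)) v) (at s)"
proof -
  note D = Cinf_derivative[OF assms]
  have "((\<lambda>s. g (x + s *\<^sub>R v)) has_derivative (\<lambda>r. frechet_derivative g (at (x + s *\<^sub>R v)) (r *\<^sub>R v))) (at s)"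
    by (rule has_derivative_compose[where f = "\<lambda>s. x + s *\<^sub>R v", OF _ D]) (auto intro!: derivative_eq_intros)
  then show ?thesis
    using has_derivative_linear[OF D] by (simp add: has_field_derivative_def linear_scale mult_commute_abs)
qed

text \<open>The mean value theorem is applied twice, in direction \<open>v\<close> to a difference
  of two parallel lines and then in direction \<open>w\<close> to the derivative. The left side is
  symmetric in \<open>v\<close> and \<open>w\<close>, which is what makes the lemma useful.\<close>

lemma Cinf_second_difference:
  fixes g :: "'e::real_normed_vector \<Rightarrow> real"
  assumes "Cinf W g" "h > 0" and in_W: "\<And>s t. 0 \<le> s \<Longrightarrow> s \<le> h \<Longrightarrow> 0 \<le> t \<Longrightarrow> t \<le> h \<Longrightarrow> x + s *\<^sub>R v + t *\<^sub>R w \<in> W"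
  obtains s t where "0 < s" "s < h" "0 < t" "t < h"
    "g (x + h *\<^sub>R v + h *\<^sub>R w) - g (x + h *\<^sub>R w) - (g (x + h *\<^sub>R v) - g x)
      = h * (h * frechet_derivative (\<lambda>y. frechet_derivative g (at y) v) (at (x + s *\<^sub>R v + t *\<^sub>R w)) w)"
proof -
  define P where "P y = frechet_derivative g (at y) v" for y
  have P: "Cinf W P" unfolding P_def by (rule Cinf_deriv[OF assms(1)])
  have dg: "((\<lambda>s. g (x + s *\<^sub>R v + t *\<^sub>R w)) has_real_derivative P (x + s *\<^sub>R v + t *\<^sub>R w)) (at s)"
    if "0 \<le> s" "s \<le> h" "0 \<le> t" "t \<le> h" for s t
    using Cinf_derivative_line[OF assms(1), of "x + t *\<^sub>R w" s v] in_W[OF that] by (simp add: P_def ac_simps)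
  have dP: "((\<lambda>t. P (x + s *\<^sub>R v + t *\<^sub>R w)) has_real_derivative
     frechet_derivative P (at (x + s *\<^sub>R v + t *\<^sub>R w)) w) (at t)"
    if "0 \<le> s" "s \<le> h" "0 \<le> t" "t \<le> h" for s t
    using Cinf_derivative_line[OF P in_W[OF that]] .
  \<comment> \<open>The summands with factor \<open>0\<close> keep every corner of the parallelogram
    in the form in which \<open>dg\<close> is stated.\<close>
  have "\<exists>s>0. s < h \<and> (g (x + h *\<^sub>R v + h *\<^sub>R w) - g (x + h *\<^sub>R v + 0 *\<^sub>R w)) - (g (x + 0 *\<^sub>R v + h *\<^sub>R w) - g (x + 0 *\<^sub>R v + 0 *\<^sub>R w))
     = (h - 0) * (P (x + s *\<^sub>R v + h *\<^sub>R w) - P (x + s *\<^sub>R v + 0 *\<^sub>R w))"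
    using \<open>h > 0\<close> by (intro MVT2 DERIV_diff dg) auto
  then obtain s where s: "0 < s" "s < h" and
    1: "g (x + h *\<^sub>R v + h *\<^sub>R w) - g (x + h *\<^sub>R v) - (g (x + h *\<^sub>R w) - g x) =
      h * (P (x + s *\<^sub>R v + h *\<^sub>R w) - P (x + s *\<^sub>R v))"
    by auto
  have "\<exists>t>0. t < h \<and> P (x + s *\<^sub>R v + h *\<^sub>R w) - P (x + s *\<^sub>R v + 0 *\<^sub>R w) = (h - 0) * frechet_derivative P (at (x + s *\<^sub>R v + t *\<^sub>R w)) w"
    using \<open>h > 0\<close> s by (intro MVT2 dP) auto
  then obtain t where t: "0 < t" "t < h" and
    2: "P (x + s *\<^sub>R v + h *\<^sub>R w) - P (x + s *\<^sub>R v) = h * frechet_derivative P (at (x + s *\<^sub>R v + t *\<^sub>R w)) w"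
    by auto
  from 1 2 show ?thesis
    by (intro that[OF s t]) (simp add: P_def[abs_def])
qed

text \<open>The same second difference equals \<open>h * h\<close> times either mixed derivative,
  each taken at some point of a small parallelogram at \<open>x\<close>. Both mixed derivatives are
  continuous, so shrinking the parallelogram identifies them at \<open>x\<close>.\<close>

lemma Cinf_derivative_symmetric:
  fixes g :: "'e::real_normed_vector \<Rightarrow> real"
  assumes "Cinf W g" "x \<in> W"
  shows "frechet_derivative (\<lambda>y. frechet_derivative g (at y) v) (at x) w =
    frechet_derivative (\<lambda>y. frechet_derivative g (at y) w) (at x) v"
proof -
  define R where "R v w y = frechet_derivative (\<lambda>y. frechet_derivative g (at y) v) (at y) w" for v w y
  have contR: "isCont (R v w) x" for v w
    using Cinf_continuous[OF Cinf_deriv[OF Cinf_deriv[OF assms(1)]]] Cinf_open[OF assms(1)] assms(2)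
    by (simp add: R_def[abs_def] continuous_on_eq_continuous_at)
  have "dist (R v w x) (R w v x) < \<epsilon>" if eps: "\<epsilon> > 0" for \<epsilon>
  proof -
    obtain d1 where d1: "d1 > 0" "\<And>y. dist y x < d1 \<Longrightarrow> dist (R v w y) (R v w x) < \<epsilon> / 2"
      using contR[of v w] half_gt_zero[OF eps] unfolding continuous_at_eps_delta by blast
    obtain d2 where d2: "d2 > 0" "\<And>y. dist y x < d2 \<Longrightarrow> dist (R w v y) (R w v x) < \<epsilon> / 2"
      using contR[of w v] half_gt_zero[OF eps] unfolding continuous_at_eps_delta by blast
    obtain d3 where d3: "d3 > 0" "ball x d3 \<subseteq> W"
      using Cinf_open[OF assms(1)] assms(2) open_contains_ball by blast
    define d where "d = min d1 (min d2 d3)"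
    \<comment> \<open>With this constant every point of the parallelogram of side parameter
      \<open>h\<close> lies within \<open>d / 2\<close> of \<open>x\<close>; the summand 1 keeps
      \<open>c\<close> positive when both directions vanish.\<close>
    define c where "c = 1 + norm v + norm w"
    define h where "h = d / 2 / c"
    have pos: "c > 0" unfolding c_def using norm_ge_zero[of v] norm_ge_zero[of w] by linarith
    have "d > 0" using d1 d2 d3 by (simp add: d_def)
    then have "h > 0" using pos by (simp add: h_def)
    have near: "dist (x + s *\<^sub>R v + t *\<^sub>R w) x < d" if "0 \<le> s" "s \<le> h" "0 \<le> t" "t \<le> h" for s t
    proof -
      have "dist (x + s *\<^sub>R v + t *\<^sub>R w) x = norm (s *\<^sub>R v + t *\<^sub>R w)"
        by (simp add: dist_norm algebra_simps)
      also have "\<dots> \<le> s * norm v + t * norm w"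
        using norm_triangle_ineq[of "s *\<^sub>R v" "t *\<^sub>R w"] that by simp
      also have "\<dots> \<le> h * norm v + h * norm w"
        using that by (intro add_mono mult_right_mono) auto
      also have "\<dots> \<le> h * c" using \<open>h > 0\<close> by (simp add: c_def algebra_simps)
      also have "\<dots> = d / 2" using pos by (simp add: h_def)
      also have "\<dots> < d" using \<open>d > 0\<close> by simp
      finally show ?thesis .
    qed
    have in_W: "x + s *\<^sub>R v + t *\<^sub>R w \<in> W" if "0 \<le> s" "s \<le> h" "0 \<le> t" "t \<le> h" for s t
    proof -
      have "x + s *\<^sub>R v + t *\<^sub>R w \<in> ball x d3"
        using near[OF that] by (simp add: d_def dist_commute)
      then show ?thesis using d3 by blast
    qed
    have in_W': "x + s *\<^sub>R w + t *\<^sub>R v \<in> W" if "0 \<le> s" "s \<le> h" "0 \<le> t" "t \<le> h" for s t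
      using in_W[of t s] that by (simp add: ac_simps)
    obtain s t where st: "0 < s" "s < h" "0 < t" "t < h"
      "g (x + h *\<^sub>R v + h *\<^sub>R w) - g (x + h *\<^sub>R w) - (g (x + h *\<^sub>R v) - g x) = h * (h * R v w (x + s *\<^sub>R v + t *\<^sub>R w))"
      using Cinf_second_difference[OF assms(1) \<open>h > 0\<close> in_W] unfolding R_def by blast
    obtain s' t' where st': "0 < s'" "s' < h" "0 < t'" "t' < h"
      "g (x + h *\<^sub>R w + h *\<^sub>R v) - g (x + h *\<^sub>R v) - (g (x + h *\<^sub>R w) - g x) = h * (h * R w v (x + s' *\<^sub>R w + t' *\<^sub>R v))"
      using Cinf_second_difference[OF assms(1) \<open>h > 0\<close> in_W'] unfolding R_def by blast
    have "x + h *\<^sub>R w + h *\<^sub>R v = x + h *\<^sub>R v + h *\<^sub>R w" by simp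
    with st(5) st'(5) have "h * (h * R v w (x + s *\<^sub>R v + t *\<^sub>R w)) = h * (h * R w v (x + s' *\<^sub>R w + t' *\<^sub>R v))"
      by (simp only:)
    then have "R v w (x + s *\<^sub>R v + t *\<^sub>R w) = R w v (x + s' *\<^sub>R w + t' *\<^sub>R v)" using \<open>h > 0\<close> by simp
    moreover have "dist (R v w (x + s *\<^sub>R v + t *\<^sub>R w)) (R v w x) < \<epsilon> / 2"
      using near[of s t] st by (intro d1) (simp add: d_def)
    moreover have "dist (R w v (x + s' *\<^sub>R w + t' *\<^sub>R v)) (R w v x) < \<epsilon> / 2"
      using near[of t' s'] st' by (intro d2) (simp add: d_def add.commute add.left_commute)
    ultimately show ?thesis by (metis dist_triangle_half_r)
  qed
  then have "R v w x = R w v x" by (metis dist_eq_0_iff less_irrefl zero_less_dist_iff)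
  then show ?thesis by (simp add: R_def)
qed

text \<open>On a set that is open only in a subspace there is no Frechet derivative to speak of, but
  derivatives along lines inside the subspace are intrinsic to the function.\<close>

definition dderiv :: "('e::real_normed_vector \<Rightarrow> 'f::real_normed_vector) \<Rightarrow> 'e \<Rightarrow> 'e \<Rightarrow> 'f" where
  "dderiv f x a = vector_derivative (\<lambda>t. f (x + t *\<^sub>R a)) (at 0)"

lemma eventually_line_in:
  fixes E :: "'e::real_normed_vector set"
  assumes "openin (top_of_set E) A" "subspace E" "x \<in> A" "a \<in> E"
  shows "\<forall>\<^sub>F t in nhds 0. x + t *\<^sub>R a \<in> A"
proof -
  obtain T where T: "open T" "A = E \<inter> T" using assms(1) by (auto simp: openin_open)
  have "((\<lambda>t. x + t *\<^sub>R a) \<longlongrightarrow> x + 0 *\<^sub>R a) (nhds 0)" by (intro tendsto_intros filterlim_ident)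
  then have "\<forall>\<^sub>F t in nhds 0. x + t *\<^sub>R a \<in> T" using T assms by (intro topological_tendstoD) auto
  moreover have "x + t *\<^sub>R a \<in> E" for t
    using assms T by (auto intro: subspace_add subspace_scale)
  ultimately show ?thesis using T by simp
qed

text \<open>Along a curve that stays in \<open>A\<close> the function and its extension coincide, so
  the chain rule for the extension computes the derivative of the function itself.\<close>

lemma has_vector_derivative_along_curve:
  assumes "Cinf W g" "\<gamma> 0 \<in> W" "\<And>y. y \<in> A \<inter> W \<Longrightarrow> g y = f y"
    and "(\<gamma> has_vector_derivative v) (at 0)" "\<forall>\<^sub>F t in nhds 0. \<gamma> t \<in> A"
  shows "((\<lambda>t. f (\<gamma> t)) has_vector_derivative frechet_derivative g (at (\<gamma> 0)) v) (at 0)"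
proof -
  note D = Cinf_derivative[OF assms(1,2)]
  have "((\<lambda>t. g (\<gamma> t)) has_derivative (\<lambda>r. frechet_derivative g (at (\<gamma> 0)) (r *\<^sub>R v))) (at 0)"
    using assms(4) unfolding has_vector_derivative_def by (rule has_derivative_compose[where f = \<gamma>, OF _ D])
  then have G: "((\<lambda>t. g (\<gamma> t)) has_vector_derivative frechet_derivative g (at (\<gamma> 0)) v) (at 0)"
    using has_derivative_linear[OF D] by (simp add: has_vector_derivative_def linear_scale)
  have "isCont \<gamma> 0" using assms(4) has_vector_derivative_continuous by blast
  then have "\<forall>\<^sub>F t in nhds 0. \<gamma> t \<in> W"
    using Cinf_open[OF assms(1)] assms(2) by (simp add: continuous_at topological_tendstoD tendsto_at_iff_tendsto_nhds)
  with assms(5) have ev: "\<forall>\<^sub>F t in nhds 0. f (\<gamma> t) = g (\<gamma> t)"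
    by eventually_elim (simp add: assms(3))
  then have "f (\<gamma> 0) = g (\<gamma> 0)" by (rule eventually_nhds_x_imp_x)
  moreover have "\<forall>\<^sub>F t in nhds 0. t \<in> UNIV \<longrightarrow> f (\<gamma> t) = g (\<gamma> t)" using ev by simp
  ultimately show ?thesis
    using G ev by (subst has_vector_derivative_cong_ev[where g = "\<lambda>t. g (\<gamma> t)"]) auto
qed

section \<open>Directional derivatives on relatively open subsets of a subspace\<close>

context
  fixes E :: "'e::euclidean_space set" and A :: "'e set"
  assumes E: "subspace E" and A: "openin (top_of_set E) A"
begin

text \<open>As \<open>a\<close> lies in \<open>E\<close>, the line stays in \<open>A\<close> for
  small parameters. Hence every smooth extension has the same derivative in direction
  \<open>a\<close>, and facts about Frechet derivatives can be read off from any of them.\<close>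

lemma dderiv_extension:
  assumes "Cinf W g" "x \<in> A" "x \<in> W" "\<And>y. y \<in> A \<inter> W \<Longrightarrow> g y = f y" "a \<in> E"
  shows "dderiv f x a = frechet_derivative g (at x) a"
    "((\<lambda>t. f (x + t *\<^sub>R a)) has_vector_derivative dderiv f x a) (at 0)"
proof -
  have "((\<lambda>t. x + t *\<^sub>R a) has_vector_derivative a) (at 0)"
    by (auto intro!: derivative_eq_intros simp: has_vector_derivative_def)
  from has_vector_derivative_along_curve[where \<gamma> = "\<lambda>t. x + t *\<^sub>R a", OF assms(1) _ assms(4) this
      eventually_line_in[OF A E assms(2,5)]] assms(3)
  have D: "((\<lambda>t. f (x + t *\<^sub>R a)) has_vector_derivative frechet_derivative g (at x) a) (at 0)" by simp
  then show "dderiv f x a = frechet_derivative g (at x) a"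
    unfolding dderiv_def by (rule vector_derivative_at)
  with D show "((\<lambda>t. f (x + t *\<^sub>R a)) has_vector_derivative dderiv f x a) (at 0)" by simp
qed

lemma dderiv_works:
  assumes "smooth_on A f" "x \<in> A" "a \<in> E"
  shows "((\<lambda>t. f (x + t *\<^sub>R a)) has_vector_derivative dderiv f x a) (at 0)"
  using assms dderiv_extension(2)[OF _ assms(2) _ _ assms(3)] unfolding smooth_on_iff_Cinf by blast

lemma dderiv_curve:
  assumes "smooth_on A f" "\<gamma> 0 \<in> A" "(\<gamma> has_vector_derivative v) (at 0)" "v \<in> E" "\<forall>\<^sub>F t in nhds 0. \<gamma> t \<in> A"
  shows "((\<lambda>t. f (\<gamma> t)) has_vector_derivative dderiv f (\<gamma> 0) v) (at 0)"
proof -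
  obtain W g where W: "Cinf W g" "\<gamma> 0 \<in> W" "\<And>y. y \<in> A \<inter> W \<Longrightarrow> g y = f y"
    using assms(1,2) unfolding smooth_on_iff_Cinf by blast
  show ?thesis
    using has_vector_derivative_along_curve[OF W assms(3,5)] dderiv_extension(1)[OF W(1) assms(2) W(2,3) assms(4)] by simp
qed

lemma smooth_on_dderiv:
  assumes "smooth_on A f" "a \<in> E"
  shows "smooth_on A (\<lambda>x. dderiv f x a)"
  unfolding smooth_on_iff_Cinf
proof
  fix x assume "x \<in> A"
  then obtain W g where W: "Cinf W g" "x \<in> W" "\<And>y. y \<in> A \<inter> W \<Longrightarrow> g y = f y"
    using assms(1) unfolding smooth_on_iff_Cinf by blast
  have "frechet_derivative g (at y) a = dderiv f y a" if "y \<in> A \<inter> W" for y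
    using dderiv_extension(1)[OF W(1) _ _ W(3) assms(2)] that by simp
  then show "\<exists>W g. Cinf W g \<and> x \<in> W \<and> (\<forall>y\<in>A \<inter> W. g y = dderiv f y a)"
    using W Cinf_deriv by blast
qed

lemma dderiv_add_scale:
  assumes "smooth_on A f" "x \<in> A" "a \<in> E" "b \<in> E"
  shows "dderiv f x (r *\<^sub>R a + b) = r *\<^sub>R dderiv f x a + dderiv f x b"
proof -
  obtain W g where W: "Cinf W g" "x \<in> W" "\<And>y. y \<in> A \<inter> W \<Longrightarrow> g y = f y"
    using assms(1,2) unfolding smooth_on_iff_Cinf by blast
  note D = dderiv_extension(1)[OF W(1) assms(2) W(2,3)]
  have "r *\<^sub>R a + b \<in> E" using E assms by (simp add: subspace_add subspace_scale)
  with D[of a] D[of b] D[of "r *\<^sub>R a + b"] assms has_derivative_linear[OF Cinf_derivative[OF W(1,2)]] show ?thesis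
    by (simp add: linear_add linear_scale)
qed

lemma dderiv_symmetric:
  fixes f :: "'e \<Rightarrow> real"
  assumes "smooth_on A f" "x \<in> A" "a \<in> E" "b \<in> E"
  shows "dderiv (\<lambda>x. dderiv f x a) x b = dderiv (\<lambda>x. dderiv f x b) x a"
proof -
  obtain W g where W: "Cinf W g" "x \<in> W" "\<And>y. y \<in> A \<inter> W \<Longrightarrow> g y = f y"
    using assms(1,2) unfolding smooth_on_iff_Cinf by blast
  have D: "frechet_derivative g (at y) c = dderiv f y c" if "y \<in> A \<inter> W" "c \<in> E" for y c
    using dderiv_extension(1)[OF W(1) _ _ W(3) that(2)] that by simp
  have "dderiv (\<lambda>x. dderiv f x c) x d = frechet_derivative (\<lambda>y. frechet_derivative g (at y) c) (at x) d"
    if "c \<in> E" "d \<in> E" for c d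
    using dderiv_extension(1)[OF Cinf_deriv[OF W(1)] assms(2) W(2) _ that(2), of _ "\<lambda>y. dderiv f y c"] D that by simp
  then show ?thesis using assms Cinf_derivative_symmetric[OF W(1,2)] by metis
qed

lemma dderiv_unique:
  assumes "((\<lambda>t. f (x + t *\<^sub>R a)) has_vector_derivative D) (at 0)"
  shows "dderiv f x a = D"
  using assms unfolding dderiv_def by (rule vector_derivative_at)

lemma dderiv_cong:
  assumes "\<And>y. y \<in> A \<Longrightarrow> f y = g y" "smooth_on A g" "x \<in> A" "a \<in> E"
  shows "dderiv f x a = dderiv g x a"
proof -
  obtain W h where W: "Cinf W h" "x \<in> W" "\<And>y. y \<in> A \<inter> W \<Longrightarrow> h y = g y"
    using assms unfolding smooth_on_iff_Cinf by blast
  show ?thesis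
    using dderiv_extension(1)[OF W(1) assms(3) W(2) _ assms(4)] W(3) assms(1) by (metis IntD1)
qed

lemma dderiv_sum:
  assumes "\<And>i. i \<in> I \<Longrightarrow> smooth_on A (f i)" "x \<in> A" "a \<in> E"
  shows "dderiv (\<lambda>x. \<Sum>i\<in>I. f i x) x a = (\<Sum>i\<in>I. dderiv (f i) x a)"
  using dderiv_works assms by (intro dderiv_unique has_vector_derivative_sum) auto

lemma dderiv_mult:
  fixes f g :: "'e \<Rightarrow> real"
  assumes "smooth_on A f" "smooth_on A g" "x \<in> A" "a \<in> E"
  shows "dderiv (\<lambda>x. f x * g x) x a = f x * dderiv g x a + dderiv f x a * g x"
  using has_vector_derivative_mult[OF dderiv_works[OF assms(1,3,4)] dderiv_works[OF assms(2,3,4)]]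
  by (intro dderiv_unique) simp

lemma dderiv_inner:
  fixes f :: "'e \<Rightarrow> 'f::euclidean_space"
  assumes "smooth_on A f" "x \<in> A" "a \<in> E"
  shows "dderiv (\<lambda>x. f x \<bullet> b) x a = dderiv f x a \<bullet> b"
  by (intro dderiv_unique bounded_linear.has_vector_derivative[OF bounded_linear_inner_left] dderiv_works assms)

text \<open>Let \<open>z\<close> be the part of the derivative orthogonal to \<open>E'\<close>. The
  function \<open>f \<bullet> z\<close> is identically zero on \<open>A\<close>, and its derivative
  is the squared length of \<open>z\<close>.\<close>

lemma dderiv_in_subspace:
  fixes f :: "'e \<Rightarrow> 'f::euclidean_space"
  assumes "smooth_on A f" "f ` A \<subseteq> E'" "subspace E'" "x \<in> A" "a \<in> E"
  shows "dderiv f x a \<in> E'"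
proof -
  obtain y z where yz: "y \<in> span E'" "\<And>w. w \<in> span E' \<Longrightarrow> orthogonal z w" "dderiv f x a = y + z"
    using orthogonal_subspace_decomp_exists[of E' "dderiv f x a"] by blast
  then have y: "y \<in> E'" using assms(3) by (metis span_eq_iff)
  have z: "w \<bullet> z = 0" if "w \<in> E'" for w
    using yz(2)[of w] that by (simp add: span_base orthogonal_def inner_commute)
  have "dderiv (\<lambda>x. f x \<bullet> z) x a = dderiv (\<lambda>x. 0) x a"
    using assms(2,4,5) z by (intro dderiv_cong smooth_on_const) auto
  also have "\<dots> = 0" by (intro dderiv_unique) simp
  finally have "dderiv f x a \<bullet> z = 0" using dderiv_inner[OF assms(1,4,5)] by simp
  then have "z \<bullet> z = 0" using yz(3) z[OF y] by (simp add: inner_add_left)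
  then show ?thesis using yz(3) y by simp
qed

end

lemma dderiv_compose:
  fixes f :: "'e::euclidean_space \<Rightarrow> 'f::euclidean_space"
  assumes "subspace E" "openin (top_of_set E) A" "subspace E'" "openin (top_of_set E') B"
    and "smooth_on A f" "f ` A \<subseteq> B" "smooth_on B g" "x \<in> A" "a \<in> E"
  shows "dderiv (\<lambda>x. g (f x)) x a = dderiv g (f x) (dderiv f x a)"
proof -
  have "f ` A \<subseteq> E'" using assms(4,6) openin_imp_subset by blast
  then have E': "dderiv f x a \<in> E'" by (intro dderiv_in_subspace[OF assms(1,2)] assms)
  have "\<forall>\<^sub>F t in nhds 0. x + t *\<^sub>R a \<in> A" by (intro eventually_line_in[OF assms(2,1)] assms)
  then have ev: "\<forall>\<^sub>F t in nhds 0. f (x + t *\<^sub>R a) \<in> B"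
    by eventually_elim (use assms(6) in blast)
  have "((\<lambda>t. g (f (x + t *\<^sub>R a))) has_vector_derivative dderiv g (f x) (dderiv f x a)) (at 0)"
    using dderiv_curve[OF assms(3,4,7) _ dderiv_works[OF assms(1,2,5,8,9)] E' ev] assms(6,8) by auto
  then show ?thesis by (rule dderiv_unique[OF assms(1,2)])
qed

section \<open>Straightening a level set\<close>

text \<open>The map shifts \<open>x\<close> along \<open>e\<close> until its
  \<open>e\<close>-coordinate becomes \<open>f x - k\<close> and leaves the orthogonal coordinates
  alone. It is a local diffeomorphism wherever \<open>f\<close> has nonzero derivative along
  \<open>e\<close>.\<close>

lemma straightening:
  fixes f :: "'e::euclidean_space \<Rightarrow> real"
  assumes f: "Cinf W f" and x0: "x0 \<in> W" and e: "e \<bullet> e = 1" and ne: "frechet_derivative f (at x0) e \<noteq> 0"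
  obtains U V g where "open U" "U \<subseteq> W" "x0 \<in> U" "open V"
    "homeomorphism U V (\<lambda>x. x + (f x - k - x \<bullet> e) *\<^sub>R e) g" "Cinf V g"
proof -
  define df where "df x = frechet_derivative f (at x)" for x
  define \<Psi> where "\<Psi> x = x + (f x - k - x \<bullet> e) *\<^sub>R e" for x
  define D where "D x v = v + (df x v - v \<bullet> e) *\<^sub>R e" for x v
  have lin: "linear (df x)" if "x \<in> W" for x
    using Cinf_derivative[OF f that] has_derivative_linear unfolding df_def by blast
  have \<Psi>: "(\<Psi> has_derivative D x) (at x)" if "x \<in> W" for x
    unfolding \<Psi>_def D_def df_def
    by (auto intro!: derivative_eq_intros Cinf_derivative[OF f that])
  have bl: "bounded_linear (D x)" if "x \<in> W" for x
    using \<Psi>[OF that] has_derivative_bounded_linear by blast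
  have cont_df: "continuous_on W (\<lambda>x. df x v)" for v
    unfolding df_def by (rule Cinf_continuous[OF Cinf_deriv[OF f]])
  define W' where "W' = {x \<in> W. df x e \<noteq> 0}"
  have openW': "open W'"
  proof -
    have "W' = W \<inter> (\<lambda>x. df x e) -` (- {0})" by (auto simp: W'_def)
    then show ?thesis
      using continuous_open_preimage[OF cont_df Cinf_open[OF f], of "- {0}" e] by (simp add: open_Compl)
  qed
  \<comment> \<open>The explicit inverse of \<open>D x\<close>: a preimage of \<open>w\<close> has
    the form \<open>w + s *\<^sub>R e\<close>, and since the \<open>e\<close>-coordinate of
    \<open>D x v\<close> is \<open>df x v\<close>, the scalar satisfies
    \<open>w \<bullet> e = df x w + s * df x e\<close>.\<close>
  define Di where "Di x w = w + ((w \<bullet> e - df x w) / df x e) *\<^sub>R e" for x w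
  have DDi: "D x (Di x w) = w" and DiD: "Di x (D x w) = w" if "x \<in> W'" for x w
  proof -
    have l: "linear (df x)" and nz: "df x e \<noteq> 0" using that lin by (auto simp: W'_def)
    show "D x (Di x w) = w"
      using nz e by (simp add: D_def Di_def linear_add[OF l] linear_scale[OF l] inner_add_left flip: scaleR_add_left)
    have "((w \<bullet> e + (df x w - w \<bullet> e)) - (df x w + (df x w - w \<bullet> e) * df x e)) / df x e = w \<bullet> e - df x w"
      using nz by (simp add: field_simps)
    then show "Di x (D x w) = w"
      using nz e by (simp add: D_def Di_def linear_add[OF l] linear_scale[OF l] inner_add_left flip: scaleR_add_left)
  qed
  have blDi: "bounded_linear (Di x)" if "x \<in> W'" for x
  proof -
    have l: "linear (df x)" using that lin by (auto simp: W'_def)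
    have "linear (Di x)"
      by (rule linearI) (simp_all add: Di_def linear_add[OF l] linear_diff[OF l] linear_scale[OF l] algebra_simps
          inner_add_left add_divide_distrib diff_divide_distrib)
    then show ?thesis by (simp add: linear_conv_bounded_linear)
  qed
  have x0': "x0 \<in> W'" using x0 ne by (simp add: W'_def df_def)
  \<comment> \<open>The inverse function theorem wants the derivative as a continuous map into
    bounded linear maps; in finite dimension continuity can be checked on each vector
    separately.\<close>
  define F where "F x = Blinfun (D x)" for x
  have F: "blinfun_apply (F x) = D x" if "x \<in> W'" for x
    using bl that by (simp add: F_def W'_def bounded_linear_Blinfun_apply)
  obtain U V g g' where U: "open U" "U \<subseteq> W'" "x0 \<in> U" "open V" "\<Psi> x0 \<in> V" "homeomorphism U V \<Psi> g"
    and g: "\<And>y. y \<in> V \<Longrightarrow> (g has_derivative g' y) (at y)" "\<And>y. y \<in> V \<Longrightarrow> g' y = inv_into UNIV (blinfun_apply (F (g y)))"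
  proof (rule inverse_function_theorem[OF openW', of \<Psi> F x0 "Blinfun (Di x0)"])
    show "(\<Psi> has_derivative blinfun_apply (F x)) (at x)" if "x \<in> W'" for x
      using that \<Psi> by (simp add: F[OF that]) (simp add: W'_def)
    have "continuous_on W' (\<lambda>x. D x v)" for v
      unfolding D_def by (intro continuous_intros continuous_on_subset[OF cont_df]) (auto simp: W'_def)
    then show "continuous_on W' F"
      by (intro continuous_on_blinfun_componentwise) (simp add: F cong: continuous_on_cong)
    show "Blinfun (Di x0) o\<^sub>L F x0 = id_blinfun"
      by (rule blinfun_eqI) (simp add: F[OF x0'] bounded_linear_Blinfun_apply[OF blDi[OF x0']] DiD[OF x0'])
  qed (use x0' that in auto)
  have gV: "g y \<in> U" if "y \<in> V" for y using U that unfolding homeomorphism_def by blast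
  have g': "(g has_derivative Di (g y)) (at y)" if "y \<in> V" for y
  proof -
    have "g y \<in> W'" using gV[OF that] U by blast
    then have "inv_into UNIV (D (g y)) = Di (g y)"
      using DDi DiD by (intro inv_equality) auto
    then show ?thesis using g[OF that] F \<open>g y \<in> W'\<close> by simp
  qed
  have UW: "U \<subseteq> W" using U W'_def by blast
  \<comment> \<open>Bootstrapping: the derivative of \<open>g\<close> at \<open>y\<close> is
    \<open>Di (g y)\<close>, built from \<open>df\<close> at \<open>g y\<close> by products and one
    inverse, so it is as regular as \<open>g\<close>.\<close>
  have "Ck_on n V g" for n
  proof (induction n)
    case 0
    show ?case using U unfolding homeomorphism_def by simp
  next
    case (Suc n)
    have dfg: "Ck_on n V (\<lambda>y. df (g y) v)" for v
    proof (rule Ck_on_compose[OF \<open>open V\<close> Cinf_open[OF f] _ Suc])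
      show "g ` V \<subseteq> W" using gV UW by blast
      show "Ck_on n W (\<lambda>y. df y v)" using Cinf_deriv[OF f] unfolding Cinf_def df_def by blast
    qed
    have "Ck_on n V (\<lambda>y. w + ((w \<bullet> e + (- 1) * df (g y) w) * inverse (df (g y) e)) *\<^sub>R e)" for w
      using gV U unfolding W'_def by (intro Ck_on_add Ck_on_scaleR Ck_on_mult Ck_on_inverse Ck_on_const dfg \<open>open V\<close>) auto
    then show ?case
      by (intro Ck_on_SucI[OF \<open>open V\<close> g']) (simp_all add: Di_def divide_inverse)
  qed
  then have "Cinf V g" using \<open>open V\<close> by (simp add: Cinf_def)
  with U UW that show ?thesis unfolding \<Psi>_def by blast
qed

section \<open>Charts, smooth functions and tangent vectors\<close>

lemma is_chartD:
  assumes "is_chart X (U, \<phi>, E)"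
  shows "openin X U" "subspace E" "openin (top_of_set E) (\<phi> ` U)"
    "homeomorphic_map (subtopology X U) (top_of_set (\<phi> ` U)) \<phi>" "U \<subseteq> topspace X" "inj_on \<phi> U" "\<phi> ` U \<subseteq> E"
proof -
  show "openin X U" "subspace E" "openin (top_of_set E) (\<phi> ` U)"
    and h: "homeomorphic_map (subtopology X U) (top_of_set (\<phi> ` U)) \<phi>"
    using assms by (auto simp: is_chart_def)
  then show UX: "U \<subseteq> topspace X" and "\<phi> ` U \<subseteq> E" by (auto dest: openin_subset openin_imp_subset)
  show "inj_on \<phi> U"
    using homeomorphic_imp_injective_map[OF h] UX by (simp add: inf_absorb2)
qed

lemma chart_open_image:
  assumes "is_chart X (U, \<phi>, E)" "openin X W"
  shows "openin (top_of_set E) (\<phi> ` (U \<inter> W))"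
proof -
  note c = is_chartD[OF assms(1)]
  have "openin (subtopology X U) (U \<inter> W)" using assms(2) by (auto simp: openin_subtopology)
  then have "openin (top_of_set (\<phi> ` U)) (\<phi> ` (U \<inter> W))"
    using homeomorphic_imp_open_map[OF c(4)] by (simp add: open_map_def)
  then show ?thesis using c(3) openin_trans by blast
qed

lemma chart_open_preimage:
  assumes "is_chart X (U, \<phi>, E)" "open T"
  shows "openin X {p \<in> U. \<phi> p \<in> T}"
proof -
  note c = is_chartD[OF assms(1)]
  have "continuous_map (subtopology X U) (top_of_set (\<phi> ` U)) \<phi>"
    by (rule homeomorphic_imp_continuous_map[OF c(4)])
  then have "continuous_map (subtopology X U) euclidean \<phi>" by (simp add: continuous_map_in_subtopology)
  then have "openin (subtopology X U) {p \<in> topspace (subtopology X U). \<phi> p \<in> T}"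
    using assms(2) by (intro openin_continuous_map_preimage[where Y = euclidean]) auto
  moreover have "{p \<in> topspace (subtopology X U). \<phi> p \<in> T} = {p \<in> U. \<phi> p \<in> T}"
    using c(5) by auto
  ultimately show ?thesis using c(1) openin_trans_full by metis
qed

lemma chart_inverse_continuous:
  assumes "is_chart X (U, \<phi>, E)"
  shows "continuous_map (top_of_set (\<phi> ` U)) X (inv_into U \<phi>)"
proof -
  note c = is_chartD[OF assms]
  obtain g where g: "continuous_map (top_of_set (\<phi> ` U)) (subtopology X U) g" "\<And>p. p \<in> U \<Longrightarrow> g (\<phi> p) = p"
    using c(4,5) by (auto simp: homeomorphic_map_maps homeomorphic_maps_def inf_absorb2)
  have "continuous_map (top_of_set (\<phi> ` U)) X g" using g(1) continuous_map_into_fulltopology by blast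
  moreover have "inv_into U \<phi> x = g x" if "x \<in> \<phi> ` U" for x using that g(2) c(6) by auto
  ultimately show ?thesis by (metis (no_types, lifting) continuous_map_eq topspace_euclidean_subtopology)
qed

lemma smooth_on_chart_change:
  assumes "inj_on \<phi> U" "inj_on \<psi> V"
    and "smooth_on (\<phi> ` (U \<inter> V)) (\<psi> \<circ> inv_into U \<phi> :: _ \<Rightarrow> 'f::euclidean_space)" "smooth_on (\<psi> ` (V \<inter> W)) (f \<circ> inv_into V \<psi>)"
  shows "smooth_on (\<phi> ` (U \<inter> V \<inter> W)) (f \<circ> inv_into U \<phi>)"
proof -
  have "smooth_on (\<phi> ` (U \<inter> V \<inter> W)) (\<lambda>x. (f \<circ> inv_into V \<psi>) ((\<psi> \<circ> inv_into U \<phi>) x))"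
    by (rule smooth_on_compose[OF smooth_on_subset[OF assms(3)] assms(4)]) (use assms(1) in auto)
  then show ?thesis
    by (rule smooth_on_cong) (use assms(1,2) in auto)
qed

text \<open>Allows smoothness in one chart to be tested on overlaps with others: the image of an
  open \<open>T\<close> is cut out of \<open>E\<close> by an ambient open set, and injectivity of
  the chart turns membership there back into membership in \<open>T\<close>.\<close>

lemma smooth_on_chart_local:
  assumes c: "is_chart X (U, \<phi>, E)"
    and "\<And>p. p \<in> U \<inter> W \<Longrightarrow> \<exists>T. openin X T \<and> p \<in> T \<and> smooth_on (\<phi> ` (U \<inter> T \<inter> W)) g"
  shows "smooth_on (\<phi> ` (U \<inter> W)) g"
proof (rule smooth_on_local)
  fix x assume "x \<in> \<phi> ` (U \<inter> W)"
  then obtain p where p: "p \<in> U \<inter> W" "x = \<phi> p" by blast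
  then obtain T where T: "openin X T" "p \<in> T" "smooth_on (\<phi> ` (U \<inter> T \<inter> W)) g" using assms by blast
  obtain S where S: "open S" "\<phi> ` (U \<inter> T) = E \<inter> S"
    using chart_open_image[OF c T(1)] by (auto simp: openin_open)
  have "\<phi> ` (U \<inter> W) \<inter> S \<subseteq> \<phi> ` (U \<inter> T \<inter> W)"
  proof
    fix y assume "y \<in> \<phi> ` (U \<inter> W) \<inter> S"
    then obtain q where q: "q \<in> U \<inter> W" "y = \<phi> q" "\<phi> q \<in> S" by blast
    then have "\<phi> q \<in> \<phi> ` (U \<inter> T)" using S(2) is_chartD(7)[OF c] by auto
    then have "q \<in> T" using is_chartD(6)[OF c] q(1) by (auto dest: inj_onD)
    then show "y \<in> \<phi> ` (U \<inter> T \<inter> W)" using q by blast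
  qed
  then have "smooth_on (\<phi> ` (U \<inter> W) \<inter> S) g" using T(3) smooth_on_subset by blast
  moreover have "x \<in> S" using p T(2) S(2) by blast
  ultimately show "\<exists>S. open S \<and> x \<in> S \<and> smooth_on (\<phi> ` (U \<inter> W) \<inter> S) g" using S(1) by blast
qed

lemma smooth_map_curve_iff:
  fixes I :: "'t::euclidean_space set" and M :: "('a, 'e::euclidean_space) mfd"
  shows "smooth_map (euclid_mfd I) M \<gamma> \<longleftrightarrow> continuous_map (top_of_set I) (mtop M) \<gamma> \<and>
    (\<forall>(V, \<psi>, E)\<in>charts M. smooth_on (I \<inter> \<gamma> -` V) (\<psi> \<circ> \<gamma>))"
proof -
  have inv: "inv_into I id t = t" if "t \<in> I" for t
    using inv_into_f_f[of id I t] that by simp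
  have "smooth_on (I \<inter> \<gamma> -` V) (\<psi> \<circ> \<gamma> \<circ> inv_into I id) \<longleftrightarrow> smooth_on (I \<inter> \<gamma> -` V) (\<psi> \<circ> \<gamma>)" for V and \<psi> :: "'a \<Rightarrow> 'e"
    by (auto intro: smooth_on_cong simp: inv)
  then show ?thesis by (simp add: smooth_map_def euclid_mfd_def)
qed

section \<open>Working with arbitrary charts of the maximal atlas\<close>

locale smooth_mfd =
  fixes M :: "('a, 'e::euclidean_space) mfd" and n :: nat
  assumes mfd: "manifold_of_dim n M"
begin

abbreviation atlas where "atlas \<equiv> maximal_atlas M"

lemma chart_is_chart: "c \<in> charts M \<Longrightarrow> is_chart (mtop M) c"
  using mfd by (simp add: manifold_of_dim_def)

lemma charts_maximal: "c \<in> charts M \<Longrightarrow> c \<in> atlas"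
  using mfd by (auto simp: manifold_of_dim_def maximal_atlas_def)

lemma maximal_is_chart: "c \<in> atlas \<Longrightarrow> is_chart (mtop M) c"
  by (simp add: maximal_atlas_def)

lemmas maximalD = is_chartD[OF maximal_is_chart]

lemma chart_cover:
  assumes "p \<in> points M"
  obtains V \<psi> E' where "(V, \<psi>, E') \<in> charts M" "p \<in> V"
proof -
  have "p \<in> (\<Union>(U, \<phi>, E)\<in>charts M. U)" using mfd assms by (simp add: manifold_of_dim_def)
  then show ?thesis using that by auto
qed

lemma smooth_on_atlas_local:
  assumes c: "(U, \<phi>, E) \<in> atlas"
    and g: "\<And>T \<kappa> F. (T, \<kappa>, F) \<in> charts M \<Longrightarrow> smooth_on (\<phi> ` (U \<inter> T \<inter> W)) g"
  shows "smooth_on (\<phi> ` (U \<inter> W)) g"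
proof (rule smooth_on_chart_local[OF maximal_is_chart[OF c]])
  fix p assume "p \<in> U \<inter> W"
  then obtain T \<kappa> F where e: "(T, \<kappa>, F) \<in> charts M" "p \<in> T"
    using chart_cover maximalD(5)[OF c] by blast
  then show "\<exists>T. openin (mtop M) T \<and> p \<in> T \<and> smooth_on (\<phi> ` (U \<inter> T \<inter> W)) g"
    using g[OF e(1)] maximalD(1)[OF charts_maximal[OF e(1)]] by blast
qed

text \<open>Compatibility is given only with the charts of the original atlas, so near each point
  the transition is factored through one of these.\<close>

lemma maximal_transition:
  assumes c: "(U, \<phi>, E) \<in> atlas" and d: "(V, \<psi>, E') \<in> atlas"
  shows "smooth_on (\<phi> ` (U \<inter> V)) (\<psi> \<circ> inv_into U \<phi>)"
proof (rule smooth_on_atlas_local[OF c])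
  fix T \<kappa> F assume e: "(T, \<kappa>, F) \<in> charts M"
  have "smooth_on (\<phi> ` (U \<inter> T)) (\<kappa> \<circ> inv_into U \<phi>)" "smooth_on (\<kappa> ` (T \<inter> V)) (\<psi> \<circ> inv_into T \<kappa>)"
    using c d e by (auto simp: maximal_atlas_def smooth_transition_def)
  then show "smooth_on (\<phi> ` (U \<inter> T \<inter> V)) (\<psi> \<circ> inv_into U \<phi>)"
    by (rule smooth_on_chart_change[OF maximalD(6)[OF c] maximalD(6)[OF charts_maximal[OF e]]])
qed

lemma smooth_fun_on_maximal:
  assumes f: "smooth_fun_on M W f" and c: "(U, \<phi>, E) \<in> atlas"
  shows "smooth_on (\<phi> ` (U \<inter> W)) (f \<circ> inv_into U \<phi>)"
proof (rule smooth_on_atlas_local[OF c])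
  fix T \<kappa> F assume e: "(T, \<kappa>, F) \<in> charts M"
  then have "smooth_on (\<kappa> ` (T \<inter> W)) (f \<circ> inv_into T \<kappa>)"
    using f by (auto simp: smooth_fun_on_def)
  then show "smooth_on (\<phi> ` (U \<inter> T \<inter> W)) (f \<circ> inv_into U \<phi>)"
    by (rule smooth_on_chart_change[OF maximalD(6)[OF c] maximalD(6)[OF charts_maximal[OF e]]
          maximal_transition[OF c charts_maximal[OF e]]])
qed

text \<open>One conveniently chosen compatible chart at each point suffices; the charts of the atlas
  follow by a change of coordinates.\<close>

lemma smooth_fun_onI:
  assumes "\<And>p. p \<in> W \<Longrightarrow> \<exists>(U, \<phi>, E)\<in>atlas. p \<in> U \<and> smooth_on (\<phi> ` (U \<inter> W)) (f \<circ> inv_into U \<phi>)"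
  shows "smooth_fun_on M W f"
  unfolding smooth_fun_on_def
proof clarify
  fix V \<psi> E' assume d: "(V, \<psi>, E') \<in> charts M"
  show "smooth_on (\<psi> ` (V \<inter> W)) (f \<circ> inv_into V \<psi>)"
  proof (rule smooth_on_chart_local[OF chart_is_chart[OF d]])
    fix p assume "p \<in> V \<inter> W"
    then obtain U \<phi> E where c: "(U, \<phi>, E) \<in> atlas" "p \<in> U" "smooth_on (\<phi> ` (U \<inter> W)) (f \<circ> inv_into U \<phi>)"
      using assms by blast
    have "smooth_on (\<psi> ` (V \<inter> U \<inter> W)) (f \<circ> inv_into V \<psi>)"
      by (rule smooth_on_chart_change[OF maximalD(6)[OF charts_maximal[OF d]] maximalD(6)[OF c(1)]
          maximal_transition[OF charts_maximal[OF d] c(1)] c(3)])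
    then show "\<exists>T. openin (mtop M) T \<and> p \<in> T \<and> smooth_on (\<psi> ` (V \<inter> T \<inter> W)) (f \<circ> inv_into V \<psi>)"
      using c maximalD(1) by blast
  qed
qed

lemma smooth_near_chart:
  assumes "smooth_near M p f" and c: "(U, \<phi>, E) \<in> atlas" and "p \<in> U"
  obtains W where "openin (mtop M) W" "p \<in> W" "W \<subseteq> U" "smooth_on (\<phi> ` W) (f \<circ> inv_into U \<phi>)"
    "openin (top_of_set E) (\<phi> ` W)"
proof -
  obtain W where W: "openin (mtop M) W" "p \<in> W" "smooth_fun_on M W f"
    using assms(1) by (auto simp: smooth_near_def)
  have "openin (mtop M) (U \<inter> W)" using W maximalD(1)[OF c] by blast
  then show ?thesis
    using that[of "U \<inter> W"] W smooth_fun_on_maximal[OF W(3) c] \<open>p \<in> U\<close>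
      chart_open_image[OF maximal_is_chart[OF c] W(1)] by blast
qed

lemma smooth_near_coord:
  assumes c: "(U, \<phi>, E) \<in> atlas" and "p \<in> U"
  shows "smooth_near M p (\<lambda>q. \<phi> q \<bullet> b)"
proof -
  have "smooth_on (\<phi> ` (U \<inter> U)) ((\<lambda>q. \<phi> q \<bullet> b) \<circ> inv_into U \<phi>)"
    by (rule smooth_on_cong[OF smooth_on_linear[OF bounded_linear_inner_left[of b]]]) (auto simp: f_inv_into_f)
  then have "smooth_fun_on M U (\<lambda>q. \<phi> q \<bullet> b)"
    using c by (intro smooth_fun_onI) blast
  then show ?thesis using maximalD(1)[OF c] \<open>p \<in> U\<close> by (auto simp: smooth_near_def)
qed

lemma has_derivative_coord_curve:
  assumes "smooth_near M p f" and c: "(U, \<phi>, E) \<in> atlas" and "p \<in> U" "a \<in> E"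
  shows "((\<lambda>t. f (inv_into U \<phi> (\<phi> p + t *\<^sub>R a))) has_real_derivative dderiv (f \<circ> inv_into U \<phi>) (\<phi> p) a) (at 0)"
proof -
  obtain W where W: "openin (mtop M) W" "p \<in> W" "W \<subseteq> U" "smooth_on (\<phi> ` W) (f \<circ> inv_into U \<phi>)"
      "openin (top_of_set E) (\<phi> ` W)"
    by (rule smooth_near_chart[OF assms(1-3)])
  then show ?thesis
    using dderiv_works[OF maximalD(2)[OF c] W(5,4), of "\<phi> p" a] \<open>a \<in> E\<close>
    by (simp add: has_real_derivative_iff_has_vector_derivative)
qed

text \<open>The case distinction repeats the default value of \<open>velocity\<close>, so this is an
  equality of tangent vectors as functions and not merely on smooth arguments.\<close>

lemma coord_field_eq:
  assumes c: "(U, \<phi>, E) \<in> atlas" and "p \<in> U" "a \<in> E"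
  shows "coord_field M (U, \<phi>, E) a p = (\<lambda>f. if smooth_near M p f then dderiv (f \<circ> inv_into U \<phi>) (\<phi> p) a else 0)"
  using DERIV_imp_deriv[OF has_derivative_coord_curve[OF _ assms]] maximalD(6)[OF c] \<open>p \<in> U\<close>
  by (auto simp: coord_field_def velocity_def)

lemma coord_field_tangent:
  assumes c: "(U, \<phi>, E) \<in> atlas" and "p \<in> U" "a \<in> E"
  shows "coord_field M (U, \<phi>, E) a p \<in> tangent_space M p"
proof -
  define \<gamma> where "\<gamma> t = inv_into U \<phi> (\<phi> p + t *\<^sub>R a)" for t
  note cD = maximalD[OF c]
  have "\<forall>\<^sub>F t in nhds 0. \<phi> p + t *\<^sub>R a \<in> \<phi> ` U"
    using eventually_line_in[OF cD(3,2)] assms by blast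
  then obtain \<epsilon> where \<epsilon>: "\<epsilon> > 0" "\<And>t. \<bar>t\<bar> < \<epsilon> \<Longrightarrow> \<phi> p + t *\<^sub>R a \<in> \<phi> ` U"
    by (auto simp: eventually_nhds_metric)
  define I where "I = {-\<epsilon><..<\<epsilon>}"
  have I: "\<phi> p + t *\<^sub>R a \<in> \<phi> ` U" if "t \<in> I" for t using \<epsilon>(2)[of t] that by (auto simp: I_def abs_less_iff)
  have "continuous_map (top_of_set I) (top_of_set (\<phi> ` U)) (\<lambda>t. \<phi> p + t *\<^sub>R a)"
    using I by (auto simp: continuous_map_in_subtopology intro!: continuous_intros)
  from continuous_map_compose[OF this chart_inverse_continuous[OF maximal_is_chart[OF c]]]
  have "continuous_map (top_of_set I) (mtop M) \<gamma>"
    by (simp add: \<gamma>_def[abs_def] o_def)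
  moreover have "smooth_on (I \<inter> \<gamma> -` V) (\<psi> \<circ> \<gamma>)" if d: "(V, \<psi>, E') \<in> charts M" for V \<psi> E'
  proof -
    have "smooth_on (I \<inter> \<gamma> -` V) (\<lambda>t. \<phi> p + t *\<^sub>R a)"
      by (intro smooth_on_add smooth_on_const smooth_on_linear bounded_linear_scaleR_left)
    moreover have "(\<lambda>t. \<phi> p + t *\<^sub>R a) ` (I \<inter> \<gamma> -` V) \<subseteq> \<phi> ` (U \<inter> V)"
    proof (rule image_subsetI)
      fix t assume "t \<in> I \<inter> \<gamma> -` V"
      then have t: "t \<in> I" "t \<in> \<gamma> -` V" by auto
      then obtain q where "q \<in> U" "\<phi> p + t *\<^sub>R a = \<phi> q" using I by blast
      then show "\<phi> p + t *\<^sub>R a \<in> \<phi> ` (U \<inter> V)" using t(2) cD(6) by (auto simp: \<gamma>_def)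
    qed
    ultimately show ?thesis
      using smooth_on_compose[OF _ maximal_transition[OF c charts_maximal[OF d]]] by (simp add: \<gamma>_def[abs_def] o_def)
  qed
  ultimately have "smooth_map (euclid_mfd I) M \<gamma>" by (auto simp: smooth_map_curve_iff)
  moreover have "\<gamma> 0 = p" using cD(6) assms by (simp add: \<gamma>_def)
  ultimately show ?thesis
    using \<epsilon>(1) unfolding tangent_space_def coord_field_def \<gamma>_def I_def by auto
qed

text \<open>A curve acts on functions like the coordinate line with the same coordinate velocity.
  Together with \<open>coord_field_tangent\<close> this identifies the tangent space with
  \<open>E\<close>, and it is the way in which tangent vectors are handled from here on.\<close>

lemma tangent_coord:
  assumes v: "v \<in> tangent_space M p" and c: "(U, \<phi>, E) \<in> atlas" and p: "p \<in> U"
  obtains a where "a \<in> E" "v = coord_field M (U, \<phi>, E) a p"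
proof -
  obtain \<gamma> \<epsilon> where \<gamma>: "v = velocity M \<gamma>" "\<gamma> 0 = p" "\<epsilon> > 0" "smooth_map (euclid_mfd {-\<epsilon><..<\<epsilon>}) M \<gamma>"
    using v by (auto simp: tangent_space_def)
  define I where "I = {-\<epsilon><..<\<epsilon>}"
  have cont: "continuous_map (top_of_set I) (mtop M) \<gamma>" using \<gamma> by (simp add: I_def smooth_map_curve_iff)
  have openI: "open {t \<in> I. \<gamma> t \<in> W}" if "openin (mtop M) W" for W
    using openin_continuous_map_preimage[OF cont that] by (simp add: I_def openin_open_eq)
  note cD = maximalD[OF c]
  \<comment> \<open>The curve is known to be smooth only in charts of the original atlas; smoothness
    in the compatible chart \<open>\<phi>\<close> is obtained through \<open>\<psi>\<close>.\<close>
  obtain V \<psi> E' where d: "(V, \<psi>, E') \<in> charts M" "p \<in> V" using chart_cover cD(5) p by blast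
  note dm = charts_maximal[OF d(1)]
  define A where "A = {t \<in> I. \<gamma> t \<in> U \<inter> V}"
  have A: "openin (top_of_set UNIV) A" "0 \<in> A"
    using openI[of "U \<inter> V"] cD(1) maximalD(1)[OF dm] \<gamma> p d by (auto simp: A_def I_def)
  have smooth\<psi>: "smooth_on (I \<inter> \<gamma> -` V) (\<psi> \<circ> \<gamma>)" using \<gamma>(4) d by (auto simp: smooth_map_curve_iff I_def)
  have "smooth_on A (\<lambda>t. (\<phi> \<circ> inv_into V \<psi>) ((\<psi> \<circ> \<gamma>) t))"
    by (rule smooth_on_compose[OF smooth_on_subset[OF smooth\<psi>] maximal_transition[OF dm c]]) (auto simp: A_def)
  then have smooth: "smooth_on A (\<phi> \<circ> \<gamma>)"
    by (rule smooth_on_cong) (use maximalD(6)[OF dm] in \<open>auto simp: A_def\<close>)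
  define a where "a = dderiv (\<phi> \<circ> \<gamma>) 0 1"
  have a: "a \<in> E" unfolding a_def
    by (rule dderiv_in_subspace[OF subspace_UNIV A(1) smooth _ cD(2) A(2)]) (use cD(7) in \<open>auto simp: A_def\<close>)
  have deriv_a: "(\<phi> \<circ> \<gamma> has_vector_derivative a) (at 0)"
    using dderiv_works[OF subspace_UNIV A(1) smooth A(2), of 1] by (simp add: a_def o_def)
  have "deriv (\<lambda>t. f (\<gamma> t)) 0 = dderiv (f \<circ> inv_into U \<phi>) (\<phi> p) a" if f: "smooth_near M p f" for f
  proof -
    obtain W where W: "openin (mtop M) W" "p \<in> W" "W \<subseteq> U" "smooth_on (\<phi> ` W) (f \<circ> inv_into U \<phi>)"
        "openin (top_of_set E) (\<phi> ` W)"
      by (rule smooth_near_chart[OF f c p])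
    have ev: "\<forall>\<^sub>F t in nhds 0. \<gamma> t \<in> W"
      using openI[OF W(1)] \<gamma> W(2) unfolding eventually_nhds by (intro exI[of _ "{t \<in> I. \<gamma> t \<in> W}"]) (auto simp: I_def)
    then have "\<forall>\<^sub>F t in nhds 0. (\<phi> \<circ> \<gamma>) t \<in> \<phi> ` W" by eventually_elim simp
    from dderiv_curve[OF cD(2) W(5,4) _ deriv_a a this] have
      "((\<lambda>t. (f \<circ> inv_into U \<phi>) ((\<phi> \<circ> \<gamma>) t)) has_vector_derivative dderiv (f \<circ> inv_into U \<phi>) (\<phi> p) a) (at 0)"
      using W(2) \<gamma>(2) by simp
    moreover have eq: "\<forall>\<^sub>F t in nhds 0. f (\<gamma> t) = (f \<circ> inv_into U \<phi>) ((\<phi> \<circ> \<gamma>) t)"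
      using ev by eventually_elim (use W(3) cD(6) in auto)
    ultimately have "((\<lambda>t. f (\<gamma> t)) has_vector_derivative dderiv (f \<circ> inv_into U \<phi>) (\<phi> p) a) (at 0)"
      using eventually_nhds_x_imp_x[OF eq]
      by (subst has_vector_derivative_cong_ev[where g = "\<lambda>t. (f \<circ> inv_into U \<phi>) ((\<phi> \<circ> \<gamma>) t)"]) auto
    then show ?thesis by (simp add: DERIV_imp_deriv has_real_derivative_iff_has_vector_derivative)
  qed
  then have "v = coord_field M (U, \<phi>, E) a p"
    unfolding coord_field_eq[OF c p a] \<gamma>(1) velocity_def \<gamma>(2) by auto
  with a show ?thesis by (rule that)
qed

lemma coord_vec_coord_field:
  assumes c: "(U, \<phi>, E) \<in> atlas" and p: "p \<in> U" and a: "a \<in> E"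
  shows "coord_vec (U, \<phi>, E) (coord_field M (U, \<phi>, E) a p) = a"
proof -
  note cD = maximalD[OF c]
  have "coord_field M (U, \<phi>, E) a p (\<lambda>q. \<phi> q \<bullet> b) = a \<bullet> b" for b
  proof -
    have "dderiv ((\<lambda>q. \<phi> q \<bullet> b) \<circ> inv_into U \<phi>) (\<phi> p) a = dderiv (\<lambda>x. x \<bullet> b) (\<phi> p) a"
      by (rule dderiv_cong[OF cD(2,3) _ smooth_on_linear[OF bounded_linear_inner_left]])
        (use p a in \<open>auto simp: f_inv_into_f\<close>)
    also have "((\<lambda>t. (\<phi> p + t *\<^sub>R a) \<bullet> b) has_vector_derivative a \<bullet> b) (at 0)"
      by (auto intro!: derivative_eq_intros simp: has_vector_derivative_def inner_add_left)
    then have "dderiv (\<lambda>x. x \<bullet> b) (\<phi> p) a = a \<bullet> b" by (rule dderiv_unique[OF cD(2,3)])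
    finally show ?thesis by (simp add: coord_field_eq[OF assms] smooth_near_coord[OF c p])
  qed
  then show ?thesis by (simp add: coord_vec_def euclidean_representation)
qed

lemma coord_field_add_scale:
  assumes c: "(U, \<phi>, E) \<in> atlas" and p: "p \<in> U" and a: "a \<in> E" and b: "b \<in> E"
  shows "coord_field M (U, \<phi>, E) (r *\<^sub>R a + b) p =
    tadd (tscale r (coord_field M (U, \<phi>, E) a p)) (coord_field M (U, \<phi>, E) b p)"
proof -
  have rab: "r *\<^sub>R a + b \<in> E" using a b maximalD(2)[OF c] by (simp add: subspace_add subspace_scale)
  have "dderiv (f \<circ> inv_into U \<phi>) (\<phi> p) (r *\<^sub>R a + b) =
      r * dderiv (f \<circ> inv_into U \<phi>) (\<phi> p) a + dderiv (f \<circ> inv_into U \<phi>) (\<phi> p) b" if f: "smooth_near M p f" for f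
  proof -
    obtain W where W: "openin (mtop M) W" "p \<in> W" "W \<subseteq> U" "smooth_on (\<phi> ` W) (f \<circ> inv_into U \<phi>)"
        "openin (top_of_set E) (\<phi> ` W)"
      by (rule smooth_near_chart[OF f c p])
    from dderiv_add_scale[OF maximalD(2)[OF c] W(5,4) _ a b] W(2) show ?thesis by simp
  qed
  then show ?thesis
    by (auto simp: coord_field_eq[OF c p] a b rab tadd_def tscale_def)
qed

text \<open>The chain rule for the transition map, applied to the coordinate expression of each test
  function on a neighbourhood where that expression is smooth.\<close>

lemma coord_field_change:
  assumes c: "(U, \<phi>, E) \<in> atlas" and d: "(V, \<psi>, E') \<in> atlas" and p: "p \<in> U \<inter> V" and a: "a \<in> E"
  shows "dderiv (\<psi> \<circ> inv_into U \<phi>) (\<phi> p) a \<in> E'"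
    and "coord_field M (U, \<phi>, E) a p = coord_field M (V, \<psi>, E') (dderiv (\<psi> \<circ> inv_into U \<phi>) (\<phi> p) a) p"
proof -
  let ?\<tau> = "\<psi> \<circ> inv_into U \<phi>"
  note cD = maximalD[OF c] and dD = maximalD[OF d]
  have UV: "openin (top_of_set E) (\<phi> ` (U \<inter> V))" by (rule chart_open_image[OF maximal_is_chart[OF c] dD(1)])
  have \<tau>: "?\<tau> ` (\<phi> ` (U \<inter> V)) \<subseteq> E'" using cD(6) dD(7) by auto
  show a': "dderiv ?\<tau> (\<phi> p) a \<in> E'"
    using dderiv_in_subspace[OF cD(2) UV maximal_transition[OF c d] \<tau> dD(2)] p a by blast
  have "dderiv (f \<circ> inv_into U \<phi>) (\<phi> p) a = dderiv (f \<circ> inv_into V \<psi>) (\<psi> p) (dderiv ?\<tau> (\<phi> p) a)"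
    if f: "smooth_near M p f" for f
  proof -
    obtain W where W: "openin (mtop M) W" "p \<in> W" "W \<subseteq> V" "smooth_on (\<psi> ` W) (f \<circ> inv_into V \<psi>)" "openin (top_of_set E') (\<psi> ` W)"
      using p by (auto intro: smooth_near_chart[OF f d])
    have A: "openin (top_of_set E) (\<phi> ` (U \<inter> W))" by (rule chart_open_image[OF maximal_is_chart[OF c] W(1)])
    have s\<tau>: "smooth_on (\<phi> ` (U \<inter> W)) ?\<tau>"
      by (rule smooth_on_subset[OF maximal_transition[OF c d]]) (use W(3) in auto)
    have im: "?\<tau> ` (\<phi> ` (U \<inter> W)) \<subseteq> \<psi> ` W" using cD(6) by auto
    have "dderiv (f \<circ> inv_into U \<phi>) (\<phi> p) a = dderiv (\<lambda>x. (f \<circ> inv_into V \<psi>) (?\<tau> x)) (\<phi> p) a"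
      by (rule dderiv_cong[OF cD(2) A _ smooth_on_compose[OF s\<tau> W(4) im]])
        (use cD(6) dD(6) W p a in auto)
    also have "\<dots> = dderiv (f \<circ> inv_into V \<psi>) (?\<tau> (\<phi> p)) (dderiv ?\<tau> (\<phi> p) a)"
      by (rule dderiv_compose[OF cD(2) A dD(2) W(5) s\<tau> im W(4) _ a]) (use p W in auto)
    finally show ?thesis using cD(6) p by simp
  qed
  then show "coord_field M (U, \<phi>, E) a p = coord_field M (V, \<psi>, E') (dderiv ?\<tau> (\<phi> p) a) p"
    using p by (auto simp: coord_field_eq[OF c _ a] coord_field_eq[OF d _ a'])
qed

end

section \<open>Differential forms in charts\<close>

text \<open>The standard basis of the ambient space need not lie in \<open>E\<close>, and only
  directions in \<open>E\<close> give tangent vectors, so expansions must use a basis inside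
  \<open>E\<close>.\<close>

lemma subspace_orthonormal_expansion:
  fixes E :: "'e::euclidean_space set"
  assumes "subspace E"
  obtains B where "finite B" "B \<subseteq> E" "\<And>v. v \<in> E \<Longrightarrow> (\<Sum>b\<in>B. (v \<bullet> b) *\<^sub>R b) = v"
proof -
  obtain B where B: "B \<subseteq> E" "pairwise orthogonal B" "\<And>x. x \<in> B \<Longrightarrow> norm x = 1" "independent B" "card B = dim E" "span B = E"
    using orthonormal_basis_subspace[OF assms] by blast
  have "finite B" using B(4) by (rule independent_imp_finite)
  then show ?thesis
    using that B orthonormal_basis_expand[OF B(2,3)] by blast
qed

lemma linear_on_subspace_sum:
  fixes l :: "'e::real_vector \<Rightarrow> real"
  assumes E: "subspace E" and l: "\<And>r a b. a \<in> E \<Longrightarrow> b \<in> E \<Longrightarrow> l (r *\<^sub>R a + b) = r * l a + l b"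
    and "finite B" "B \<subseteq> E"
  shows "l (\<Sum>b\<in>B. s b *\<^sub>R b) = (\<Sum>b\<in>B. s b * l b)"
  using assms(3,4)
proof induction
  case empty
  show ?case using l[of 0 0 1] subspace_0[OF E] by simp
next
  case (insert b B)
  have "(\<Sum>b\<in>B. s b *\<^sub>R b) \<in> E"
    using insert.prems by (intro subspace_sum[OF E] subspace_scale[OF E]) auto
  with insert show ?case by (simp add: l)
qed

lemma differential_form_1_linear:
  assumes "differential_form M 1 \<theta>" "p \<in> points M" "u \<in> tangent_space M p" "w \<in> tangent_space M p"
  shows "\<theta> p [tadd (tscale r u) w] = r * \<theta> p [u] + \<theta> p [w]"
proof -
  have "\<forall>i<1. \<forall>r. \<forall>u\<in>tangent_space M p. \<forall>w\<in>tangent_space M p.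
      \<theta> p ([u][i := tadd (tscale r u) w]) = r * \<theta> p ([u][i := u]) + \<theta> p ([u][i := w])"
    using assms unfolding differential_form_def by (elim conjE) (drule bspec, assumption, drule spec[of _ "[u]"], simp)
  then show ?thesis using assms by (auto dest!: spec[of _ "0::nat"])
qed

lemma differential_form_2_linear:
  assumes "differential_form M 2 \<omega>" "p \<in> points M" "u \<in> tangent_space M p" "w \<in> tangent_space M p" "z \<in> tangent_space M p"
  shows "\<omega> p [tadd (tscale r u) w, z] = r * \<omega> p [u, z] + \<omega> p [w, z]"
    and "\<omega> p [z, tadd (tscale r u) w] = r * \<omega> p [z, u] + \<omega> p [z, w]"
    and "\<omega> p [z, z] = 0"
proof -
  \<comment> \<open>The one list \<open>[z, z]\<close> serves all claims: updating a slot gives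
    linearity in it, and the equal entries give the vanishing.\<close>
  have *: "(\<forall>i<2. \<forall>r. \<forall>u\<in>tangent_space M p. \<forall>w\<in>tangent_space M p.
      \<omega> p ([z, z][i := tadd (tscale r u) w]) = r * \<omega> p ([z, z][i := u]) + \<omega> p ([z, z][i := w])) \<and>
      (\<forall>i<2. \<forall>j<2. i \<noteq> j \<and> [z, z] ! i = [z, z] ! j \<longrightarrow> \<omega> p [z, z] = 0)"
    using assms unfolding differential_form_def by (elim conjE) (drule bspec, assumption, drule spec[of _ "[z, z]"], simp)
  show "\<omega> p [tadd (tscale r u) w, z] = r * \<omega> p [u, z] + \<omega> p [w, z]"
    using conjunct1[OF *, rule_format, of 0 u w r] assms by simp
  show "\<omega> p [z, tadd (tscale r u) w] = r * \<omega> p [z, u] + \<omega> p [z, w]"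
    using conjunct1[OF *, rule_format, of 1 u w r] assms by simp
  show "\<omega> p [z, z] = 0"
    using conjunct2[OF *, rule_format, of 0 1] by simp
qed

lemma differential_form_smooth:
  assumes "differential_form M k \<alpha>" "(V, \<psi>, E) \<in> charts M" "length as = k" "set as \<subseteq> E"
  shows "smooth_fun_on M V (\<lambda>q. \<alpha> q (map (\<lambda>a. coord_field M (V, \<psi>, E) a q) as))"
proof -
  have "\<forall>(U, \<phi>, E)\<in>charts M. \<forall>as. length as = k \<and> set as \<subseteq> E \<longrightarrow>
      smooth_fun_on M U (\<lambda>q. \<alpha> q (map (\<lambda>a. coord_field M (U, \<phi>, E) a q) as))"
    using assms(1) by (simp add: differential_form_def)
  from bspec[OF this assms(2)] show ?thesis using assms(3,4) by simp
qed

lemma ext_d_pair: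
  "ext_d M \<theta> p [u, w] = (let c = (SOME c. c \<in> charts M \<and> p \<in> fst c)
    in u (\<lambda>q. \<theta> q [coord_field M c (coord_vec c w) q]) - w (\<lambda>q. \<theta> q [coord_field M c (coord_vec c u) q]))"
proof -
  have "{..<length [u, w]} = {0, 1}" by auto
  then show ?thesis by (simp add: ext_d_def Let_def)
qed

context smooth_mfd
begin

lemma one_form_linear:
  assumes "differential_form M 1 \<theta>" and c: "(U, \<phi>, E) \<in> atlas" and p: "p \<in> U" and ab: "a \<in> E" "b \<in> E"
  shows "\<theta> p [coord_field M (U, \<phi>, E) (r *\<^sub>R a + b) p] = r * \<theta> p [coord_field M (U, \<phi>, E) a p] + \<theta> p [coord_field M (U, \<phi>, E) b p]"
  unfolding coord_field_add_scale[OF c p ab]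
  using maximalD(5)[OF c] p ab by (intro differential_form_1_linear[OF assms(1)] coord_field_tangent[OF c]) auto

lemma two_form_linear:
  assumes "differential_form M 2 \<omega>" and c: "(U, \<phi>, E) \<in> atlas" and p: "p \<in> U" and ab: "a \<in> E" "b \<in> E"
    and z: "z \<in> tangent_space M p"
  shows "\<omega> p [coord_field M (U, \<phi>, E) (r *\<^sub>R a + b) p, z] = r * \<omega> p [coord_field M (U, \<phi>, E) a p, z] + \<omega> p [coord_field M (U, \<phi>, E) b p, z]"
    "\<omega> p [z, coord_field M (U, \<phi>, E) (r *\<^sub>R a + b) p] = r * \<omega> p [z, coord_field M (U, \<phi>, E) a p] + \<omega> p [z, coord_field M (U, \<phi>, E) b p]"
  unfolding coord_field_add_scale[OF c p ab]
  using maximalD(5)[OF c] p ab z by (intro differential_form_2_linear[OF assms(1)] coord_field_tangent[OF c]; auto)+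

text \<open>Separates the part that varies with the transition map from the finitely many
  coefficients of the form in the chart \<open>\<psi>\<close>; only those coefficients are known to
  be smooth.\<close>

lemma one_form_change:
  assumes \<theta>: "differential_form M 1 \<theta>" and c: "(U, \<phi>, E) \<in> atlas" and d: "(V, \<psi>, E') \<in> atlas"
    and p: "p \<in> U \<inter> V" and a: "a \<in> E"
    and B: "finite B" "B \<subseteq> E'" "\<And>v. v \<in> E' \<Longrightarrow> (\<Sum>b\<in>B. (v \<bullet> b) *\<^sub>R b) = v"
  shows "\<theta> p [coord_field M (U, \<phi>, E) a p] =
    (\<Sum>b\<in>B. (dderiv (\<psi> \<circ> inv_into U \<phi>) (\<phi> p) a \<bullet> b) * \<theta> p [coord_field M (V, \<psi>, E') b p])"
proof -
  note ch = coord_field_change[OF c d p a]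
  have "\<theta> p [coord_field M (V, \<psi>, E') (\<Sum>b\<in>B. (dderiv (\<psi> \<circ> inv_into U \<phi>) (\<phi> p) a \<bullet> b) *\<^sub>R b) p] =
    (\<Sum>b\<in>B. (dderiv (\<psi> \<circ> inv_into U \<phi>) (\<phi> p) a \<bullet> b) * \<theta> p [coord_field M (V, \<psi>, E') b p])"
    by (rule linear_on_subspace_sum[OF maximalD(2)[OF d] one_form_linear[OF \<theta> d] B(1,2)]) (use p in auto)
  then show ?thesis unfolding B(3)[OF ch(1)] ch(2) .
qed

lemma two_form_change:
  assumes \<omega>: "differential_form M 2 \<omega>" and c: "(U, \<phi>, E) \<in> atlas" and d: "(V, \<psi>, E') \<in> atlas"
    and p: "p \<in> U \<inter> V" and a: "a \<in> E" "a' \<in> E"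
    and B: "finite B" "B \<subseteq> E'" "\<And>v. v \<in> E' \<Longrightarrow> (\<Sum>b\<in>B. (v \<bullet> b) *\<^sub>R b) = v"
  shows "\<omega> p [coord_field M (U, \<phi>, E) a p, coord_field M (U, \<phi>, E) a' p] =
    (\<Sum>b\<in>B. \<Sum>b'\<in>B. (dderiv (\<psi> \<circ> inv_into U \<phi>) (\<phi> p) a \<bullet> b) * ((dderiv (\<psi> \<circ> inv_into U \<phi>) (\<phi> p) a' \<bullet> b') *
      \<omega> p [coord_field M (V, \<psi>, E') b p, coord_field M (V, \<psi>, E') b' p]))"
proof -
  let ?D = "dderiv (\<psi> \<circ> inv_into U \<phi>) (\<phi> p)" and ?cf = "\<lambda>b. coord_field M (V, \<psi>, E') b p"
  note ch = coord_field_change[OF c d p]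
  have pV: "p \<in> V" using p by simp
  have tan: "?cf b \<in> tangent_space M p" if "b \<in> E'" for b by (rule coord_field_tangent[OF d pV that])
  have 1: "\<omega> p [?cf (\<Sum>b\<in>B. (?D a \<bullet> b) *\<^sub>R b), ?cf (?D a')] = (\<Sum>b\<in>B. (?D a \<bullet> b) * \<omega> p [?cf b, ?cf (?D a')])"
    by (rule linear_on_subspace_sum[OF maximalD(2)[OF d] two_form_linear(1)[OF \<omega> d pV] B(1,2)])
      (use tan ch(1) a in auto)
  have 2: "\<omega> p [?cf b, ?cf (\<Sum>b'\<in>B. (?D a' \<bullet> b') *\<^sub>R b')] = (\<Sum>b'\<in>B. (?D a' \<bullet> b') * \<omega> p [?cf b, ?cf b'])" if "b \<in> E'" for b
    by (rule linear_on_subspace_sum[OF maximalD(2)[OF d] two_form_linear(2)[OF \<omega> d pV] B(1,2)])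
      (use tan that in auto)
  have "\<omega> p [?cf (?D a), ?cf (?D a')] = (\<Sum>b\<in>B. (?D a \<bullet> b) * (\<Sum>b'\<in>B. (?D a' \<bullet> b') * \<omega> p [?cf b, ?cf b']))"
    using 1 2 B(2) unfolding B(3)[OF ch(1)[OF a(1)]] B(3)[OF ch(1)[OF a(2)]] by (simp add: subset_iff)
  then show ?thesis unfolding ch(2)[OF a(1)] ch(2)[OF a(2)] by (simp add: sum_distrib_left)
qed

lemma smooth_on_transition_deriv:
  assumes c: "(U, \<phi>, E) \<in> atlas" and d: "(V, \<psi>, E') \<in> atlas" and a: "a \<in> E"
  shows "smooth_on (\<phi> ` (U \<inter> V)) (\<lambda>x. dderiv (\<psi> \<circ> inv_into U \<phi>) x a \<bullet> b)"
proof -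
  have "smooth_on (\<phi> ` (U \<inter> V)) (dderiv_at a)" if "dderiv_at = (\<lambda>a x. dderiv (\<psi> \<circ> inv_into U \<phi>) x a)" for dderiv_at
    unfolding that using maximalD(1)[OF d]
    by (intro smooth_on_dderiv[OF maximalD(2)[OF c] chart_open_image[OF maximal_is_chart[OF c]]] maximal_transition[OF c d] a)
  from smooth_on_compose[OF this[OF refl] smooth_on_linear[OF bounded_linear_inner_left, of UNIV b]] show ?thesis
    by simp
qed

lemma smooth_on_change:
  assumes c: "(U, \<phi>, E) \<in> atlas" and f: "smooth_fun_on M V f"
  shows "smooth_on (\<phi> ` (U \<inter> V)) (\<lambda>x. f (inv_into U \<phi> x))"
  using smooth_fun_on_maximal[OF f c] by (simp add: o_def)

lemma smooth_fun_on_chartI: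
  assumes c: "(U, \<phi>, E) \<in> atlas"
    and f: "\<And>V \<psi> E'. (V, \<psi>, E') \<in> charts M \<Longrightarrow> smooth_on (\<phi> ` (U \<inter> V)) (f \<circ> inv_into U \<phi>)"
  shows "smooth_fun_on M U f"
proof (rule smooth_fun_onI)
  fix p assume p: "p \<in> U"
  have "smooth_on (\<phi> ` (U \<inter> U)) (f \<circ> inv_into U \<phi>)"
    by (rule smooth_on_atlas_local[OF c], rule smooth_on_subset[OF f]) auto
  then show "\<exists>(V, \<psi>, E')\<in>atlas. p \<in> V \<and> smooth_on (\<psi> ` (V \<inter> U)) (f \<circ> inv_into V \<psi>)"
    using c p by blast
qed

text \<open>The definition of a form tests coefficients in the charts of the given atlas, but slice
  charts come from the maximal atlas. The change-of-chart formula carries smoothness over.\<close>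

lemma one_form_smooth:
  assumes \<theta>: "differential_form M 1 \<theta>" and c: "(U, \<phi>, E) \<in> atlas" and a: "a \<in> E"
  shows "smooth_fun_on M U (\<lambda>q. \<theta> q [coord_field M (U, \<phi>, E) a q])"
proof (rule smooth_fun_on_chartI[OF c])
  fix V \<psi> E' assume d: "(V, \<psi>, E') \<in> charts M"
  note dm = charts_maximal[OF d]
  obtain B where B: "finite B" "B \<subseteq> E'" "\<And>v. v \<in> E' \<Longrightarrow> (\<Sum>b\<in>B. (v \<bullet> b) *\<^sub>R b) = v"
    by (rule subspace_orthonormal_expansion[OF maximalD(2)[OF dm]]) blast
  have "smooth_fun_on M V (\<lambda>q. \<theta> q [coord_field M (V, \<psi>, E') b q])" if "b \<in> B" for b
    using differential_form_smooth[OF \<theta> d, of "[b]"] that B by auto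
  then have "smooth_on (\<phi> ` (U \<inter> V)) (\<lambda>x. \<Sum>b\<in>B. (dderiv (\<psi> \<circ> inv_into U \<phi>) x a \<bullet> b) *
      \<theta> (inv_into U \<phi> x) [coord_field M (V, \<psi>, E') b (inv_into U \<phi> x)])"
    by (intro smooth_on_sum smooth_on_mult smooth_on_transition_deriv[OF c dm a] smooth_on_change[OF c])
  then show "smooth_on (\<phi> ` (U \<inter> V)) ((\<lambda>q. \<theta> q [coord_field M (U, \<phi>, E) a q]) \<circ> inv_into U \<phi>)"
    by (rule smooth_on_cong) (use one_form_change[OF \<theta> c dm _ a B] maximalD(6)[OF c] in auto)
qed

lemma two_form_smooth:
  assumes \<omega>: "differential_form M 2 \<omega>" and c: "(U, \<phi>, E) \<in> atlas" and a: "a \<in> E" "a' \<in> E"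
  shows "smooth_fun_on M U (\<lambda>q. \<omega> q [coord_field M (U, \<phi>, E) a q, coord_field M (U, \<phi>, E) a' q])"
proof (rule smooth_fun_on_chartI[OF c])
  fix V \<psi> E' assume d: "(V, \<psi>, E') \<in> charts M"
  note dm = charts_maximal[OF d]
  obtain B where B: "finite B" "B \<subseteq> E'" "\<And>v. v \<in> E' \<Longrightarrow> (\<Sum>b\<in>B. (v \<bullet> b) *\<^sub>R b) = v"
    by (rule subspace_orthonormal_expansion[OF maximalD(2)[OF dm]]) blast
  have "smooth_fun_on M V (\<lambda>q. \<omega> q [coord_field M (V, \<psi>, E') b q, coord_field M (V, \<psi>, E') b' q])"
    if "b \<in> B" "b' \<in> B" for b b'
    using differential_form_smooth[OF \<omega> d, of "[b, b']"] that B by auto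
  then have "smooth_on (\<phi> ` (U \<inter> V)) (\<lambda>x. \<Sum>b\<in>B. \<Sum>b'\<in>B. (dderiv (\<psi> \<circ> inv_into U \<phi>) x a \<bullet> b) *
      ((dderiv (\<psi> \<circ> inv_into U \<phi>) x a' \<bullet> b') *
      \<omega> (inv_into U \<phi> x) [coord_field M (V, \<psi>, E') b (inv_into U \<phi> x), coord_field M (V, \<psi>, E') b' (inv_into U \<phi> x)]))"
    by (intro smooth_on_sum smooth_on_mult smooth_on_transition_deriv[OF c dm] a smooth_on_change[OF c])
  then show "smooth_on (\<phi> ` (U \<inter> V)) ((\<lambda>q. \<omega> q [coord_field M (U, \<phi>, E) a q, coord_field M (U, \<phi>, E) a' q]) \<circ> inv_into U \<phi>)"
    by (rule smooth_on_cong) (use two_form_change[OF \<omega> c dm _ a B] maximalD(6)[OF c] in auto)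
qed

lemma one_form_coord_smooth:
  assumes \<theta>: "differential_form M 1 \<theta>" and c: "(U, \<phi>, E) \<in> atlas" and a: "a \<in> E"
  shows "smooth_on (\<phi> ` U) (\<lambda>x. \<theta> (inv_into U \<phi> x) [coord_field M (U, \<phi>, E) a (inv_into U \<phi> x)])"
  using smooth_fun_on_maximal[OF one_form_smooth[OF assms] c] by (simp add: o_def)

lemma coord_field_one_form:
  assumes \<theta>: "differential_form M 1 \<theta>" and c: "(U, \<phi>, E) \<in> atlas" and p: "p \<in> U" and a: "a \<in> E" "b \<in> E"
  shows "coord_field M (U, \<phi>, E) a p (\<lambda>q. \<theta> q [coord_field M (U, \<phi>, E) b q]) =
    dderiv (\<lambda>x. \<theta> (inv_into U \<phi> x) [coord_field M (U, \<phi>, E) b (inv_into U \<phi> x)]) (\<phi> p) a"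
proof -
  have "smooth_near M p (\<lambda>q. \<theta> q [coord_field M (U, \<phi>, E) b q])"
    using one_form_smooth[OF \<theta> c a(2)] maximalD(1)[OF c] p unfolding smooth_near_def by blast
  then show ?thesis by (simp add: coord_field_eq[OF c p a(1)] o_def)
qed

text \<open>The second derivatives of the transition map enter symmetrically and cancel.\<close>

lemma ext_d_chart:
  assumes \<theta>: "differential_form M 1 \<theta>" and c: "(U, \<phi>, E) \<in> atlas" and p: "p \<in> U" and a: "a0 \<in> E" "a1 \<in> E"
  shows "ext_d M \<theta> p [coord_field M (U, \<phi>, E) a0 p, coord_field M (U, \<phi>, E) a1 p] =
    dderiv (\<lambda>x. \<theta> (inv_into U \<phi> x) [coord_field M (U, \<phi>, E) a1 (inv_into U \<phi> x)]) (\<phi> p) a0 -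
    dderiv (\<lambda>x. \<theta> (inv_into U \<phi> x) [coord_field M (U, \<phi>, E) a0 (inv_into U \<phi> x)]) (\<phi> p) a1"
proof -
  \<comment> \<open>The chart picked inside \<open>ext_d\<close>; nothing is known about it beyond
    belonging to the atlas and containing \<open>p\<close>.\<close>
  define d where "d = (SOME d. d \<in> charts M \<and> p \<in> fst d)"
  obtain V \<psi> E' where dV: "d = (V, \<psi>, E')" by (cases d) auto
  obtain V' \<psi>' E'' where "(V', \<psi>', E'') \<in> charts M" "p \<in> V'" using chart_cover maximalD(5)[OF c] p by blast
  then have "\<exists>d. d \<in> charts M \<and> p \<in> fst d" by (intro exI[of _ "(V', \<psi>', E'')"]) simp
  then have "d \<in> charts M \<and> p \<in> fst d" unfolding d_def by (rule someI_ex)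
  then have dm: "(V, \<psi>, E') \<in> atlas" and pV: "p \<in> V" using charts_maximal dV by auto
  let ?\<tau> = "\<psi> \<circ> inv_into U \<phi>"
  note cD = maximalD[OF c] and dD = maximalD[OF dm]
  have pUV: "p \<in> U \<inter> V" using p pV by simp
  define h where "h b y = \<theta> (inv_into V \<psi> y) [coord_field M (V, \<psi>, E') b (inv_into V \<psi> y)]" for b y
  have h: "smooth_on (\<psi> ` V) (h b)" if "b \<in> E'" for b
    unfolding h_def using one_form_coord_smooth[OF \<theta> dm that] .
  define D where "D = dderiv ?\<tau> (\<phi> p)"
  have D: "D a \<in> E'" "coord_field M (U, \<phi>, E) a p = coord_field M (V, \<psi>, E') (D a) p" if "a \<in> E" for a
    unfolding D_def using coord_field_change[OF c dm pUV that] by auto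
  obtain B where B: "finite B" "B \<subseteq> E'" "\<And>v. v \<in> E' \<Longrightarrow> (\<Sum>b\<in>B. (v \<bullet> b) *\<^sub>R b) = v"
    by (rule subspace_orthonormal_expansion[OF dD(2)]) blast
  define A where "A = \<phi> ` (U \<inter> V)"
  have A: "openin (top_of_set E) A" unfolding A_def by (rule chart_open_image[OF maximal_is_chart[OF c] dD(1)])
  have \<tau>: "smooth_on A ?\<tau>" unfolding A_def by (rule maximal_transition[OF c dm])
  have \<tau>im: "?\<tau> ` A \<subseteq> \<psi> ` V" unfolding A_def using cD(6) by auto
  have pA: "\<phi> p \<in> A" using pUV by (simp add: A_def)
  have ext: "ext_d M \<theta> p [coord_field M (U, \<phi>, E) a0 p, coord_field M (U, \<phi>, E) a1 p] =
      dderiv (h (D a1)) (\<psi> p) (D a0) - dderiv (h (D a0)) (\<psi> p) (D a1)"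
    unfolding ext_d_pair Let_def d_def[symmetric] dV
    using D a by (simp add: coord_vec_coord_field[OF dm pV] coord_field_one_form[OF \<theta> dm pV] h_def[abs_def])
  \<comment> \<open>The right side of \<open>ext\<close> involves coefficients in the directions
    \<open>D a0\<close> and \<open>D a1\<close>; expanding them over \<open>B\<close> gives the
    shape that \<open>main\<close> produces.\<close>
  have hsum: "dderiv (h b') (\<psi> p) b = (\<Sum>b''\<in>B. (b' \<bullet> b'') * dderiv (h b'') (\<psi> p) b)" if "b \<in> E'" "b' \<in> E'" for b b'
  proof -
    have "h b' y = (\<Sum>b''\<in>B. (b' \<bullet> b'') * h b'' y)" if "y \<in> \<psi> ` V" for y
    proof -
      have "\<theta> (inv_into V \<psi> y) [coord_field M (V, \<psi>, E') (\<Sum>b''\<in>B. (b' \<bullet> b'') *\<^sub>R b'') (inv_into V \<psi> y)] =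
          (\<Sum>b''\<in>B. (b' \<bullet> b'') * \<theta> (inv_into V \<psi> y) [coord_field M (V, \<psi>, E') b'' (inv_into V \<psi> y)])"
        by (rule linear_on_subspace_sum[OF dD(2) one_form_linear[OF \<theta> dm] B(1,2)]) (use that dD(6) in auto)
      then show ?thesis unfolding h_def B(3)[OF \<open>b' \<in> E'\<close>] .
    qed
    then have "dderiv (h b') (\<psi> p) b = dderiv (\<lambda>y. \<Sum>b''\<in>B. (b' \<bullet> b'') * h b'' y) (\<psi> p) b"
      using pV B(2) \<open>b \<in> E'\<close> by (intro dderiv_cong[OF dD(2,3)] smooth_on_sum smooth_on_mult smooth_on_const h) auto
    also have "\<dots> = (\<Sum>b''\<in>B. dderiv (\<lambda>y. (b' \<bullet> b'') * h b'' y) (\<psi> p) b)"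
      using pV B(2) \<open>b \<in> E'\<close> by (intro dderiv_sum[OF dD(2,3)] smooth_on_mult smooth_on_const h) auto
    also have "\<dots> = (\<Sum>b''\<in>B. (b' \<bullet> b'') * dderiv (h b'') (\<psi> p) b)"
    proof (rule sum.cong[OF refl])
      fix b'' assume "b'' \<in> B"
      then have "((\<lambda>t. h b'' (\<psi> p + t *\<^sub>R b)) has_vector_derivative dderiv (h b'') (\<psi> p) b) (at 0)"
        using dderiv_works[OF dD(2,3) h, of b'' "\<psi> p" b] B(2) pV \<open>b \<in> E'\<close> by blast
      then have "((\<lambda>t. (b' \<bullet> b'') * h b'' (\<psi> p + t *\<^sub>R b)) has_vector_derivative (b' \<bullet> b'') * dderiv (h b'') (\<psi> p) b) (at 0)"
        by (rule has_vector_derivative_mult_right)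
      then show "dderiv (\<lambda>y. (b' \<bullet> b'') * h b'' y) (\<psi> p) b = (b' \<bullet> b'') * dderiv (h b'') (\<psi> p) b"
        by (rule dderiv_unique[OF dD(2,3)])
    qed
    finally show ?thesis .
  qed
  define S where "S b a a' = dderiv (\<lambda>x. dderiv ?\<tau> x a \<bullet> b) (\<phi> p) a'" for b a a'
  have S: "S b a0 a1 = S b a1 a0" for b
  proof -
    have \<tau>b: "smooth_on A (\<lambda>x. ?\<tau> x \<bullet> b)"
      using smooth_on_compose[OF \<tau> smooth_on_linear[OF bounded_linear_inner_left, of UNIV b]] by simp
    have "S b a a' = dderiv (\<lambda>x. dderiv (\<lambda>x. ?\<tau> x \<bullet> b) x a) (\<phi> p) a'" if "a \<in> E" "a' \<in> E" for a a'
      unfolding S_def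
      by (rule dderiv_cong[OF cD(2) A _ smooth_on_dderiv[OF cD(2) A \<tau>b that(1)] pA that(2)])
        (rule dderiv_inner[OF cD(2) A \<tau> _ that(1), symmetric])
    then show ?thesis using dderiv_symmetric[OF cD(2) A \<tau>b pA] a by metis
  qed
  \<comment> \<open>Product rule for the transformed coefficients. Differentiating the coefficient
    of the form gives the wanted term, while differentiating the transition map gives
    \<open>S\<close>, which drops out after antisymmetrisation.\<close>
  have main: "dderiv (\<lambda>x. \<theta> (inv_into U \<phi> x) [coord_field M (U, \<phi>, E) a (inv_into U \<phi> x)]) (\<phi> p) a' =
      (\<Sum>b\<in>B. (D a \<bullet> b) * dderiv (h b) (\<psi> p) (D a') + S b a a' * h b (\<psi> p))" if a: "a \<in> E" "a' \<in> E" for a a'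
  proof -
    have hc: "smooth_on A (\<lambda>x. h b (?\<tau> x))" if "b \<in> B" for b
      using that B(2) by (intro smooth_on_compose[OF \<tau> h \<tau>im]) auto
    have Dc: "smooth_on A (\<lambda>x. dderiv ?\<tau> x a \<bullet> b)" for b
      unfolding A_def by (rule smooth_on_transition_deriv[OF c dm a(1)])
    have "dderiv (\<lambda>x. \<theta> (inv_into U \<phi> x) [coord_field M (U, \<phi>, E) a (inv_into U \<phi> x)]) (\<phi> p) a' =
        dderiv (\<lambda>x. \<Sum>b\<in>B. (dderiv ?\<tau> x a \<bullet> b) * h b (?\<tau> x)) (\<phi> p) a'"
    proof (rule dderiv_cong[OF cD(2) A _ _ pA a(2)])
      fix x assume "x \<in> A"
      then obtain q where q: "q \<in> U \<inter> V" "x = \<phi> q" unfolding A_def by blast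
      then show "\<theta> (inv_into U \<phi> x) [coord_field M (U, \<phi>, E) a (inv_into U \<phi> x)] = (\<Sum>b\<in>B. (dderiv ?\<tau> x a \<bullet> b) * h b (?\<tau> x))"
        using one_form_change[OF \<theta> c dm q(1) a(1) B] cD(6) dD(6) by (simp add: h_def)
    qed (intro smooth_on_sum smooth_on_mult Dc hc)
    also have "\<dots> = (\<Sum>b\<in>B. dderiv (\<lambda>x. (dderiv ?\<tau> x a \<bullet> b) * h b (?\<tau> x)) (\<phi> p) a')"
      by (intro dderiv_sum[OF cD(2) A _ pA a(2)] smooth_on_mult Dc hc)
    also have "\<dots> = (\<Sum>b\<in>B. (D a \<bullet> b) * dderiv (h b) (\<psi> p) (D a') + S b a a' * h b (\<psi> p))"
    proof (rule sum.cong[OF refl])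
      fix b assume b: "b \<in> B"
      have "dderiv (\<lambda>x. h b (?\<tau> x)) (\<phi> p) a' = dderiv (h b) (?\<tau> (\<phi> p)) (D a')"
        unfolding D_def using b B(2) by (intro dderiv_compose[OF cD(2) A dD(2,3) \<tau> \<tau>im h pA a(2)]) auto
      with dderiv_mult[OF cD(2) A Dc hc[OF b] pA a(2)] p cD(6)
      show "dderiv (\<lambda>x. (dderiv ?\<tau> x a \<bullet> b) * h b (?\<tau> x)) (\<phi> p) a' = (D a \<bullet> b) * dderiv (h b) (\<psi> p) (D a') + S b a a' * h b (\<psi> p)"
        by (simp add: S_def D_def)
    qed
    finally show ?thesis .
  qed
  show ?thesis
    unfolding ext main[OF a(2,1)] main[OF a] hsum[OF D(1)[OF a(1)] D(1)[OF a(2)]] hsum[OF D(1)[OF a(2)] D(1)[OF a(1)]]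
    by (simp add: S sum_subtractf[symmetric])
qed

end

section \<open>Submanifolds\<close>

lemma is_chartI:
  assumes "openin X U" "subspace E" "openin (top_of_set E) (\<phi> ` U)" "inj_on \<phi> U"
    and "continuous_map (subtopology X U) euclidean \<phi>" "continuous_map (top_of_set (\<phi> ` U)) X (inv_into U \<phi>)"
  shows "is_chart X (U, \<phi>, E)"
proof -
  have U: "topspace (subtopology X U) = U" using openin_subset[OF assms(1)] by (simp add: inf_absorb2)
  have "continuous_map (subtopology X U) (top_of_set (\<phi> ` U)) \<phi>"
    using assms(5) U by (simp add: continuous_map_in_subtopology)
  moreover have "continuous_map (top_of_set (\<phi> ` U)) (subtopology X U) (inv_into U \<phi>)"
    using assms(6) by (auto simp: continuous_map_in_subtopology inv_into_into)
  ultimately have "homeomorphic_maps (subtopology X U) (top_of_set (\<phi> ` U)) \<phi> (inv_into U \<phi>)"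
    using assms(4) U by (simp add: homeomorphic_maps_def f_inv_into_f)
  then show ?thesis
    using assms(1-3) by (auto simp: is_chart_def homeomorphic_map_maps)
qed

lemma chart_continuous_map:
  assumes "is_chart X (U, \<phi>, E)"
  shows "continuous_map (subtopology X U) euclidean \<phi>"
  using homeomorphic_imp_continuous_map[OF is_chartD(4)[OF assms]] by (simp add: continuous_map_in_subtopology)

text \<open>The complement of \<open>S\<close> completes any relatively open cover to a cover of
  \<open>X\<close>; a locally finite refinement of that is then intersected with
  \<open>S\<close>.\<close>

lemma paracompact_space_closed_subspace:
  assumes X: "paracompact_space X" and S: "closedin X S"
  shows "paracompact_space (subtopology X S)"
  unfolding paracompact_space_def
proof (intro allI impI)
  fix \<U> assume \<U>: "(\<forall>U\<in>\<U>. openin (subtopology X S) U) \<and> \<Union>\<U> = topspace (subtopology X S)"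
  have SX: "S \<subseteq> topspace X" using S closedin_subset by blast
  then have tS: "topspace (subtopology X S) = S" by (simp add: inf_absorb2)
  define \<W> where "\<W> = insert (topspace X - S) {T. openin X T \<and> T \<inter> S \<in> \<U>}"
  have "x \<in> \<Union>\<W>" if "x \<in> topspace X" for x
  proof (cases "x \<in> S")
    case True
    then obtain U where U: "U \<in> \<U>" "x \<in> U" using \<U> tS by blast
    then obtain T where "openin X T" "U = T \<inter> S" using \<U> by (auto simp: openin_subtopology)
    then show ?thesis using U by (auto simp: \<W>_def)
  qed (use that in \<open>auto simp: \<W>_def\<close>)
  moreover have \<W>: "\<forall>T\<in>\<W>. openin X T" using S by (auto simp: \<W>_def closedin_def)
  ultimately have "\<Union>\<W> = topspace X" using openin_subset by blast
  with \<W> X obtain \<V> where \<V>: "\<forall>V\<in>\<V>. openin X V \<and> (\<exists>U\<in>\<W>. V \<subseteq> U)" "\<Union>\<V> = topspace X" "locally_finite_in X \<V>"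
    unfolding paracompact_space_def by meson
  \<comment> \<open>Only refining sets that meet \<open>S\<close> are kept: such a set cannot lie in
    the added complement, so its trace lies in a member of \<open>\<U>\<close>.\<close>
  define \<V>' where "\<V>' = (\<lambda>V. V \<inter> S) ` {V \<in> \<V>. V \<inter> S \<noteq> {}}"
  have "openin (subtopology X S) V' \<and> (\<exists>U\<in>\<U>. V' \<subseteq> U)" if "V' \<in> \<V>'" for V'
  proof -
    obtain V where V: "V \<in> \<V>" "V \<inter> S \<noteq> {}" "V' = V \<inter> S" using \<open>V' \<in> \<V>'\<close> by (auto simp: \<V>'_def)
    then obtain U where "U \<in> \<W>" "V \<subseteq> U" "openin X V" using \<V> by blast
    then have "U \<inter> S \<in> \<U>" using V by (auto simp: \<W>_def)
    moreover have "V' \<subseteq> U \<inter> S" using V \<open>V \<subseteq> U\<close> by blast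
    moreover have "openin (subtopology X S) V'" using V \<open>openin X V\<close> by (auto simp: openin_subtopology)
    ultimately show ?thesis by blast
  qed
  moreover have un: "\<Union>\<V>' = topspace (subtopology X S)"
    using \<V>(2) SX unfolding tS \<V>'_def by blast
  moreover have "locally_finite_in (subtopology X S) \<V>'"
    unfolding locally_finite_in_def
  proof (intro conjI ballI)
    show "\<Union>\<V>' \<subseteq> topspace (subtopology X S)" using un by simp
    fix x assume "x \<in> topspace (subtopology X S)"
    then have x: "x \<in> S" "x \<in> topspace X" using tS SX by auto
    then obtain T where T: "openin X T" "x \<in> T" "finite {V \<in> \<V>. V \<inter> T \<noteq> {}}"
      using \<V>(3) unfolding locally_finite_in_def by blast
    have "{V' \<in> \<V>'. V' \<inter> (T \<inter> S) \<noteq> {}} \<subseteq> (\<lambda>V. V \<inter> S) ` {V \<in> \<V>. V \<inter> T \<noteq> {}}"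
      by (auto simp: \<V>'_def)
    then have "finite {V' \<in> \<V>'. V' \<inter> (T \<inter> S) \<noteq> {}}" using T(3) finite_surj by blast
    then show "\<exists>V. openin (subtopology X S) V \<and> x \<in> V \<and> finite {U \<in> \<V>'. U \<inter> V \<noteq> {}}"
      using T x by (intro exI[of _ "T \<inter> S"]) (auto simp: openin_subtopology)
  qed
  ultimately show "\<exists>\<V>. (\<forall>V\<in>\<V>. openin (subtopology X S) V \<and> (\<exists>U\<in>\<U>. V \<subseteq> U)) \<and>
      \<Union>\<V> = topspace (subtopology X S) \<and> locally_finite_in (subtopology X S) \<V>" by blast
qed

lemma mtop_submfd [simp]: "mtop (submfd M S) = subtopology (mtop M) S"
  by (simp add: submfd_def)

lemma in_charts_submfd_iff:
  "(V, \<phi>, F) \<in> charts (submfd M S) \<longleftrightarrow> (\<exists>U E. V = U \<inter> S \<and> (U, \<phi>, E) \<in> maximal_atlas M \<and>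
     subspace F \<and> F \<subseteq> E \<and> \<phi> ` (U \<inter> S) = \<phi> ` U \<inter> F)"
  by (auto simp: submfd_def)

lemma inv_into_restrict:
  assumes "inj_on f A" "B \<subseteq> A" "x \<in> f ` B"
  shows "inv_into B f x = inv_into A f x"
  using assms by (auto simp: inv_into_f_f inj_on_subset subset_iff intro!: inv_into_f_eq[symmetric])

section \<open>Slice charts and the manifold structure of a closed subset\<close>

context smooth_mfd
begin

lemma submfd_is_chart:
  assumes "(V, \<phi>, F) \<in> charts (submfd M S)"
  shows "is_chart (mtop (submfd M S)) (V, \<phi>, F)"
proof -
  obtain U E where U: "V = U \<inter> S" "(U, \<phi>, E) \<in> atlas" "subspace F" "F \<subseteq> E" "\<phi> ` (U \<inter> S) = \<phi> ` U \<inter> F"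
    using assms in_charts_submfd_iff by metis
  note c = maximal_is_chart[OF U(2)] and cD = maximalD[OF U(2)]
  show ?thesis unfolding U(1)
  proof (rule is_chartI)
    show "openin (mtop (submfd M S)) (U \<inter> S)" using cD(1) by (auto simp: openin_subtopology)
    show "openin (top_of_set F) (\<phi> ` (U \<inter> S))"
    proof -
      obtain T where "open T" "\<phi> ` U = E \<inter> T" using cD(3) by (auto simp: openin_open)
      then show ?thesis using U(4,5) by (auto simp: openin_open)
    qed
    show "inj_on \<phi> (U \<inter> S)" using cD(6) inj_on_subset by blast
    show "continuous_map (subtopology (mtop (submfd M S)) (U \<inter> S)) euclidean \<phi>"
    proof -
      have "subtopology (mtop (submfd M S)) (U \<inter> S) = subtopology (subtopology (mtop M) U) S"
        by (simp add: subtopology_subtopology inf_left_idem inf_commute inf_left_commute)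
      then show ?thesis using continuous_map_from_subtopology[OF chart_continuous_map[OF c]] by metis
    qed
    have "continuous_map (top_of_set (\<phi> ` (U \<inter> S))) (mtop M) (inv_into U \<phi>)"
      by (rule continuous_map_from_subtopology_mono[OF chart_inverse_continuous[OF c]]) blast
    then have "continuous_map (top_of_set (\<phi> ` (U \<inter> S))) (mtop M) (inv_into (U \<inter> S) \<phi>)"
      by (rule continuous_map_eq) (auto simp: inv_into_restrict[OF cD(6)])
    moreover have "inv_into (U \<inter> S) \<phi> x \<in> S" if "x \<in> \<phi> ` (U \<inter> S)" for x using inv_into_into[OF that] by blast
    ultimately show "continuous_map (top_of_set (\<phi> ` (U \<inter> S))) (mtop (submfd M S)) (inv_into (U \<inter> S) \<phi>)"
      by (auto simp: continuous_map_in_subtopology)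
  qed (rule U(3))
qed

lemma submfd_transition:
  assumes "c \<in> charts (submfd M S)" "d \<in> charts (submfd M S)"
  shows "smooth_transition c d"
proof -
  obtain U \<phi> E F where c: "c = (U \<inter> S, \<phi>, F)" "(U, \<phi>, E) \<in> atlas"
    using assms(1) by (cases c) (metis in_charts_submfd_iff)
  obtain V \<psi> E' F' where d: "d = (V \<inter> S, \<psi>, F')" "(V, \<psi>, E') \<in> atlas"
    using assms(2) by (cases d) (metis in_charts_submfd_iff)
  have "smooth_on (\<phi> ` (U \<inter> S \<inter> (V \<inter> S))) (\<psi> \<circ> inv_into U \<phi>)"
    by (rule smooth_on_subset[OF maximal_transition[OF c(2) d(2)]]) blast
  then have "smooth_on (\<phi> ` (U \<inter> S \<inter> (V \<inter> S))) (\<psi> \<circ> inv_into (U \<inter> S) \<phi>)"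
    by (rule smooth_on_cong) (subst o_apply, subst inv_into_restrict[OF maximalD(6)[OF c(2)]], auto)
  then show ?thesis by (simp add: c(1) d(1) smooth_transition_def)
qed

text \<open>\<open>submfd\<close> admits every slice chart, with no dimension prescribed. On an
  overlap the transition map is continuous and injective between subspaces, so invariance of domain
  compares the dimensions; using it in both directions gives equality.\<close>

lemma submfd_dim_le:
  assumes c: "(U, \<phi>, F) \<in> charts (submfd M S)" and d: "(V, \<psi>, F') \<in> charts (submfd M S)" and p: "p \<in> U \<inter> V"
  shows "dim F \<le> dim F'"
proof -
  note cD = is_chartD[OF submfd_is_chart[OF c]] and dD = is_chartD[OF submfd_is_chart[OF d]]
  have s: "smooth_on (\<phi> ` (U \<inter> V)) (\<psi> \<circ> inv_into U \<phi>)"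
    using submfd_transition[OF c d] by (simp add: smooth_transition_def)
  show ?thesis
  proof (rule invariance_of_dimension_subspaces)
    show "openin (top_of_set F) (\<phi> ` (U \<inter> V))" by (rule chart_open_image[OF submfd_is_chart[OF c] dD(1)])
    show "continuous_on (\<phi> ` (U \<inter> V)) (\<psi> \<circ> inv_into U \<phi>)" by (rule smooth_on_continuous[OF s])
    show "\<psi> \<circ> inv_into U \<phi> \<in> \<phi> ` (U \<inter> V) \<rightarrow> F'" using cD(6) dD(7) by auto
    show "inj_on (\<psi> \<circ> inv_into U \<phi>) (\<phi> ` (U \<inter> V))" using cD(6) dD(6) by (auto simp: inj_on_def)
    show "\<phi> ` (U \<inter> V) \<noteq> {}" using p by blast
  qed (rule cD(2) dD(2))+
qed

text \<open>A single slice chart of dimension \<open>m\<close> at each point fixes the dimension of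
  all others, and closedness hands paracompactness down to \<open>S\<close>.\<close>

lemma submfd_manifold:
  assumes S: "closedin (mtop M) S"
    and slice: "\<And>p. p \<in> S \<Longrightarrow> \<exists>(U, \<phi>, F)\<in>charts (submfd M S). p \<in> U \<and> dim F = m"
  shows "manifold_of_dim m (submfd M S)"
  unfolding manifold_of_dim_def
proof (intro conjI)
  show "Hausdorff_space (mtop (submfd M S))"
    using mfd by (simp add: manifold_of_dim_def Hausdorff_space_subtopology)
  show "paracompact_space (mtop (submfd M S))"
    using mfd S by (simp add: manifold_of_dim_def paracompact_space_closed_subspace)
  show "\<forall>c\<in>charts (submfd M S). is_chart (mtop (submfd M S)) c"
    using submfd_is_chart by auto
  show "\<forall>c\<in>charts (submfd M S). \<forall>d\<in>charts (submfd M S). smooth_transition c d"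
    using submfd_transition by blast
  have SX: "points (submfd M S) = S" using closedin_subset[OF S] by (simp add: inf_absorb2)
  show "(\<Union>(U, \<phi>, E)\<in>charts (submfd M S). U) = points (submfd M S)"
  proof
    show "(\<Union>(U, \<phi>, E)\<in>charts (submfd M S). U) \<subseteq> points (submfd M S)"
      using is_chartD(5)[OF submfd_is_chart] by fast
    show "points (submfd M S) \<subseteq> (\<Union>(U, \<phi>, E)\<in>charts (submfd M S). U)"
      using slice unfolding SX by fast
  qed
  have "dim F = m" if c: "(U, \<phi>, F) \<in> charts (submfd M S)" and p: "p \<in> U" for U \<phi> F p
  proof -
    have "p \<in> S" using c p by (auto simp: in_charts_submfd_iff)
    then obtain V \<psi> F' where d: "(V, \<psi>, F') \<in> charts (submfd M S)" "p \<in> V" "dim F' = m" using slice by blast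
    show ?thesis using submfd_dim_le[OF c d(1)] submfd_dim_le[OF d(1) c] p d(2,3) by force
  qed
  then show "\<forall>(U, \<phi>, F)\<in>charts (submfd M S). U \<noteq> {} \<longrightarrow> dim F = m"
    by blast
qed

end

section \<open>Level sets\<close>

lemma dim_orthogonal_in_subspace:
  fixes E :: "'e::euclidean_space set"
  assumes E: "subspace E" and e: "e \<in> E" "e \<noteq> 0"
  shows "dim {v \<in> E. v \<bullet> e = 0} + 1 = dim E"
proof -
  have "span {e} \<subseteq> E" using span_minimal[of "{e}" E] E e by simp
  then have "dim {y \<in> E. \<forall>x\<in>span {e}. orthogonal x y} + dim (span {e}) = dim E"
    by (rule dim_subspace_orthogonal_to_vectors[OF subspace_span E])
  moreover have "{y \<in> E. \<forall>x\<in>span {e}. orthogonal x y} = {v \<in> E. v \<bullet> e = 0}"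
    by (auto simp: span_singleton orthogonal_def inner_commute)
  moreover have "dim (span {e}) = 1" using e by (simp add: dim_singleton)
  ultimately show ?thesis by simp
qed

section \<open>Charts adapted to a level set\<close>

context smooth_mfd
begin

text \<open>The map \<open>\<Psi>\<close> acts on the whole ambient space; that it preserves
  membership in \<open>E\<close> makes its restriction a diffeomorphism between relatively open
  subsets of \<open>E\<close>.\<close>

lemma maximal_atlas_reparametrize:
  assumes c: "(U, \<phi>, E) \<in> atlas" and hom: "homeomorphism U0 V0 \<Psi> g"
    and \<Psi>: "Cinf U0 \<Psi>" and g: "Cinf V0 g" and E: "\<And>x. x \<in> U0 \<Longrightarrow> \<Psi> x \<in> E \<longleftrightarrow> x \<in> E"
  shows "({p \<in> U. \<phi> p \<in> U0}, \<Psi> \<circ> \<phi>, E) \<in> atlas"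
proof -
  note cD = maximalD[OF c]
  define U' where "U' = {p \<in> U. \<phi> p \<in> U0}"
  note U0 = Cinf_open[OF \<Psi>] and V0 = Cinf_open[OF g]
  have U': "U' \<subseteq> U" by (auto simp: U'_def)
  have g\<Psi>: "g (\<Psi> x) = x" "\<Psi> x \<in> V0" if "x \<in> U0" for x using hom that by (auto simp: homeomorphism_def)
  have \<Psi>g: "\<Psi> (g y) = y" "g y \<in> U0" if "y \<in> V0" for y using hom that by (auto simp: homeomorphism_def)
  have inj: "inj_on (\<Psi> \<circ> \<phi>) U'"
    by (rule inj_on_inverseI[of _ "inv_into U \<phi> \<circ> g"]) (use g\<Psi> cD(6) in \<open>auto simp: U'_def\<close>)
  have inv: "inv_into U' (\<Psi> \<circ> \<phi>) y = inv_into U \<phi> (g y)" if "y \<in> (\<Psi> \<circ> \<phi>) ` U'" for y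
  proof -
    obtain p where p: "p \<in> U'" "y = \<Psi> (\<phi> p)" using \<open>y \<in> (\<Psi> \<circ> \<phi>) ` U'\<close> by auto
    then have "inv_into U' (\<Psi> \<circ> \<phi>) y = p" using inv_into_f_f[OF inj p(1)] by simp
    moreover have "inv_into U \<phi> (g y) = p" using p g\<Psi> cD(6) by (auto simp: U'_def)
    ultimately show ?thesis by simp
  qed
  have cont_g: "continuous_on V0 g" using Cinf_continuous[OF g] .
  have "is_chart (mtop M) (U', \<Psi> \<circ> \<phi>, E)"
  proof (rule is_chartI)
    show "openin (mtop M) U'" unfolding U'_def by (rule chart_open_preimage[OF maximal_is_chart[OF c] U0])
    show "subspace E" by (rule cD(2))
    obtain T where T: "open T" "\<phi> ` U = E \<inter> T" using cD(3) by (auto simp: openin_open)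
    have "(\<Psi> \<circ> \<phi>) ` U' = E \<inter> (V0 \<inter> g -` T)"
    proof
      show "(\<Psi> \<circ> \<phi>) ` U' \<subseteq> E \<inter> (V0 \<inter> g -` T)"
        using g\<Psi> E cD(7) T(2) by (auto simp: U'_def)
      show "E \<inter> (V0 \<inter> g -` T) \<subseteq> (\<Psi> \<circ> \<phi>) ` U'"
      proof
        fix y assume y: "y \<in> E \<inter> (V0 \<inter> g -` T)"
        then have "g y \<in> E" using E[of "g y"] \<Psi>g by auto
        then have "g y \<in> \<phi> ` U" using y T(2) by auto
        then obtain p where p: "p \<in> U" "\<phi> p = g y" by auto
        then have "p \<in> U'" "y = (\<Psi> \<circ> \<phi>) p" using \<Psi>g y by (auto simp: U'_def)
        then show "y \<in> (\<Psi> \<circ> \<phi>) ` U'" by blast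
      qed
    qed
    moreover have "open (V0 \<inter> g -` T)" by (rule continuous_open_preimage[OF cont_g V0 T(1)])
    ultimately show "openin (top_of_set E) ((\<Psi> \<circ> \<phi>) ` U')" by (auto simp: openin_open)
    show "inj_on (\<Psi> \<circ> \<phi>) U'" by (rule inj)
    have "continuous_map (subtopology (mtop M) U') euclidean \<phi>"
      by (rule continuous_map_from_subtopology_mono[OF chart_continuous_map[OF maximal_is_chart[OF c]] U'])
    then have "continuous_map (subtopology (mtop M) U') (top_of_set U0) \<phi>"
      by (auto simp: continuous_map_in_subtopology U'_def)
    moreover have "continuous_map (top_of_set U0) euclidean \<Psi>" using Cinf_continuous[OF \<Psi>] by simp
    ultimately show "continuous_map (subtopology (mtop M) U') euclidean (\<Psi> \<circ> \<phi>)"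
      by (rule continuous_map_compose)
    have sub: "(\<Psi> \<circ> \<phi>) ` U' \<subseteq> V0" "g ` ((\<Psi> \<circ> \<phi>) ` U') \<subseteq> \<phi> ` U" using g\<Psi> by (auto simp: U'_def)
    have "continuous_map (top_of_set ((\<Psi> \<circ> \<phi>) ` U')) (top_of_set (\<phi> ` U)) g"
      using continuous_on_subset[OF cont_g sub(1)] sub(2) by (auto simp: continuous_map_in_subtopology)
    from continuous_map_compose[OF this chart_inverse_continuous[OF maximal_is_chart[OF c]]]
    show "continuous_map (top_of_set ((\<Psi> \<circ> \<phi>) ` U')) (mtop M) (inv_into U' (\<Psi> \<circ> \<phi>))"
      by (rule continuous_map_eq) (simp add: inv del: o_apply, simp add: inv)
  qed
  moreover have "smooth_transition (U', \<Psi> \<circ> \<phi>, E) d \<and> smooth_transition d (U', \<Psi> \<circ> \<phi>, E)" if "d \<in> charts M" for d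
  proof -
    obtain V \<psi> E' where d: "d = (V, \<psi>, E')" by (cases d) auto
    have dm: "(V, \<psi>, E') \<in> atlas" using charts_maximal[OF that] d by simp
    note dD = maximalD[OF dm]
    have "smooth_on ((\<Psi> \<circ> \<phi>) ` (U' \<inter> V)) g"
      by (rule smooth_on_Cinf[OF g]) (use g\<Psi> in \<open>auto simp: U'_def\<close>)
    then have "smooth_on ((\<Psi> \<circ> \<phi>) ` (U' \<inter> V)) (\<lambda>y. (\<psi> \<circ> inv_into U \<phi>) (g y))"
      by (rule smooth_on_compose[OF _ maximal_transition[OF c dm]]) (use g\<Psi> in \<open>auto simp: U'_def\<close>)
    then have 1: "smooth_on ((\<Psi> \<circ> \<phi>) ` (U' \<inter> V)) (\<psi> \<circ> inv_into U' (\<Psi> \<circ> \<phi>))"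
      by (rule smooth_on_cong) (subst o_apply, subst inv, auto)
    have "smooth_on (\<psi> ` (V \<inter> U')) (\<phi> \<circ> inv_into V \<psi>)"
      by (rule smooth_on_subset[OF maximal_transition[OF dm c]]) (use U' in auto)
    then have "smooth_on (\<psi> ` (V \<inter> U')) (\<lambda>y. \<Psi> ((\<phi> \<circ> inv_into V \<psi>) y))"
      by (rule smooth_on_compose[OF _ smooth_on_Cinf[OF \<Psi> order_refl]]) (use dD(6) in \<open>auto simp: U'_def\<close>)
    then have "smooth_on (\<psi> ` (V \<inter> U')) ((\<Psi> \<circ> \<phi>) \<circ> inv_into V \<psi>)"
      by (simp add: o_def)
    with 1 show ?thesis by (simp add: d smooth_transition_def)
  qed
  ultimately show ?thesis unfolding U'_def[symmetric] by (simp add: maximal_atlas_def)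
qed

lemma smooth_fun_on_points_near: "smooth_fun_on M (points M) h \<Longrightarrow> p \<in> points M \<Longrightarrow> smooth_near M p h"
  unfolding smooth_near_def using openin_topspace by blast

lemma smooth_on_coord_fun:
  assumes "smooth_fun_on M (points M) h" and c: "(U, \<phi>, E) \<in> atlas"
  shows "smooth_on (\<phi> ` U) (h \<circ> inv_into U \<phi>)"
  using smooth_fun_on_maximal[OF assms] maximalD(5)[OF c] by (simp add: inf_absorb1)

text \<open>Supplies the closedness needed for paracompactness of the level set. Continuity of
  \<open>h\<close> is available only through charts, hence the pointwise argument in the
  complement.\<close>

lemma closedin_level_set:
  assumes h: "smooth_fun_on M (points M) h"
  shows "closedin (mtop M) (level_set M h k)"
proof -
  have "openin (mtop M) (points M - level_set M h k)"
  proof (subst openin_subopen, intro ballI)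
    fix p assume p: "p \<in> points M - level_set M h k"
    then obtain U \<phi> E where c: "(U, \<phi>, E) \<in> charts M" "p \<in> U" using chart_cover by blast
    note cm = charts_maximal[OF c(1)]
    have "continuous_on (\<phi> ` U) (h \<circ> inv_into U \<phi>)" by (rule smooth_on_continuous[OF smooth_on_coord_fun[OF h cm]])
    then have "openin (top_of_set (\<phi> ` U)) (\<phi> ` U \<inter> (h \<circ> inv_into U \<phi>) -` (- {k}))"
      by (rule continuous_openin_preimage_gen) (simp add: open_Compl)
    then obtain T where T: "open T" "\<phi> ` U \<inter> (h \<circ> inv_into U \<phi>) -` (- {k}) = \<phi> ` U \<inter> T" by (auto simp: openin_open)
    have "h q \<noteq> k \<longleftrightarrow> \<phi> q \<in> T" if "q \<in> U" for q
    proof -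
      have "\<phi> q \<in> \<phi> ` U \<inter> (h \<circ> inv_into U \<phi>) -` (- {k}) \<longleftrightarrow> \<phi> q \<in> \<phi> ` U \<inter> T" using T(2) by simp
      then show ?thesis using that maximalD(6)[OF cm] by simp
    qed
    then have "{q \<in> U. \<phi> q \<in> T} \<subseteq> points M - level_set M h k" "p \<in> {q \<in> U. \<phi> q \<in> T}"
      using maximalD(5)[OF cm] p c(2) by (auto simp: level_set_def)
    then show "\<exists>T. openin (mtop M) T \<and> p \<in> T \<and> T \<subseteq> points M - level_set M h k"
      using chart_open_preimage[OF maximal_is_chart[OF cm] T(1)] by blast
  qed
  then show ?thesis by (auto simp: closedin_def level_set_def)
qed

text \<open>A tangent vector with nonzero derivative of \<open>h\<close> supplies the direction in
  which \<open>straightening\<close> replaces a linear coordinate by \<open>h - k\<close>. The level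
  set then becomes the hyperplane of \<open>E\<close> orthogonal to \<open>e\<close>.\<close>

lemma level_set_adapted_chart:
  assumes h: "smooth_fun_on M (points M) h" and q: "q \<in> points M" and v: "v \<in> tangent_space M q" "v h \<noteq> 0"
  obtains U \<phi> E e where "(U, \<phi>, E) \<in> atlas" "q \<in> U" "dim E = n" "e \<in> E" "e \<bullet> e = 1" "\<And>p. p \<in> U \<Longrightarrow> \<phi> p \<bullet> e = h p - k"
proof -
  obtain U \<phi> E where c0: "(U, \<phi>, E) \<in> charts M" "q \<in> U" using chart_cover[OF q] by blast
  have dimE: "dim E = n" using mfd c0 unfolding manifold_of_dim_def by blast
  note c = charts_maximal[OF c0(1)]
  note cD = maximalD[OF c]
  obtain a where a: "a \<in> E" "v = coord_field M (U, \<phi>, E) a q" using tangent_coord[OF v(1) c c0(2)] by blast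
  let ?f = "h \<circ> inv_into U \<phi>"
  have f: "smooth_on (\<phi> ` U) ?f" by (rule smooth_on_coord_fun[OF h c])
  have ne: "dderiv ?f (\<phi> q) a \<noteq> 0"
    using v(2) smooth_fun_on_points_near[OF h q] unfolding a(2) coord_field_eq[OF c c0(2) a(1)] by simp
  \<comment> \<open>Straightening happens in the ambient space, so \<open>h\<close> is first
    replaced by a smooth extension of its coordinate expression.\<close>
  obtain W f' where W: "Cinf W f'" "\<phi> q \<in> W" "\<And>y. y \<in> \<phi> ` U \<inter> W \<Longrightarrow> f' y = ?f y"
    using f c0(2) unfolding smooth_on_iff_Cinf by blast
  have dfa: "frechet_derivative f' (at (\<phi> q)) a \<noteq> 0"
    using ne dderiv_extension(1)[OF cD(2,3) W(1) imageI[OF c0(2)] W(2,3) a(1)] by (simp only: not_False_eq_True)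
  have lin: "linear (frechet_derivative f' (at (\<phi> q)))"
    using has_derivative_linear[OF Cinf_derivative[OF W(1,2)]] .
  then have "a \<noteq> 0" using dfa linear_0 by blast
  \<comment> \<open>Normalising \<open>a\<close> gives the unit vector that
    \<open>straightening\<close> requires; the derivative along it remains nonzero.\<close>
  define e where "e = a /\<^sub>R norm a"
  have e: "e \<in> E" "e \<bullet> e = 1" "frechet_derivative f' (at (\<phi> q)) e \<noteq> 0"
    using a(1) cD(2) \<open>a \<noteq> 0\<close> dfa
    by (auto simp: e_def subspace_scale linear_scale[OF lin] dot_square_norm power2_eq_square)
  obtain U0 V0 g where S: "open U0" "U0 \<subseteq> W" "\<phi> q \<in> U0" "open V0"
    "homeomorphism U0 V0 (\<lambda>x. x + (f' x - k - x \<bullet> e) *\<^sub>R e) g" "Cinf V0 g"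
    by (rule straightening[OF W(1,2) e(2,3)])
  define \<Psi> where "\<Psi> x = x + (f' x - k - x \<bullet> e) *\<^sub>R e" for x
  have C0: "Cinf U0 (\<lambda>x. x)" by (rule Cinf_bounded_linear[OF S(1) bounded_linear_ident])
  have C1: "Cinf U0 (\<lambda>x. - (x \<bullet> e))"
    by (rule Cinf_bounded_linear[OF S(1)]) (intro bounded_linear_minus bounded_linear_inner_left)
  have "Cinf U0 (\<lambda>x. x + ((f' x + (- k)) + - (x \<bullet> e)) *\<^sub>R e)"
    by (intro Cinf_add Cinf_scaleR Cinf_const C0 C1 Cinf_subset[OF W(1)] S)
  then have \<Psi>: "Cinf U0 \<Psi>" by (simp add: \<Psi>_def[abs_def])
  \<comment> \<open>Points move by multiples of \<open>e\<close>, which lies in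
    \<open>E\<close>.\<close>
  have \<Psi>E: "\<Psi> x \<in> E \<longleftrightarrow> x \<in> E" for x
  proof -
    have r: "r *\<^sub>R e \<in> E" for r using cD(2) e(1) by (simp add: subspace_scale)
    have "x = \<Psi> x - (f' x - k - x \<bullet> e) *\<^sub>R e" by (simp add: \<Psi>_def)
    then show ?thesis using r cD(2) \<Psi>_def by (metis subspace_add subspace_diff)
  qed
  have "({p \<in> U. \<phi> p \<in> U0}, \<Psi> \<circ> \<phi>, E) \<in> atlas"
    using S(5,6) \<Psi> \<Psi>E by (intro maximal_atlas_reparametrize[OF c]) (auto simp: \<Psi>_def[abs_def])
  moreover have "q \<in> {p \<in> U. \<phi> p \<in> U0}" using c0 S by simp
  moreover have "(\<Psi> \<circ> \<phi>) p \<bullet> e = h p - k" if "p \<in> {p \<in> U. \<phi> p \<in> U0}" for p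
  proof -
    have "f' (\<phi> p) = h p" using that S(2) W(3) cD(6) by auto
    then show ?thesis using e(2) by (simp add: \<Psi>_def inner_add_left)
  qed
  ultimately show ?thesis using that[OF _ _ dimE e(1,2)] by blast
qed

text \<open>In an adapted chart \<open>h\<close> is affine in the coordinates, so its differential
  is the inner product with \<open>e\<close>.\<close>

lemma adapted_chart_derivative:
  assumes h: "smooth_fun_on M (points M) h" and c: "(U, \<phi>, E) \<in> atlas" and q: "q \<in> U" and a: "a \<in> E"
    and e: "\<And>p. p \<in> U \<Longrightarrow> \<phi> p \<bullet> e = h p - k"
  shows "coord_field M (U, \<phi>, E) a q h = a \<bullet> e"
proof -
  note cD = maximalD[OF c]
  have "dderiv (h \<circ> inv_into U \<phi>) (\<phi> q) a = dderiv (\<lambda>y. y \<bullet> e + k) (\<phi> q) a"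
    by (rule dderiv_cong[OF cD(2,3) _ smooth_on_add[OF smooth_on_linear[OF bounded_linear_inner_left] smooth_on_const]])
      (use q a e cD(6) in auto)
  also have "((\<lambda>t. (\<phi> q + t *\<^sub>R a) \<bullet> e + k) has_vector_derivative a \<bullet> e) (at 0)"
    by (auto intro!: derivative_eq_intros simp: has_vector_derivative_def inner_add_left)
  then have "dderiv (\<lambda>y. y \<bullet> e + k) (\<phi> q) a = a \<bullet> e" by (rule dderiv_unique[OF cD(2,3)])
  moreover have "smooth_near M q h" using smooth_fun_on_points_near[OF h] q cD(5) by blast
  ultimately show ?thesis by (simp add: coord_field_eq[OF c q a])
qed

lemma level_set_slice:
  assumes c: "(U, \<phi>, E) \<in> atlas" and e: "e \<in> E" and h: "\<And>p. p \<in> U \<Longrightarrow> \<phi> p \<bullet> e = h p - k"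
  shows "(U \<inter> level_set M h k, \<phi>, {v \<in> E. v \<bullet> e = 0}) \<in> charts (submfd M (level_set M h k))"
proof -
  have "subspace {v \<in> E. v \<bullet> e = 0}"
    using maximalD(2)[OF c] by (auto simp: subspace_def inner_add_left)
  moreover have "\<phi> ` (U \<inter> level_set M h k) = \<phi> ` U \<inter> {v \<in> E. v \<bullet> e = 0}"
    using h maximalD(5,7)[OF c] by (auto simp: level_set_def)
  ultimately show ?thesis using c unfolding in_charts_submfd_iff by blast
qed

end

section \<open>The inclusion of a submanifold and the restriction of forms\<close>

locale smooth_submfd = smooth_mfd M n + sub: smooth_mfd "submfd M S" m
  for M :: "('a, 'e::euclidean_space) mfd" and n S m
begin

abbreviation N where "N \<equiv> submfd M S"

lemma slice_chartD:
  assumes "(V, \<phi>, F) \<in> charts N"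
  obtains U E where "V = U \<inter> S" "(U, \<phi>, E) \<in> atlas" "subspace F" "F \<subseteq> E" "\<phi> ` (U \<inter> S) = \<phi> ` U \<inter> F"
  using assms in_charts_submfd_iff by metis

lemma smooth_fun_on_restrict:
  assumes "smooth_fun_on M W f"
  shows "smooth_fun_on N (W \<inter> S) f"
  unfolding smooth_fun_on_def
proof clarify
  fix V \<phi> F assume "(V, \<phi>, F) \<in> charts N"
  then obtain U E where c: "V = U \<inter> S" "(U, \<phi>, E) \<in> atlas" by (rule slice_chartD)
  have "smooth_on (\<phi> ` (V \<inter> (W \<inter> S))) (f \<circ> inv_into U \<phi>)"
    by (rule smooth_on_subset[OF smooth_fun_on_maximal[OF assms c(2)]]) (auto simp: c(1))
  then show "smooth_on (\<phi> ` (V \<inter> (W \<inter> S))) (f \<circ> inv_into V \<phi>)"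
    by (rule smooth_on_cong) (subst o_apply, subst inv_into_restrict[OF maximalD(6)[OF c(2)]], auto simp: c(1))
qed

lemma smooth_near_restrict:
  assumes "smooth_near M p f" "p \<in> S"
  shows "smooth_near N p f"
proof -
  obtain W where "openin (mtop M) W" "p \<in> W" "smooth_fun_on M W f" using assms(1) by (auto simp: smooth_near_def)
  then show ?thesis
    using smooth_fun_on_restrict assms(2) unfolding smooth_near_def
    by (intro exI[of _ "W \<inter> S"]) (auto simp: openin_subtopology)
qed

text \<open>The slice chart uses the same map \<open>\<phi>\<close>, so for small parameters the
  coordinate lines in \<open>S\<close> and in \<open>M\<close> are one curve. On functions that are
  not smooth near \<open>p\<close> in \<open>M\<close> both sides take the default value 0.\<close>

lemma tmap_inclusion_coord_field:
  assumes s: "(U \<inter> S, \<phi>, F) \<in> charts N" and c: "(U, \<phi>, E) \<in> atlas"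
    and F: "F \<subseteq> E" and p: "p \<in> U \<inter> S" and a: "a \<in> F"
  shows "tmap M id p (coord_field N (U \<inter> S, \<phi>, F) a p) = coord_field M (U, \<phi>, E) a p"
proof
  fix f
  note sm = sub.charts_maximal[OF s]
  note sD = sub.maximalD[OF sm] and cD = maximalD[OF c]
  have aE: "a \<in> E" and pU: "p \<in> U" using F a p by auto
  show "tmap M id p (coord_field N (U \<inter> S, \<phi>, F) a p) f = coord_field M (U, \<phi>, E) a p f"
  proof (cases "smooth_near M p f")
    case True
    then have T: "smooth_near N p f" using p smooth_near_restrict by blast
    have "((\<lambda>t. f (inv_into U \<phi> (\<phi> p + t *\<^sub>R a))) has_real_derivative dderiv (f \<circ> inv_into U \<phi>) (\<phi> p) a) (at 0)"
      by (rule has_derivative_coord_curve[OF True c pU aE])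
    moreover have "((\<lambda>t. f (inv_into (U \<inter> S) \<phi> (\<phi> p + t *\<^sub>R a))) has_real_derivative dderiv (f \<circ> inv_into (U \<inter> S) \<phi>) (\<phi> p) a) (at 0)"
      by (rule sub.has_derivative_coord_curve[OF T sm p a])
    moreover have ev: "\<forall>\<^sub>F t in nhds 0. f (inv_into (U \<inter> S) \<phi> (\<phi> p + t *\<^sub>R a)) = f (inv_into U \<phi> (\<phi> p + t *\<^sub>R a))"
      using eventually_line_in[OF sD(3,2) imageI[OF p] a]
      by eventually_elim (simp add: inv_into_restrict[OF cD(6)])
    ultimately have "dderiv (f \<circ> inv_into (U \<inter> S) \<phi>) (\<phi> p) a = dderiv (f \<circ> inv_into U \<phi>) (\<phi> p) a"
      using DERIV_cong_ev[OF refl ev refl] DERIV_unique by blast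
    then show ?thesis
      using True T by (simp add: tmap_def coord_field_eq[OF c pU aE] sub.coord_field_eq[OF sm p a])
  next
    case False
    then show ?thesis by (simp add: tmap_def coord_field_eq[OF c pU aE])
  qed
qed

lemma tmap_inclusion_tangent:
  assumes "p \<in> points N" "w \<in> tangent_space N p"
  shows "tmap M id p w \<in> tangent_space M p"
proof -
  obtain V \<phi> F where s: "(V, \<phi>, F) \<in> charts N" "p \<in> V" using sub.chart_cover[OF assms(1)] by blast
  then obtain U E where c: "V = U \<inter> S" "(U, \<phi>, E) \<in> atlas" "F \<subseteq> E" using slice_chartD by metis
  obtain a where a: "a \<in> F" "w = coord_field N (V, \<phi>, F) a p"
    using sub.tangent_coord[OF assms(2) sub.charts_maximal[OF s(1)] s(2)] by blast
  have "tmap M id p w = coord_field M (U, \<phi>, E) a p"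
    using tmap_inclusion_coord_field[of U \<phi> F E p a] s c a by simp
  then show ?thesis using coord_field_tangent[OF c(2), of p a] a c s by auto
qed

lemma tmap_inclusion_linear:
  "tmap M id p (tadd (tscale r u) w) = tadd (tscale r (tmap M id p u)) (tmap M id p w)"
  by (auto simp: tmap_def tadd_def tscale_def)

lemma pullback_coord_field:
  assumes s: "(U \<inter> S, \<phi>, F) \<in> charts N" and c: "(U, \<phi>, E) \<in> atlas"
    and F: "F \<subseteq> E" and p: "p \<in> U \<inter> S" and "set as \<subseteq> F"
  shows "pullback M id \<alpha> p (map (\<lambda>a. coord_field N (U \<inter> S, \<phi>, F) a p) as) =
    \<alpha> p (map (\<lambda>a. coord_field M (U, \<phi>, E) a p) as)"
proof -
  have "map (tmap M id p) (map (\<lambda>a. coord_field N (U \<inter> S, \<phi>, F) a p) as) = map (\<lambda>a. coord_field M (U, \<phi>, E) a p) as"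
    using assms(5) tmap_inclusion_coord_field[OF s c F p] by auto
  then show ?thesis by (simp only: pullback_def id_apply)
qed

lemma smooth_fun_on_cong:
  assumes "smooth_fun_on N W f" "\<And>p. p \<in> W \<Longrightarrow> g p = f p"
  shows "smooth_fun_on N W g"
  unfolding smooth_fun_on_def
proof clarify
  fix V \<phi> F assume s: "(V, \<phi>, F) \<in> charts N"
  then have "smooth_on (\<phi> ` (V \<inter> W)) (f \<circ> inv_into V \<phi>)" using assms(1) by (auto simp: smooth_fun_on_def)
  then show "smooth_on (\<phi> ` (V \<inter> W)) (g \<circ> inv_into V \<phi>)"
    by (rule smooth_on_cong) (use assms(2) sub.maximalD(6)[OF sub.charts_maximal[OF s]] in auto)
qed

lemma pullback_one_form:
  assumes \<theta>: "differential_form M 1 \<theta>"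
  shows "differential_form N 1 (pullback M id \<theta>)"
  unfolding differential_form_def
proof (intro conjI ballI allI impI)
  fix p vs i r u w
  assume p: "p \<in> points N" and vs: "length vs = 1 \<and> set vs \<subseteq> tangent_space N p" and i: "i < (1::nat)"
    and u: "u \<in> tangent_space N p" "w \<in> tangent_space N p"
  obtain v where v: "vs = [v]" using vs by (auto simp: length_Suc_conv)
  have pM: "p \<in> points M" using p by simp
  show "pullback M id \<theta> p (vs[i := tadd (tscale r u) w]) = r * pullback M id \<theta> p (vs[i := u]) + pullback M id \<theta> p (vs[i := w])"
    using i differential_form_1_linear[OF \<theta> pM tmap_inclusion_tangent[OF p u(1)] tmap_inclusion_tangent[OF p u(2)]]
    by (simp add: v pullback_def tmap_inclusion_linear)
next
  fix c assume "c \<in> charts N"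
  then obtain V \<phi> F where s: "c = (V, \<phi>, F)" "(V, \<phi>, F) \<in> charts N" by (cases c) auto
  obtain U E where c: "V = U \<inter> S" "(U, \<phi>, E) \<in> atlas" "F \<subseteq> E" using slice_chartD[OF s(2)] by metis
  have "smooth_fun_on N V (\<lambda>q. pullback M id \<theta> q (map (\<lambda>a. coord_field N (V, \<phi>, F) a q) as))"
    if as: "length as = 1" "set as \<subseteq> F" for as
  proof -
    obtain a where a: "as = [a]" using as(1) by (auto simp: length_Suc_conv)
    have "smooth_fun_on N (U \<inter> S) (\<lambda>q. \<theta> q [coord_field M (U, \<phi>, E) a q])"
      using as a c(3) by (intro smooth_fun_on_restrict one_form_smooth[OF \<theta> c(2)]) auto
    then show ?thesis unfolding c(1)
      by (rule smooth_fun_on_cong) (use pullback_coord_field[OF s(2)[unfolded c(1)] c(2,3) _ as(2)] a in auto)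
  qed
  then show "case c of (U, \<phi>, E) \<Rightarrow> \<forall>as. length as = 1 \<and> set as \<subseteq> E \<longrightarrow>
      smooth_fun_on N U (\<lambda>q. pullback M id \<theta> q (map (\<lambda>a. coord_field N (U, \<phi>, E) a q) as))"
    by (simp add: s(1))
qed simp

text \<open>In a slice chart and its parent chart the coefficients agree on the slice, and
  directions in \<open>F\<close> do not leave the slice. Chart independence of \<open>ext_d\<close>
  on both manifolds permits exactly these two charts to be used.\<close>

lemma ext_d_pullback:
  assumes \<theta>: "differential_form M 1 \<theta>" and s: "(U \<inter> S, \<phi>, F) \<in> charts N" and c: "(U, \<phi>, E) \<in> atlas"
    and F: "F \<subseteq> E" and p: "p \<in> U \<inter> S" and a: "a0 \<in> F" "a1 \<in> F"
  shows "ext_d N (pullback M id \<theta>) p [coord_field N (U \<inter> S, \<phi>, F) a0 p, coord_field N (U \<inter> S, \<phi>, F) a1 p] =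
    ext_d M \<theta> p [coord_field M (U, \<phi>, E) a0 p, coord_field M (U, \<phi>, E) a1 p]"
proof -
  note sm = sub.charts_maximal[OF s]
  note sD = sub.maximalD[OF sm] and cD = maximalD[OF c]
  have aE: "a0 \<in> E" "a1 \<in> E" and pU: "p \<in> U" using F a p by auto
  have "dderiv (\<lambda>x. pullback M id \<theta> (inv_into (U \<inter> S) \<phi> x) [coord_field N (U \<inter> S, \<phi>, F) a (inv_into (U \<inter> S) \<phi> x)]) (\<phi> p) b =
      dderiv (\<lambda>x. \<theta> (inv_into U \<phi> x) [coord_field M (U, \<phi>, E) a (inv_into U \<phi> x)]) (\<phi> p) b" if ab: "a \<in> F" "b \<in> F" for a b
  proof (rule dderiv_cong[OF sD(2,3)])
    show "smooth_on (\<phi> ` (U \<inter> S)) (\<lambda>x. \<theta> (inv_into U \<phi> x) [coord_field M (U, \<phi>, E) a (inv_into U \<phi> x)])"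
      using F ab by (intro smooth_on_subset[OF one_form_coord_smooth[OF \<theta> c]]) auto
    fix x assume "x \<in> \<phi> ` (U \<inter> S)"
    then obtain q where q: "q \<in> U \<inter> S" "x = \<phi> q" by blast
    then have "inv_into (U \<inter> S) \<phi> x = q" "inv_into U \<phi> x = q"
      using inv_into_f_f[OF sD(6) q(1)] inv_into_f_f[OF cD(6), of q] by auto
    then show "pullback M id \<theta> (inv_into (U \<inter> S) \<phi> x) [coord_field N (U \<inter> S, \<phi>, F) a (inv_into (U \<inter> S) \<phi> x)] =
       \<theta> (inv_into U \<phi> x) [coord_field M (U, \<phi>, E) a (inv_into U \<phi> x)]"
      using pullback_coord_field[OF s c F q(1), of "[a]" \<theta>] ab by simp
  qed (use p ab in auto)
  then show ?thesis
    using a unfolding ext_d_chart[OF \<theta> c pU aE] sub.ext_d_chart[OF pullback_one_form[OF \<theta>] sm p a] by simp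
qed

end

section \<open>Wedge powers of a two-form\<close>

text \<open>The hyperbolic pairs are \<open>(1, 2), (3, 4), \<dots>\<close>; index \<open>0\<close> is left for the kernel direction of the
  restricted two-form.\<close>

definition std_symplectic :: "nat \<Rightarrow> nat \<Rightarrow> real" where
  "std_symplectic a b = (if odd a \<and> b = Suc a then 1 else if odd b \<and> a = Suc b then - 1 else 0)"

text \<open>The inner permutations act on the last \<open>l\<close> positions, hence are absorbed by translating the outer sum.\<close>

lemma sum_permutations_absorb:
  fixes H :: "(nat \<Rightarrow> nat) \<Rightarrow> real" and A :: "(nat \<Rightarrow> nat) \<Rightarrow> real"
  assumes A: "\<And>p \<rho>. (\<And>i. i < k \<Longrightarrow> \<rho> i = i) \<Longrightarrow> A (p \<circ> \<rho>) = A p"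
    and H: "\<And>f g. (\<And>j. j < l \<Longrightarrow> f j = g j) \<Longrightarrow> H f = H g"
  shows "(\<Sum>p | p permutes {..<k + l}. of_int (sign p) * A p * (\<Sum>\<rho> | \<rho> permutes {..<l}. of_int (sign \<rho>) * H (\<lambda>j. p (k + \<rho> j)))) =
    fact l * (\<Sum>p | p permutes {..<k + l}. of_int (sign p) * A p * H (\<lambda>j. p (k + j)))"
proof -
  let ?S = "{p. p permutes {..<k + l}}"
  have "(\<Sum>p\<in>?S. of_int (sign p) * A p * (of_int (sign \<rho>) * H (\<lambda>j. p (k + \<rho> j)))) =
      (\<Sum>p\<in>?S. of_int (sign p) * A p * H (\<lambda>j. p (k + j)))" if \<rho>: "\<rho> permutes {..<l}" for \<rho>
  proof -
    \<comment> \<open>\<open>\<rho>\<close> transported to the last \<open>l\<close> positions. It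
      fixes the first \<open>k\<close>, so \<open>A\<close> does not notice it, while its sign is
      that of \<open>\<rho>\<close>.\<close>
    define \<rho>' where "\<rho>' = map_permutation {..<l} ((+) k) \<rho>"
    have "\<rho>' permutes (+) k ` {..<l}" unfolding \<rho>'_def
      by (rule map_permutation_permutes[OF _ \<rho>]) (simp add: bij_betw_def)
    then have perm: "\<rho>' permutes {k..<k + l}" by (simp add: image_add_atLeastLessThan lessThan_atLeast0 add.commute)
    then have perm': "\<rho>' permutes {..<k + l}" by (rule permutes_subset) auto
    have fixk: "\<rho>' i = i" if "i < k" for i using perm that by (simp add: permutes_not_in)
    have app: "\<rho>' (k + j) = k + \<rho> j" if "j < l" for j
      unfolding \<rho>'_def using that by (intro map_permutation_apply) auto
    have sgn: "sign \<rho>' = sign \<rho>" unfolding \<rho>'_def by (intro sign_map_permutation \<rho>) auto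
    have "(\<Sum>p\<in>?S. of_int (sign p) * A p * H (\<lambda>j. p (k + j))) =
        (\<Sum>p\<in>?S. of_int (sign (p \<circ> \<rho>')) * A (p \<circ> \<rho>') * H (\<lambda>j. (p \<circ> \<rho>') (k + j)))"
      by (rule sum_permutations_compose_right[OF perm'])
    also have "\<dots> = (\<Sum>p\<in>?S. of_int (sign p) * A p * (of_int (sign \<rho>) * H (\<lambda>j. p (k + \<rho> j))))"
    proof (rule sum.cong[OF refl])
      fix p assume "p \<in> ?S"
      then have "permutation p" "permutation \<rho>'"
        using perm' permutation_permutes by (metis finite_lessThan mem_Collect_eq)+
      then have "sign (p \<circ> \<rho>') = sign p * sign \<rho>" by (simp add: sign_compose sgn)
      moreover have "H (\<lambda>j. (p \<circ> \<rho>') (k + j)) = H (\<lambda>j. p (k + \<rho> j))" by (rule H) (simp add: app)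
      ultimately show "of_int (sign (p \<circ> \<rho>')) * A (p \<circ> \<rho>') * H (\<lambda>j. (p \<circ> \<rho>') (k + j)) =
          of_int (sign p) * A p * (of_int (sign \<rho>) * H (\<lambda>j. p (k + \<rho> j)))"
        by (simp add: A[OF fixk])
    qed
    finally show ?thesis by simp
  qed
  then have "(\<Sum>\<rho> | \<rho> permutes {..<l}. \<Sum>p\<in>?S. of_int (sign p) * A p * (of_int (sign \<rho>) * H (\<lambda>j. p (k + \<rho> j)))) =
      (\<Sum>\<rho> | \<rho> permutes {..<l}. \<Sum>p\<in>?S. of_int (sign p) * A p * H (\<lambda>j. p (k + j)))"
    by (rule sum.cong[OF refl]) blast
  also have "\<dots> = fact l * (\<Sum>p\<in>?S. of_int (sign p) * A p * H (\<lambda>j. p (k + j)))"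
    using card_permutations[of "{..<l}" l] by simp
  finally show ?thesis
    by (subst (asm) sum.swap) (simp add: sum_distrib_left)
qed

text \<open>Absorbing the inner permutations produces the factor \<open>fact (m * 2)\<close> that
  cancels the normalisation of \<open>wedge\<close>; each two-form factor leaves behind one division
  by 2.\<close>

lemma wedge_power_eq:
  "wedge_power 2 \<beta> m vs = (\<Sum>p | p permutes {..<m * 2}. of_int (sign p) * (\<Prod>i<m. \<beta> [vs ! p (2 * i), vs ! p (2 * i + 1)])) / 2 ^ m"
proof (induction m arbitrary: vs)
  case 0
  then show ?case by simp
next
  case (Suc m)
  let ?A = "\<lambda>p. \<beta> [vs ! p 0, vs ! p 1]" and ?H = "\<lambda>f. \<Prod>i<m. \<beta> [vs ! f (2 * i), vs ! f (2 * i + 1)]"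
  have W: "wedge_power 2 \<beta> m (map (\<lambda>i. vs ! p i) [2..<2 + m * 2]) =
      (\<Sum>\<rho> | \<rho> permutes {..<m * 2}. of_int (sign \<rho>) * ?H (\<lambda>j. p (2 + \<rho> j))) / 2 ^ m" for p
  proof -
    have "map (\<lambda>i. vs ! p i) [2..<2 + m * 2] ! \<rho> j = vs ! p (2 + \<rho> j)" if "\<rho> permutes {..<m * 2}" "j < m * 2" for \<rho> j
      using permutes_in_image[OF that(1), of j] that(2) by (simp del: upt_Suc)
    then show ?thesis unfolding Suc.IH by (intro arg_cong2[where f = "(/)"] sum.cong arg_cong2[where f = "(*)"] prod.cong refl) auto
  qed
  have A: "map (\<lambda>i. vs ! p i) [0..<2] = [vs ! p 0, vs ! p 1]" for p by (simp add: upt_rec)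
  have "wedge_power 2 \<beta> (Suc m) vs = (\<Sum>p | p permutes {..<2 + m * 2}. of_int (sign p) * ?A p *
      (\<Sum>\<rho> | \<rho> permutes {..<m * 2}. of_int (sign \<rho>) * ?H (\<lambda>j. p (2 + \<rho> j)))) / (2 * fact (m * 2) * 2 ^ m)"
    unfolding wedge_power.simps wedge_def W A by (simp add: fact_2 ac_simps flip: sum_divide_distrib)
  also have "(\<Sum>p | p permutes {..<2 + m * 2}. of_int (sign p) * ?A p *
      (\<Sum>\<rho> | \<rho> permutes {..<m * 2}. of_int (sign \<rho>) * ?H (\<lambda>j. p (2 + \<rho> j)))) =
      fact (m * 2) * (\<Sum>p | p permutes {..<2 + m * 2}. of_int (sign p) * ?A p * ?H (\<lambda>j. p (2 + j)))"
    by (rule sum_permutations_absorb) auto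
  also have "(\<Sum>p | p permutes {..<2 + m * 2}. of_int (sign p) * ?A p * ?H (\<lambda>j. p (2 + j))) =
     (\<Sum>p | p permutes {..<Suc m * 2}. of_int (sign p) * (\<Prod>i<Suc m. \<beta> [vs ! p (2 * i), vs ! p (2 * i + 1)]))"
    by (simp add: prod.lessThan_Suc_shift mult.assoc del: prod.lessThan_Suc)
  finally show ?case by simp
qed

text \<open>Position 0 feeds the one-form and the positions \<open>2 * i + 1\<close>,
  \<open>2 * i + 2\<close> feed the two-form. Summing with signs gives the wedge product up to the
  factor \<open>2 ^ m\<close>, which affects neither smoothness nor vanishing.\<close>

definition contact_term :: "('v list \<Rightarrow> real) \<Rightarrow> ('v list \<Rightarrow> real) \<Rightarrow> nat \<Rightarrow> 'v list \<Rightarrow> (nat \<Rightarrow> nat) \<Rightarrow> real" where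
  "contact_term \<eta> \<beta> m vs p = \<eta> [vs ! p 0] * (\<Prod>i<m. \<beta> [vs ! p (2 * i + 1), vs ! p (2 * i + 2)])"

definition contact_sum :: "('v list \<Rightarrow> real) \<Rightarrow> ('v list \<Rightarrow> real) \<Rightarrow> nat \<Rightarrow> 'v list \<Rightarrow> real" where
  "contact_sum \<eta> \<beta> m vs = (\<Sum>p | p permutes {..<2 * m + 1}. of_int (sign p) * contact_term \<eta> \<beta> m vs p)"

lemma wedge_wedge_power_eq:
  "wedge 1 (2 * m) \<eta> (wedge_power 2 \<beta> m) vs = contact_sum \<eta> \<beta> m vs / 2 ^ m"
proof -
  let ?A = "\<lambda>p. \<eta> [vs ! p 0]" and ?H = "\<lambda>f. \<Prod>i<m. \<beta> [vs ! f (2 * i), vs ! f (2 * i + 1)]"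
  have W: "wedge_power 2 \<beta> m (map (\<lambda>i. vs ! p i) [1..<1 + 2 * m]) =
      (\<Sum>\<rho> | \<rho> permutes {..<2 * m}. of_int (sign \<rho>) * ?H (\<lambda>j. p (1 + \<rho> j))) / 2 ^ m" for p
  proof -
    have "map (\<lambda>i. vs ! p i) [1..<1 + 2 * m] ! \<rho> j = vs ! p (1 + \<rho> j)" if "\<rho> permutes {..<2 * m}" "j < 2 * m" for \<rho> j
      using permutes_in_image[OF that(1), of j] that(2) by (simp del: upt_Suc)
    then show ?thesis unfolding wedge_power_eq mult.commute[of m 2]
      by (intro arg_cong2[where f = "(/)"] sum.cong arg_cong2[where f = "(*)"] prod.cong refl) auto
  qed
  have "wedge 1 (2 * m) \<eta> (wedge_power 2 \<beta> m) vs = (\<Sum>p | p permutes {..<1 + 2 * m}. of_int (sign p) * ?A p *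
      (\<Sum>\<rho> | \<rho> permutes {..<2 * m}. of_int (sign \<rho>) * ?H (\<lambda>j. p (1 + \<rho> j)))) / (fact (2 * m) * 2 ^ m)"
    unfolding wedge_def W by (simp add: ac_simps flip: sum_divide_distrib)
  also have "(\<Sum>p | p permutes {..<1 + 2 * m}. of_int (sign p) * ?A p *
      (\<Sum>\<rho> | \<rho> permutes {..<2 * m}. of_int (sign \<rho>) * ?H (\<lambda>j. p (1 + \<rho> j)))) =
      fact (2 * m) * (\<Sum>p | p permutes {..<1 + 2 * m}. of_int (sign p) * ?A p * ?H (\<lambda>j. p (1 + j)))"
    by (rule sum_permutations_absorb) auto
  finally show ?thesis by (simp add: contact_sum_def contact_term_def mult.assoc)
qed

text \<open>Composing every permutation with the exchange of \<open>i\<close> and \<open>j\<close>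
  leaves the terms unchanged and flips all signs, so the sum equals its own negative.\<close>

lemma contact_sum_alternating:
  assumes "i < 2 * m + 1" "j < 2 * m + 1" "i \<noteq> j" "vs ! i = vs ! j"
  shows "contact_sum \<eta> \<beta> m vs = 0"
proof -
  let ?T = "\<lambda>p. of_int (sign p) * contact_term \<eta> \<beta> m vs p"
  let ?S = "{p. p permutes {..<2 * m + 1}}"
  have t: "Transposition.transpose i j permutes {..<2 * m + 1}" using assms by (intro permutes_swap_id) auto
  have v: "vs ! Transposition.transpose i j k = vs ! k" for k using assms(4) by (simp add: Transposition.transpose_def)
  have "sum ?T ?S = sum (\<lambda>p. ?T (Transposition.transpose i j \<circ> p)) ?S" by (rule setum_permutations_compose_left[OF t])
  also have "\<dots> = sum (\<lambda>p. - ?T p) ?S"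
  proof (rule sum.cong[OF refl])
    fix p assume "p \<in> ?S"
    then have "permutation p" "permutation (Transposition.transpose i j)"
      using t permutation_permutes by (metis finite_lessThan mem_Collect_eq)+
    then show "?T (Transposition.transpose i j \<circ> p) = - ?T p"
      using assms(3) by (simp add: contact_term_def sign_compose sign_swap_id v)
  qed
  finally show ?thesis by (simp add: contact_sum_def sum_negf)
qed

text \<open>The vector in slot \<open>i\<close> enters exactly one factor, at the position
  \<open>j\<close> that \<open>p\<close> sends to \<open>i\<close>. The set \<open>T\<close> limits
  the linearity required of \<beta> to the vectors that can occur beside it.\<close>

lemma contact_term_linear:
  assumes p: "p permutes {..<2 * m + 1}" and vs: "length vs = 2 * m + 1" "set vs \<subseteq> T" and i: "i < 2 * m + 1"
    and \<eta>: "\<eta> [x] = r * \<eta> [u] + (\<eta> [w] :: real)"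
    and \<beta>: "\<And>z. z \<in> T \<Longrightarrow> \<beta> [x, z] = r * \<beta> [u, z] + (\<beta> [w, z] :: real)" "\<And>z. z \<in> T \<Longrightarrow> \<beta> [z, x] = r * \<beta> [z, u] + \<beta> [z, w]"
  shows "contact_term \<eta> \<beta> m (vs[i := x]) p = r * contact_term \<eta> \<beta> m (vs[i := u]) p + contact_term \<eta> \<beta> m (vs[i := w]) p"
proof -
  have "i \<in> p ` {..<2 * m + 1}" using permutes_image[OF p] i by simp
  then obtain j where j: "j < 2 * m + 1" "i = p j" by auto
  have other: "vs[i := y] ! p k = vs ! p k" if "k \<noteq> j" for k y
    by (rule nth_list_update_neq) (metis j(2) permutes_inj[OF p] injD that)
  have at_j: "vs[i := y] ! p j = y" for y using i vs j by simp
  have inT: "vs ! p k \<in> T" if "k < 2 * m + 1" for k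
    using vs permutes_in_image[OF p, of k] that nth_mem by fastforce
  show ?thesis
  proof (cases "j = 0")
    case True
    then show ?thesis using \<eta> at_j other by (simp add: contact_term_def algebra_simps)
  next
    case False
    \<comment> \<open>The index of the pair of positions \<open>2 * k + 1\<close>,
      \<open>2 * k + 2\<close> that contains \<open>j\<close>.\<close>
    define k where "k = (j - 1) div 2"
    have k: "k < m" using j False by (auto simp: k_def)
    have jk: "j = 2 * k + 1 \<or> j = 2 * k + 2" using False by (auto simp: k_def)
    define G where "G y i' = \<beta> [vs[i := y] ! p (2 * i' + 1), vs[i := y] ! p (2 * i' + 2)]" for y i'
    have rest: "G y i' = \<beta> [vs ! p (2 * i' + 1), vs ! p (2 * i' + 2)]" if "i' \<noteq> k" for y i'
    proof -
      have "2 * i' + 1 \<noteq> j" "2 * i' + 2 \<noteq> j" using jk that by presburger+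
      then show ?thesis unfolding G_def by (simp only: other not_False_eq_True)
    qed
    have Gk: "G x k = r * G u k + G w k"
      using jk
    proof
      assume jk: "j = 2 * k + 1"
      then have "2 * k + 2 \<noteq> j" by simp
      then have "G y k = \<beta> [y, vs ! p (2 * k + 2)]" for y
        unfolding G_def other[OF \<open>2 * k + 2 \<noteq> j\<close>] using at_j by (simp add: jk)
      then show ?thesis using \<beta>(1) inT k by simp
    next
      assume jk: "j = 2 * k + 2"
      then have "2 * k + 1 \<noteq> j" by simp
      then have "G y k = \<beta> [vs ! p (2 * k + 1), y]" for y
        unfolding G_def other[OF \<open>2 * k + 1 \<noteq> j\<close>] using at_j by (simp add: jk)
      then show ?thesis using \<beta>(2) inT k by simp
    qed
    have "prod (G y) {..<m} = G y k * (\<Prod>i'\<in>{..<m} - {k}. \<beta> [vs ! p (2 * i' + 1), vs ! p (2 * i' + 2)])" for y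
      using k rest by (subst prod.remove[of _ k]) auto
    moreover have "contact_term \<eta> \<beta> m (vs[i := y]) p = \<eta> [vs ! p 0] * prod (G y) {..<m}" for y
      unfolding contact_term_def G_def using other[of 0] False by simp
    ultimately show ?thesis by (simp add: Gk algebra_simps)
  qed
qed

lemma contact_sum_linear:
  assumes "length vs = 2 * m + 1" "set vs \<subseteq> T" "i < 2 * m + 1" "\<eta> [x] = r * \<eta> [u] + \<eta> [w]"
    and "\<And>z. z \<in> T \<Longrightarrow> \<beta> [x, z] = r * \<beta> [u, z] + \<beta> [w, z]" "\<And>z. z \<in> T \<Longrightarrow> \<beta> [z, x] = r * \<beta> [z, u] + \<beta> [z, w]"
  shows "contact_sum \<eta> \<beta> m (vs[i := x]) = r * contact_sum \<eta> \<beta> m (vs[i := u]) + contact_sum \<eta> \<beta> m (vs[i := w])"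
proof -
  have "contact_sum \<eta> \<beta> m (vs[i := x]) = (\<Sum>p | p permutes {..<2 * m + 1}.
      r * (of_int (sign p) * contact_term \<eta> \<beta> m (vs[i := u]) p) + of_int (sign p) * contact_term \<eta> \<beta> m (vs[i := w]) p)"
    unfolding contact_sum_def
    by (rule sum.cong[OF refl], subst contact_term_linear[OF _ assms]) (simp_all add: algebra_simps)
  then show ?thesis by (simp only: contact_sum_def sum.distrib sum_distrib_left)
qed

text \<open>In a nonzero term \<open>p\<close> maps pairs \<open>{2i+1, 2i+2}\<close> to pairs. Moving pairs around is an even permutation, and a swap
  within a pair changes the sign of \<open>p\<close> and of one factor.\<close>

lemma std_symplectic_sign_nonneg:
  "p permutes {1..<2 * m + 1} \<Longrightarrow> 0 \<le> of_int (sign p) * (\<Prod>i<m. std_symplectic (p (2 * i + 1)) (p (2 * i + 2)))"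
proof (induction m arbitrary: p)
  case 0
  then show ?case by (simp add: sign_def)
next
  case (Suc m)
  let ?P = "\<lambda>n p. \<Prod>i<n. std_symplectic (p (2 * i + 1)) (p (2 * i + 2))"
  have perm: "permutation \<rho>" if "\<rho> permutes {1..<2 * Suc m + 1}" for \<rho>
    using that permutation_permutes by blast
  \<comment> \<open>With the last pair fixed, its factor is 1 and what remains is a permutation for
    the induction hypothesis.\<close>
  have last: "0 \<le> of_int (sign \<rho>) * ?P (Suc m) \<rho>"
    if \<rho>: "\<rho> permutes {1..<2 * Suc m + 1}" "\<rho> (2 * m + 1) = 2 * m + 1" "\<rho> (2 * m + 2) = 2 * m + 2" for \<rho>
  proof -
    have "\<rho> permutes {1..<2 * m + 1}"
    proof (rule permutes_superset[OF \<rho>(1)])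
      fix x assume "x \<in> {1..<2 * Suc m + 1} - {1..<2 * m + 1}"
      then have "x = 2 * m + 1 \<or> x = 2 * m + 2" by auto
      then show "\<rho> x = x" using \<rho> by auto
    qed
    from Suc.IH[OF this] show ?thesis using \<rho>(2,3) by (simp add: std_symplectic_def)
  qed
  have last': "0 \<le> of_int (sign \<rho>) * ?P (Suc m) \<rho>"
    if \<rho>: "\<rho> permutes {1..<2 * Suc m + 1}" "{\<rho> (2 * m + 1), \<rho> (2 * m + 2)} = {2 * m + 1, 2 * m + 2}" for \<rho>
  proof (cases "\<rho> (2 * m + 1) = 2 * m + 1")
    case True
    then show ?thesis using \<rho> by (intro last) (auto simp: doubleton_eq_iff)
  next
    case False
    then have v: "\<rho> (2 * m + 1) = 2 * m + 2" "\<rho> (2 * m + 2) = 2 * m + 1" using \<rho>(2) by (auto simp: doubleton_eq_iff)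
    define t where "t = Transposition.transpose (2 * m + 1) (2 * m + 2)"
    have t: "t permutes {1..<2 * Suc m + 1}" unfolding t_def by (rule permutes_swap_id) auto
    have "\<rho> \<circ> t permutes {1..<2 * Suc m + 1}" by (rule permutes_compose[OF t \<rho>(1)])
    then have nonneg: "0 \<le> of_int (sign (\<rho> \<circ> t)) * ?P (Suc m) (\<rho> \<circ> t)" by (rule last) (use v in \<open>simp_all add: t_def\<close>)
    have sgn: "sign (\<rho> \<circ> t) = - sign \<rho>"
      using sign_compose[OF perm[OF \<rho>(1)] perm[OF t]] by (simp add: t_def sign_swap_id)
    have Pm: "?P m (\<rho> \<circ> t) = ?P m \<rho>" by (rule prod.cong) (auto simp: t_def Transposition.transpose_def)
    have "std_symplectic ((\<rho> \<circ> t) (2 * m + 1)) ((\<rho> \<circ> t) (2 * m + 2)) = - std_symplectic (\<rho> (2 * m + 1)) (\<rho> (2 * m + 2))"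
      using v by (simp add: t_def std_symplectic_def)
    then have P: "?P (Suc m) (\<rho> \<circ> t) = - ?P (Suc m) \<rho>" unfolding prod.lessThan_Suc Pm by simp
    show ?thesis using nonneg unfolding P sgn by simp
  qed
  show ?case
  proof (cases "?P (Suc m) p = 0")
    case True
    then show ?thesis by (simp only: mult_zero_right order_refl)
  next
    case False
    \<comment> \<open>Locates the pair of positions whose image contains the largest index; this
      pair is to be moved to the end.\<close>
    have "2 * m + 2 \<in> p ` {1..<2 * Suc m + 1}" using permutes_image[OF Suc.prems] by simp
    then obtain j where j: "1 \<le> j" "j < 2 * Suc m + 1" "p j = 2 * m + 2" by auto
    define k where "k = (j - 1) div 2"
    have k: "k < Suc m" using j by (auto simp: k_def)
    have jk: "j = 2 * k + 1 \<or> j = 2 * k + 2" using j(1) by (auto simp: k_def)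
    have "std_symplectic (p (2 * k + 1)) (p (2 * k + 2)) \<noteq> 0" using False k by (metis finite_lessThan lessThan_iff prod_zero_iff)
    moreover have bound: "p l \<le> 2 * m + 2" if "1 \<le> l" "l < 2 * Suc m + 1" for l
      using permutes_in_image[OF Suc.prems, of l] that by auto
    \<comment> \<open>The factor is nonzero only on an odd number and its successor, so the partner
      of \<open>2 * m + 2\<close> must be \<open>2 * m + 1\<close>.\<close>
    ultimately have pair: "{p (2 * k + 1), p (2 * k + 2)} = {2 * m + 1, 2 * m + 2}"
      using jk j(3) bound[of "2 * k + 1"] bound[of "2 * k + 2"] k by (auto simp: std_symplectic_def split: if_splits)
    \<comment> \<open>Exchanges pair \<open>k\<close> with the last pair as a whole. Two
      transpositions make it even; for \<open>k = m\<close> both are the identity and the sign is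
      still 1.\<close>
    define t where "t = Transposition.transpose (2 * k + 1) (2 * m + 1) \<circ> Transposition.transpose (2 * k + 2) (2 * m + 2)"
    have t1: "Transposition.transpose (2 * k + 1) (2 * m + 1) permutes {1..<2 * Suc m + 1}"
      and t2: "Transposition.transpose (2 * k + 2) (2 * m + 2) permutes {1..<2 * Suc m + 1}"
      using k by (auto intro!: permutes_swap_id)
    have t: "t permutes {1..<2 * Suc m + 1}" unfolding t_def by (rule permutes_compose[OF t2 t1])
    have "sign t = 1" unfolding t_def sign_compose[OF perm[OF t1] perm[OF t2]] by (simp add: sign_swap_id)
    then have sgn: "sign (p \<circ> t) = sign p" using sign_compose[OF perm[OF Suc.prems] perm[OF t]] by simp
    have tv: "t (2 * i + 1) = 2 * Transposition.transpose k m i + 1" "t (2 * i + 2) = 2 * Transposition.transpose k m i + 2" for i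
      by (auto simp: t_def Transposition.transpose_def; presburger)+
    have "?P (Suc m) (p \<circ> t) = (\<Prod>i<Suc m. std_symplectic (p (2 * Transposition.transpose k m i + 1)) (p (2 * Transposition.transpose k m i + 2)))"
      by (simp only: o_apply tv)
    also have "\<dots> = ?P (Suc m) p"
    proof (rule prod.reindex_bij_betw[of "Transposition.transpose k m" "{..<Suc m}" "{..<Suc m}" "\<lambda>i. std_symplectic (p (2 * i + 1)) (p (2 * i + 2))"])
      show "bij_betw (Transposition.transpose k m) {..<Suc m} {..<Suc m}"
        using k by (intro permutes_imp_bij permutes_swap_id) auto
    qed
    finally have P: "?P (Suc m) (p \<circ> t) = ?P (Suc m) p" .
    have "0 \<le> of_int (sign (p \<circ> t)) * ?P (Suc m) (p \<circ> t)"
    proof (rule last')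
      show "p \<circ> t permutes {1..<2 * Suc m + 1}" by (rule permutes_compose[OF t Suc.prems])
      show "{(p \<circ> t) (2 * m + 1), (p \<circ> t) (2 * m + 2)} = {2 * m + 1, 2 * m + 2}"
        using pair by (simp only: o_apply tv transpose_apply_second)
    qed
    then show ?thesis unfolding P sgn .
  qed
qed

text \<open>Permutations moving 0 contribute nothing, because the one-form vanishes on every vector
  but the first. All other terms are the same nonzero number times a nonnegative one, and the
  identity contributes the factor 1, so no cancellation can occur.\<close>

lemma contact_sum_nonzero:
  assumes \<eta>0: "\<eta> [vs ! 0] \<noteq> 0" and \<eta>: "\<And>a. 1 \<le> a \<Longrightarrow> a < 2 * m + 1 \<Longrightarrow> \<eta> [vs ! a] = 0"
    and \<beta>: "\<And>a b. 1 \<le> a \<Longrightarrow> a < 2 * m + 1 \<Longrightarrow> 1 \<le> b \<Longrightarrow> b < 2 * m + 1 \<Longrightarrow> \<beta> [vs ! a, vs ! b] = std_symplectic a b"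
  shows "contact_sum \<eta> \<beta> m vs \<noteq> 0"
proof -
  let ?S = "{p. p permutes {..<2 * m + 1}}"
  define g where "g p = (if p 0 = 0 then of_int (sign p) * (\<Prod>i<m. std_symplectic (p (2 * i + 1)) (p (2 * i + 2))) else 0)" for p :: "nat \<Rightarrow> nat"
  have fixed: "p permutes {1..<2 * m + 1}" if "p \<in> ?S" "p 0 = 0" for p
    by (rule permutes_superset[of _ "{..<2 * m + 1}"]) (use that in \<open>auto simp: not_le\<close>)
  have "of_int (sign p) * contact_term \<eta> \<beta> m vs p = \<eta> [vs ! 0] * g p"
    if p: "p \<in> ?S" for p
  proof (cases "p 0 = 0")
    case True
    have "1 \<le> p l \<and> p l < 2 * m + 1" if "1 \<le> l" "l < 2 * m + 1" for l
      using permutes_in_image[OF fixed[OF p True], of l] that by auto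
    then have "(\<Prod>i<m. \<beta> [vs ! p (2 * i + 1), vs ! p (2 * i + 2)]) = (\<Prod>i<m. std_symplectic (p (2 * i + 1)) (p (2 * i + 2)))"
      by (intro prod.cong refl \<beta>) auto
    then show ?thesis using True by (simp add: g_def contact_term_def)
  next
    case False
    have "p 0 < 2 * m + 1" using permutes_in_image[of p "{..<2 * m + 1}" 0] p by simp
    then have "\<eta> [vs ! p 0] = 0" using False by (intro \<eta>) auto
    then show ?thesis using False by (simp add: g_def contact_term_def)
  qed
  then have "contact_sum \<eta> \<beta> m vs = \<eta> [vs ! 0] * sum g ?S"
    by (simp add: contact_sum_def sum_distrib_left)
  moreover have "g id \<le> sum g ?S"
  proof (rule member_le_sum)
    show "id \<in> ?S" by (simp add: permutes_id)
    show "0 \<le> g p" if "p \<in> ?S - {id}" for p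
      using std_symplectic_sign_nonneg fixed that by (auto simp: g_def)
    show "finite ?S" by (simp add: finite_permutations)
  qed
  moreover have "g id = 1" by (simp add: g_def std_symplectic_def)
  ultimately show ?thesis using \<eta>0 by simp
qed

section \<open>Symplectic linear algebra\<close>

definition alternating_on :: "'e::real_vector set \<Rightarrow> ('e \<Rightarrow> 'e \<Rightarrow> real) \<Rightarrow> bool" where
  "alternating_on V B \<longleftrightarrow> (\<forall>a\<in>V. B a a = 0) \<and>
     (\<forall>a\<in>V. \<forall>b\<in>V. \<forall>c\<in>V. \<forall>r. B (r *\<^sub>R a + b) c = r * B a c + B b c \<and> B c (r *\<^sub>R a + b) = r * B c a + B c b)"

definition nondegenerate_on :: "'e::real_vector set \<Rightarrow> ('e \<Rightarrow> 'e \<Rightarrow> real) \<Rightarrow> bool" where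
  "nondegenerate_on V B \<longleftrightarrow> (\<forall>u\<in>V. (\<forall>v\<in>V. B u v = 0) \<longrightarrow> u = 0)"

context
  fixes V :: "'e::euclidean_space set" and B :: "'e \<Rightarrow> 'e \<Rightarrow> real"
  assumes V: "subspace V" and B: "alternating_on V B"
begin

lemma alternating_linear:
  assumes "a \<in> V" "b \<in> V" "c \<in> V"
  shows "B (r *\<^sub>R a + b) c = r * B a c + B b c" "B c (r *\<^sub>R a + b) = r * B c a + B c b"
  using B assms by (auto simp: alternating_on_def)

lemma alternating_self: "a \<in> V \<Longrightarrow> B a a = 0"
  using B by (simp add: alternating_on_def)

lemma alternating_skew:
  assumes "a \<in> V" "b \<in> V"
  shows "B b a = - B a b"
proof -
  have s: "1 *\<^sub>R a + b \<in> V" using V assms by (simp add: subspace_add)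
  have "B (1 *\<^sub>R a + b) (1 *\<^sub>R a + b) = B a b + B b a"
    using alternating_linear(1)[OF assms s, of 1] alternating_linear(2)[OF assms assms(1), of 1]
      alternating_linear(2)[OF assms assms(2), of 1] alternating_self assms by simp
  then show ?thesis using alternating_self[OF s] by simp
qed

lemma alternating_zero:
  assumes "c \<in> V" shows "B 0 c = 0" "B c 0 = 0"
  using alternating_linear[OF subspace_0[OF V] subspace_0[OF V] assms, of 1] by auto

lemma alternating_scale:
  assumes "a \<in> V" "c \<in> V" shows "B (r *\<^sub>R a) c = r * B a c" "B c (r *\<^sub>R a) = r * B c a"
  using alternating_linear[OF assms(1) subspace_0[OF V] assms(2), of r] alternating_zero[OF assms(2)] by auto

text \<open>The form is nondegenerate on the plane spanned by \<open>e\<close> and \<open>f\<close>,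
  so the plane and its orthogonal space \<open>K\<close> together make up \<open>V\<close>. A vector
  of \<open>K\<close> orthogonal to \<open>K\<close> is orthogonal to the plane as well, hence to
  all of \<open>V\<close>.\<close>

lemma hyperbolic_complement:
  assumes nd: "nondegenerate_on V B" and e: "e \<in> V" and f: "f \<in> V" and ef: "B e f \<noteq> 0"
  defines "K \<equiv> {v \<in> V. B e v = 0 \<and> B f v = 0}"
  shows "subspace K" "alternating_on K B" "nondegenerate_on K B" "dim V = dim K + 2"
proof -
  have KV: "K \<subseteq> V" by (auto simp: K_def)
  show K: "subspace K"
    unfolding subspace_def
  proof (intro conjI ballI allI)
    show "0 \<in> K" using subspace_0[OF V] alternating_zero e f by (simp add: K_def)
    show "x + y \<in> K" if "x \<in> K" "y \<in> K" for x y
      using that subspace_add[OF V] alternating_linear(2)[of x y e 1] alternating_linear(2)[of x y f 1] e f by (auto simp: K_def)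
    show "r *\<^sub>R x \<in> K" if "x \<in> K" for r x
      using that subspace_scale[OF V] alternating_scale(2) e f by (auto simp: K_def)
  qed
  show "alternating_on K B" using B KV unfolding alternating_on_def by blast
  have fe: "B f e = - B e f" by (rule alternating_skew[OF e f])
  have decomp: "\<exists>k\<in>K. \<exists>s t. v = s *\<^sub>R e + (t *\<^sub>R f + k)" if v: "v \<in> V" for v
  proof -
    \<comment> \<open>The coefficients solve \<open>B e k = 0\<close> and \<open>B f k = 0\<close>;
      the sign in \<open>s\<close> comes from \<open>B f e = - B e f\<close>.\<close>
    define t where "t = B e v / B e f"
    define s where "s = - B f v / B e f"
    define k where "k = (- s) *\<^sub>R e + ((- t) *\<^sub>R f + v)"
    have tf: "(- t) *\<^sub>R f + v \<in> V" using V f v by (intro subspace_add subspace_scale)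
    have kV: "k \<in> V" unfolding k_def using V e tf by (intro subspace_add[OF _ _ tf] subspace_scale)
    have "B e k = 0" unfolding k_def alternating_linear(2)[OF e tf e] alternating_linear(2)[OF f v e]
      using ef alternating_self[OF e] by (simp add: t_def)
    moreover have "B f k = 0" unfolding k_def alternating_linear(2)[OF e tf f] alternating_linear(2)[OF f v f]
      using ef alternating_self[OF f] by (simp add: s_def fe)
    ultimately have "k \<in> K" using kV by (simp add: K_def)
    then show ?thesis by (intro bexI[of _ k] exI[of _ s] exI[of _ t]) (simp_all add: k_def)
  qed
  show "nondegenerate_on K B"
    unfolding nondegenerate_on_def
  proof (intro ballI impI)
    fix u assume u: "u \<in> K" "\<forall>v\<in>K. B u v = 0"
    have uV: "u \<in> V" and "B e u = 0" "B f u = 0" using u by (auto simp: K_def)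
    then have ue: "B u e = 0" "B u f = 0" using alternating_skew[OF e] alternating_skew[OF f] by auto
    have "B u v = 0" if "v \<in> V" for v
    proof -
      obtain k s t where k: "k \<in> K" "v = s *\<^sub>R e + (t *\<^sub>R f + k)" using decomp[OF \<open>v \<in> V\<close>] by blast
      then have kV: "k \<in> V" "t *\<^sub>R f + k \<in> V" using KV V f by (auto intro!: subspace_add subspace_scale)
      show ?thesis
        unfolding k(2) alternating_linear(2)[OF e kV(2) uV] alternating_linear(2)[OF f kV(1) uV]
        using ue u(2) k(1) by simp
    qed
    then show "u = 0" using nd uV unfolding nondegenerate_on_def by blast
  qed
  show "dim V = dim K + 2"
  proof -
    let ?T = "span {e, f}"
    have e0: "e \<noteq> 0" and f0: "f \<noteq> 0" using ef alternating_zero e f by auto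
    have "e \<notin> span {f}"
    proof
      assume "e \<in> span {f}"
      then obtain r where "e = r *\<^sub>R f" by (auto simp: span_singleton)
      then show False using ef alternating_scale(1)[OF f f] alternating_self[OF f] by simp
    qed
    then have "independent {e, f}" "e \<noteq> f" using f0 by (auto simp: independent_insert span_base)
    then have dT: "dim ?T = 2" by (simp add: dim_eq_card_independent)
    have T: "\<exists>s t. x = s *\<^sub>R e + t *\<^sub>R f" if xT: "x \<in> ?T" for x
    proof -
      obtain s where "x - s *\<^sub>R e \<in> span {f}" using iffD1[OF span_breakdown_eq xT] by blast
      then obtain t where "x - s *\<^sub>R e = t *\<^sub>R f" by (auto simp: span_singleton)
      then show ?thesis by (metis add_diff_cancel_left' diff_add_cancel add.commute)
    qed
    have "K \<inter> ?T = {0}"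
    proof -
      have "x = 0" if x: "x \<in> K" "x \<in> ?T" for x
      proof -
        obtain s t where st: "x = s *\<^sub>R e + t *\<^sub>R f" using T[OF x(2)] by blast
        have tf: "t *\<^sub>R f \<in> V" using V f by (simp add: subspace_scale)
        have "B e x = t * B e f" "B f x = s * B f e"
          unfolding st alternating_linear(2)[OF e tf e] alternating_linear(2)[OF e tf f]
          using alternating_self e f alternating_scale(2)[OF f] by auto
        then show ?thesis using x(1) ef fe st by (simp add: K_def)
      qed
      then show ?thesis using subspace_0[OF K] span_zero by auto
    qed
    moreover have "{x + y |x y. x \<in> K \<and> y \<in> ?T} = V"
    proof
      have "?T \<subseteq> V" using e f V by (simp add: span_minimal)
      then show "{x + y |x y. x \<in> K \<and> y \<in> ?T} \<subseteq> V" using KV V by (auto intro!: subspace_add)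
      show "V \<subseteq> {x + y |x y. x \<in> K \<and> y \<in> ?T}"
      proof
        fix v assume "v \<in> V"
        then obtain k s t where k: "k \<in> K" "v = s *\<^sub>R e + (t *\<^sub>R f + k)" using decomp by blast
        have "s *\<^sub>R e + t *\<^sub>R f \<in> ?T" by (intro span_add span_scale span_base) auto
        moreover have "v = k + (s *\<^sub>R e + t *\<^sub>R f)" using k(2) by simp
        ultimately show "v \<in> {x + y |x y. x \<in> K \<and> y \<in> ?T}" using k(1) by blast
      qed
    qed
    ultimately show ?thesis using dim_sums_Int[OF K subspace_span[of "{e, f}"]] dT by simp
  qed
qed

end

text \<open>Hyperbolic planes are split off until nothing is left, which also shows that the
  dimension is even. The shift by \<open>Suc\<close> aligns list positions with the pairs of
  \<open>std_symplectic\<close>, which start at 1.\<close>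

lemma symplectic_basis:
  fixes V :: "'e::euclidean_space set"
  assumes "subspace V" "alternating_on V B" "nondegenerate_on V B"
  shows "\<exists>m es. dim V = 2 * m \<and> length es = 2 * m \<and> set es \<subseteq> V \<and>
    (\<forall>a<2 * m. \<forall>b<2 * m. B (es ! a) (es ! b) = std_symplectic (Suc a) (Suc b))"
  using assms
proof (induction "dim V" arbitrary: V rule: less_induct)
  case less
  note V = less.prems(1) and B = less.prems(2) and nd = less.prems(3)
  show ?case
  proof (cases "\<exists>e\<in>V. \<exists>f\<in>V. B e f \<noteq> 0")
    case False
    then have "V \<subseteq> {0}" using nd unfolding nondegenerate_on_def by blast
    then have "dim V = 0" by (simp add: dim_eq_0)
    then show ?thesis by (intro exI[of _ 0] exI[of _ "[]"]) simp
  next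
    case True
    then obtain e f0 where e: "e \<in> V" and f0: "f0 \<in> V" "B e f0 \<noteq> 0" by blast
    define f where "f = (1 / B e f0) *\<^sub>R f0"
    have f: "f \<in> V" "B e f = 1"
      using f0 V alternating_scale(2)[OF V B f0(1) e] by (auto simp: f_def subspace_scale)
    define K where "K = {v \<in> V. B e v = 0 \<and> B f v = 0}"
    have K: "subspace K" "alternating_on K B" "nondegenerate_on K B" "dim V = dim K + 2"
      unfolding K_def using hyperbolic_complement[OF V B nd e f(1)] f(2) by auto
    obtain m es where es: "dim K = 2 * m" "length es = 2 * m" "set es \<subseteq> K"
      "\<And>a b. a < 2 * m \<Longrightarrow> b < 2 * m \<Longrightarrow> B (es ! a) (es ! b) = std_symplectic (Suc a) (Suc b)"
      using less.hyps[OF _ K(1-3)] K(4) by auto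
    have esK: "es ! a \<in> V" "B e (es ! a) = 0" "B f (es ! a) = 0" if "a < 2 * m" for a
    proof -
      have "es ! a \<in> K" using es(2,3) that nth_mem[of a es] by auto
      then show "es ! a \<in> V" "B e (es ! a) = 0" "B f (es ! a) = 0" by (auto simp: K_def)
    qed
    have esK': "B (es ! a) e = 0" "B (es ! a) f = 0" if "a < 2 * m" for a
      using alternating_skew[OF V B e esK(1)[OF that]] alternating_skew[OF V B f(1) esK(1)[OF that]] esK[OF that] by auto
    have ef: "B e e = 0" "B f f = 0" "B f e = - 1"
      using alternating_self[OF V B] alternating_skew[OF V B e f(1)] e f by auto
    \<comment> \<open>Appending the new pair at the end leaves the earlier positions, and thus their
      pairing, untouched.\<close>
    have "B ((es @ [e, f]) ! a) ((es @ [e, f]) ! b) = std_symplectic (Suc a) (Suc b)" if ab: "a < 2 * Suc m" "b < 2 * Suc m" for a b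
    proof -
      have "a < 2 * m \<or> a = 2 * m \<or> a = Suc (2 * m)" "b < 2 * m \<or> b = 2 * m \<or> b = Suc (2 * m)" using ab by auto
      moreover have "2 * m \<noteq> Suc c" if "even c" for c using that by presburger
      ultimately show ?thesis
        using es(2,4) esK esK' ef f(2) by (elim disjE) (auto simp: nth_append std_symplectic_def)
    qed
    then show ?thesis
      using es K(4) e f(1) by (intro exI[of _ "Suc m"] exI[of _ "es @ [e, f]"]) (auto simp: K_def)
  qed
qed

text \<open>A coordinate model of one tangent space: \<open>B\<close> is \<omega>, \<open>x\<close>
  the Liouville vector and the hyperplane orthogonal to \<open>e\<close> the tangent space of the
  level set. Contraction of \<open>B\<close> with \<open>x\<close> plays the part of the contact
  form, and \<open>- B\<close> that of its differential.\<close>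

lemma contact_basis:
  fixes V :: "'e::euclidean_space set"
  assumes V: "subspace V" and B: "alternating_on V B" and nd: "nondegenerate_on V B"
    and e: "e \<in> V" "e \<bullet> e = 1" and x: "x \<in> V" "x \<bullet> e \<noteq> 0"
  shows "\<exists>m vs. dim V = 2 * m + 2 \<and> length vs = 2 * m + 1 \<and> set vs \<subseteq> {v \<in> V. v \<bullet> e = 0} \<and>
    B x (vs ! 0) \<noteq> 0 \<and> (\<forall>a. 1 \<le> a \<and> a < 2 * m + 1 \<longrightarrow> B x (vs ! a) = 0) \<and>
    (\<forall>a b. 1 \<le> a \<and> a < 2 * m + 1 \<and> 1 \<le> b \<and> b < 2 * m + 1 \<longrightarrow> - B (vs ! a) (vs ! b) = std_symplectic a b)"
proof -
  define F where "F = {v \<in> V. v \<bullet> e = 0}"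
  have FV: "F \<subseteq> V" by (auto simp: F_def)
  have F: "subspace F" using V by (auto simp: F_def subspace_def inner_add_left)
  have BF: "alternating_on F B" using B FV unfolding alternating_on_def by blast
  have "e \<noteq> 0" using e by auto
  then have dF: "dim F + 1 = dim V" unfolding F_def using V e(1)
    by (intro dim_orthogonal_in_subspace)
  \<comment> \<open>As \<open>V\<close> has even dimension, the hyperplane has odd dimension, and
    there an alternating form must have a kernel vector \<open>R\<close>.\<close>
  obtain m0 where "dim V = 2 * m0" using symplectic_basis[OF V B nd] by blast
  then have "odd (dim F)" using dF by presburger
  then have "\<not> nondegenerate_on F B" using symplectic_basis[OF F BF] by fastforce
  then obtain R where R: "R \<in> F" "R \<noteq> 0" "\<And>v. v \<in> F \<Longrightarrow> B R v = 0" unfolding nondegenerate_on_def by blast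
  have RV: "R \<in> V" using R FV by blast
  have decomp: "\<exists>s. \<exists>u\<in>F. v = s *\<^sub>R x + u" if "v \<in> V" for v
  proof -
    define s where "s = (v \<bullet> e) / (x \<bullet> e)"
    have "v - s *\<^sub>R x \<in> F" using that x V by (simp add: F_def s_def subspace_diff subspace_scale inner_diff_left)
    then show ?thesis by (intro exI[of _ s] bexI[of _ "v - s *\<^sub>R x"]) auto
  qed
  have BRv: "B R (s *\<^sub>R x + u) = s * B R x" if "u \<in> F" for s u
    using alternating_linear(2)[OF V B x(1) _ RV, of u s] R(3)[OF that] that FV by auto
  have "B R x \<noteq> 0"
  proof
    assume "B R x = 0"
    then have "B R v = 0" if "v \<in> V" for v using decomp[OF that] BRv by auto
    then show False using nd R(2) RV unfolding nondegenerate_on_def by blast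
  qed
  then have xR: "B x R \<noteq> 0" using alternating_skew[OF V B RV x(1)] by simp
  define K where "K = {v \<in> V. B x v = 0 \<and> B R v = 0}"
  have K: "subspace K" "alternating_on K B" "nondegenerate_on K B" "dim V = dim K + 2"
    unfolding K_def by (rule hyperbolic_complement[OF V B nd x(1) RV xR])+
  \<comment> \<open>Since \<open>R\<close> annihilates \<open>F\<close>, pairing with
    \<open>R\<close> detects the \<open>x\<close>-component of a vector; it vanishes for vectors of
    \<open>K\<close>.\<close>
  have KF: "K \<subseteq> F"
  proof
    fix v assume v: "v \<in> K"
    then have "v \<in> V" by (simp add: K_def)
    from decomp[OF this] obtain s u where "u \<in> F" "v = s *\<^sub>R x + u" by blast
    then show "v \<in> F" using v BRv[of u s] \<open>B R x \<noteq> 0\<close> by (simp add: K_def)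
  qed
  \<comment> \<open>The sign is that of \<omega> = -d\<theta>: the differential of the contact form
    is represented by \<open>- B\<close>, so the standard basis is taken for this form.\<close>
  have "alternating_on K (\<lambda>a b. - B a b)" "nondegenerate_on K (\<lambda>a b. - B a b)"
    using K(2,3) by (auto simp: alternating_on_def nondegenerate_on_def)
  from symplectic_basis[OF K(1) this] obtain m es where es: "dim K = 2 * m" "length es = 2 * m" "set es \<subseteq> K"
    "\<And>a b. a < 2 * m \<Longrightarrow> b < 2 * m \<Longrightarrow> - B (es ! a) (es ! b) = std_symplectic (Suc a) (Suc b)"
    by blast
  have "B x ((R # es) ! a) = 0" if "1 \<le> a" "a < 2 * m + 1" for a
  proof -
    have "es ! (a - 1) \<in> K" using that es(2,3) nth_mem[of "a - 1" es] by auto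
    then show ?thesis using that by (simp add: nth_Cons' K_def)
  qed
  moreover have "- B ((R # es) ! a) ((R # es) ! b) = std_symplectic a b" if "1 \<le> a" "a < 2 * m + 1" "1 \<le> b" "b < 2 * m + 1" for a b
    using es(4)[of "a - 1" "b - 1"] that by (simp add: nth_Cons')
  ultimately show ?thesis
    using K(4) es KF R(1) xR by (intro exI[of _ m] exI[of _ "R # es"]) (auto simp: F_def)
qed

section \<open>Energy hypersurfaces\<close>

lemma smooth_fun_on_const: "smooth_fun_on M W (\<lambda>q. k)"
  by (simp add: smooth_fun_on_def o_def smooth_on_const)

lemma smooth_fun_on_mult:
  assumes "smooth_fun_on M W f" "smooth_fun_on M W g"
  shows "smooth_fun_on M W (\<lambda>q. f q * g q)"
  using assms by (auto simp: smooth_fun_on_def o_def intro!: smooth_on_mult)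

lemma smooth_fun_on_sum:
  assumes "\<And>i. i \<in> I \<Longrightarrow> smooth_fun_on M W (f i)"
  shows "smooth_fun_on M W (\<lambda>q. \<Sum>i\<in>I. f i q)"
  unfolding smooth_fun_on_def
proof clarify
  fix U \<phi> E assume "(U, \<phi>, E) \<in> charts M"
  then have "smooth_on (\<phi> ` (U \<inter> W)) (\<lambda>x. f i (inv_into U \<phi> x))" if "i \<in> I" for i
    using assms[OF that] by (auto simp: smooth_fun_on_def o_def)
  then show "smooth_on (\<phi> ` (U \<inter> W)) ((\<lambda>q. \<Sum>i\<in>I. f i q) \<circ> inv_into U \<phi>)"
    unfolding o_def by (rule smooth_on_sum)
qed

lemma smooth_fun_on_prod:
  assumes "\<And>i. i \<in> I \<Longrightarrow> smooth_fun_on M W (f i)"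
  shows "smooth_fun_on M W (\<lambda>q. \<Prod>i\<in>I. f i q)"
  unfolding smooth_fun_on_def
proof clarify
  fix U \<phi> E assume "(U, \<phi>, E) \<in> charts M"
  then have "smooth_on (\<phi> ` (U \<inter> W)) (\<lambda>x. f i (inv_into U \<phi> x))" if "i \<in> I" for i
    using assms[OF that] by (auto simp: smooth_fun_on_def o_def)
  then show "smooth_on (\<phi> ` (U \<inter> W)) ((\<lambda>q. \<Prod>i\<in>I. f i q) \<circ> inv_into U \<phi>)"
    unfolding o_def by (rule smooth_on_prod)
qed

section \<open>Level sets with a nowhere vanishing derivative\<close>

context smooth_mfd
begin

lemma tangent_space_add_scale:
  assumes p: "p \<in> points M" and u: "u \<in> tangent_space M p" and w: "w \<in> tangent_space M p"
  shows "tadd (tscale r u) w \<in> tangent_space M p"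
proof -
  obtain U \<phi> E where c0: "(U, \<phi>, E) \<in> charts M" "p \<in> U" using chart_cover[OF p] by blast
  note c = charts_maximal[OF c0(1)]
  obtain a where a: "a \<in> E" "u = coord_field M (U, \<phi>, E) a p" using tangent_coord[OF u c c0(2)] by blast
  obtain b where b: "b \<in> E" "w = coord_field M (U, \<phi>, E) b p" using tangent_coord[OF w c c0(2)] by blast
  have "r *\<^sub>R a + b \<in> E" using maximalD(2)[OF c] a b by (simp add: subspace_add subspace_scale)
  then show ?thesis
    using coord_field_tangent[OF c c0(2)] unfolding a(2) b(2) coord_field_add_scale[OF c c0(2) a(1) b(1), symmetric] by blast
qed

lemma regular_valueI:
  assumes h: "smooth_fun_on M (points M) h"
    and v: "\<And>q. q \<in> level_set M h k \<Longrightarrow> X q \<in> tangent_space M q" "\<And>q. q \<in> level_set M h k \<Longrightarrow> X q h \<noteq> 0"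
  shows "regular_value M h k"
  unfolding regular_value_def
proof (intro ballI equalityI subset_UNIV subsetI)
  fix q and y :: real assume q: "q \<in> level_set M h k"
  then have qM: "q \<in> points M" by (simp add: level_set_def)
  obtain U \<phi> E e where c: "(U, \<phi>, E) \<in> atlas" "q \<in> U" and e: "\<And>p. p \<in> U \<Longrightarrow> \<phi> p \<bullet> e = h p - k"
    by (rule level_set_adapted_chart[OF h qM v[OF q], where k = k]) blast
  obtain a where a: "a \<in> E" "X q = coord_field M (U, \<phi>, E) a q" by (rule tangent_coord[OF v(1)[OF q] c])
  have ae: "a \<bullet> e \<noteq> 0" using v(2)[OF q] adapted_chart_derivative[OF h c a(1) e] a(2) by simp
  define b where "b = (y / (a \<bullet> e)) *\<^sub>R a"
  have b: "b \<in> E" using a maximalD(2)[OF c(1)] by (simp add: b_def subspace_scale)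
  have "y = coord_field M (U, \<phi>, E) b q h"
    using adapted_chart_derivative[OF h c b e] ae by (simp add: b_def)
  then show "y \<in> (\<lambda>v. v h) ` tangent_space M q"
    using coord_field_tangent[OF c b] by blast
qed

text \<open>Adapted charts are slice charts of codimension one. The dimension is tied to
  \<open>n\<close> only for a nonempty level set, since the empty one counts as a manifold of every
  dimension; this lets the empty case be given an odd dimension later.\<close>

lemma level_set_submfd:
  assumes h: "smooth_fun_on M (points M) h"
    and v: "\<And>q. q \<in> level_set M h k \<Longrightarrow> X q \<in> tangent_space M q" "\<And>q. q \<in> level_set M h k \<Longrightarrow> X q h \<noteq> 0"
    and m: "level_set M h k \<noteq> {} \<Longrightarrow> n = Suc m"
  shows "manifold_of_dim m (submfd M (level_set M h k))"
proof (rule submfd_manifold[OF closedin_level_set[OF h]])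
  fix q assume q: "q \<in> level_set M h k"
  then have qM: "q \<in> points M" by (simp add: level_set_def)
  obtain U \<phi> E e where c: "(U, \<phi>, E) \<in> atlas" "q \<in> U" "dim E = n" and e: "e \<in> E" "e \<bullet> e = 1"
    and he: "\<And>p. p \<in> U \<Longrightarrow> \<phi> p \<bullet> e = h p - k"
    by (rule level_set_adapted_chart[OF h qM v[OF q], where k = k]) blast
  have "e \<noteq> 0" using e(2) by auto
  then have "dim {v \<in> E. v \<bullet> e = 0} + 1 = dim E"
    by (rule dim_orthogonal_in_subspace[OF maximalD(2)[OF c(1)] e(1)])
  then have "dim {v \<in> E. v \<bullet> e = 0} = m" using c(3) m q by auto
  then show "\<exists>(U, \<phi>, F)\<in>charts (submfd M (level_set M h k)). q \<in> U \<and> dim F = m"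
    using level_set_slice[OF c(1) e(1) he] q c(2) by blast
qed

end

section \<open>Smoothness and multilinearity of the contact volume\<close>

context smooth_submfd
begin

lemma tmap_coordE:
  assumes "p \<in> points N"
  obtains U \<phi> E F where "(U \<inter> S, \<phi>, F) \<in> charts N" "(U, \<phi>, E) \<in> atlas" "F \<subseteq> E" "p \<in> U \<inter> S"
proof -
  obtain V \<phi> F where s: "(V, \<phi>, F) \<in> charts N" "p \<in> V" using sub.chart_cover[OF assms] by blast
  then obtain U E where "V = U \<inter> S" "(U, \<phi>, E) \<in> atlas" "F \<subseteq> E" using slice_chartD by metis
  with s that show ?thesis by blast
qed

lemma ext_d_pullback_tangent:
  assumes \<theta>: "differential_form M 1 \<theta>" and p: "p \<in> points N"
    and u: "u \<in> tangent_space N p" and w: "w \<in> tangent_space N p"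
  shows "ext_d N (pullback M id \<theta>) p [u, w] = ext_d M \<theta> p [tmap M id p u, tmap M id p w]"
proof -
  obtain U \<phi> E F where c: "(U \<inter> S, \<phi>, F) \<in> charts N" "(U, \<phi>, E) \<in> atlas" "F \<subseteq> E" "p \<in> U \<inter> S"
    by (rule tmap_coordE[OF p])
  note cm = sub.charts_maximal[OF c(1)]
  obtain a where a: "a \<in> F" "u = coord_field N (U \<inter> S, \<phi>, F) a p" by (rule sub.tangent_coord[OF u cm c(4)])
  obtain b where b: "b \<in> F" "w = coord_field N (U \<inter> S, \<phi>, F) b p" by (rule sub.tangent_coord[OF w cm c(4)])
  show ?thesis
    unfolding a(2) b(2) ext_d_pullback[OF \<theta> c a(1) b(1)] tmap_inclusion_coord_field[OF c a(1)] tmap_inclusion_coord_field[OF c b(1)] ..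
qed

text \<open>The two-form properties of the restricted differential are inherited from
  \<open>neg_d M \<theta>\<close> on the ambient manifold, because \<open>ext_d\<close> commutes
  with restriction. The permutation sum then reduces the claim to slots and coefficients.\<close>

lemma contact_form_differential_form:
  assumes \<theta>: "differential_form M 1 \<theta>" and \<omega>: "differential_form M 2 (neg_d M \<theta>)"
  defines "\<eta> \<equiv> pullback M id \<theta>"
  shows "differential_form N (2 * l + 1) (\<lambda>p. wedge 1 (2 * l) (\<eta> p) (wedge_power 2 (ext_d N \<eta> p) l))"
  unfolding differential_form_def wedge_wedge_power_eq
proof (intro conjI ballI allI impI)
  let ?\<beta> = "ext_d N \<eta>"
  note \<eta>form = pullback_one_form[OF \<theta>, folded \<eta>_def]
  fix p vs assume p: "p \<in> points N" and vs: "length vs = 2 * l + 1 \<and> set vs \<subseteq> tangent_space N p"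
  have pM: "p \<in> points M" using p by simp
  {
    fix i r u w
    assume i: "i < 2 * l + 1" and u: "u \<in> tangent_space N p" and w: "w \<in> tangent_space N p"
    let ?x = "tadd (tscale r u) w"
    have x: "?x \<in> tangent_space N p" by (rule sub.tangent_space_add_scale[OF p u w])
    have \<eta>x: "\<eta> p [?x] = r * \<eta> p [u] + \<eta> p [w]" by (rule differential_form_1_linear[OF \<eta>form p u w])
    have \<beta>x: "?\<beta> p [?x, z] = r * ?\<beta> p [u, z] + ?\<beta> p [w, z]" "?\<beta> p [z, ?x] = r * ?\<beta> p [z, u] + ?\<beta> p [z, w]"
      if z: "z \<in> tangent_space N p" for z
      using differential_form_2_linear(1,2)[OF \<omega> pM tmap_inclusion_tangent[OF p u] tmap_inclusion_tangent[OF p w] tmap_inclusion_tangent[OF p z], of r]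
      unfolding \<eta>_def ext_d_pullback_tangent[OF \<theta> p x z] ext_d_pullback_tangent[OF \<theta> p u z] ext_d_pullback_tangent[OF \<theta> p w z]
        ext_d_pullback_tangent[OF \<theta> p z x] ext_d_pullback_tangent[OF \<theta> p z u] ext_d_pullback_tangent[OF \<theta> p z w] tmap_inclusion_linear
      by (simp_all add: neg_d_def)
    show "contact_sum (\<eta> p) (?\<beta> p) l (vs[i := ?x]) / 2 ^ l =
        r * (contact_sum (\<eta> p) (?\<beta> p) l (vs[i := u]) / 2 ^ l) + contact_sum (\<eta> p) (?\<beta> p) l (vs[i := w]) / 2 ^ l"
      using contact_sum_linear[where \<eta> = "\<eta> p" and \<beta> = "?\<beta> p", OF conjunct1[OF vs] conjunct2[OF vs] i \<eta>x \<beta>x]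
      by (simp add: add_divide_distrib)
  next
    fix i j assume "i < 2 * l + 1" "j < 2 * l + 1" "i \<noteq> j \<and> vs ! i = vs ! j"
    then show "contact_sum (\<eta> p) (?\<beta> p) l vs / 2 ^ l = 0" by (simp add: contact_sum_alternating)
  }
next
  let ?\<beta> = "ext_d N \<eta>"
  fix c assume "c \<in> charts N"
  then obtain V \<phi> F where s: "c = (V, \<phi>, F)" "(V, \<phi>, F) \<in> charts N" by (cases c) auto
  obtain U E where c: "V = U \<inter> S" "(U, \<phi>, E) \<in> atlas" "F \<subseteq> E" using slice_chartD[OF s(2)] by metis
  let ?cf = "\<lambda>a. coord_field N (V, \<phi>, F) a"
  have \<eta>s: "smooth_fun_on N V (\<lambda>q. \<eta> q [?cf a q])" if "a \<in> F" for a
    unfolding \<eta>_def by (rule sub.one_form_smooth[OF pullback_one_form[OF \<theta>] sub.charts_maximal[OF s(2)] that])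
  have \<beta>s: "smooth_fun_on N V (\<lambda>q. ?\<beta> q [?cf a q, ?cf b q])" if ab: "a \<in> F" "b \<in> F" for a b
  proof -
    have "smooth_fun_on N V (\<lambda>q. neg_d M \<theta> q [coord_field M (U, \<phi>, E) a q, coord_field M (U, \<phi>, E) b q])"
      unfolding c(1) using ab c(3) by (intro smooth_fun_on_restrict two_form_smooth[OF \<omega> c(2)]) auto
    from smooth_fun_on_mult[OF smooth_fun_on_const[of _ _ "- 1"] this]
    show ?thesis
    proof (rule smooth_fun_on_cong)
      fix q assume "q \<in> V"
      then show "?\<beta> q [?cf a q, ?cf b q] = - 1 * neg_d M \<theta> q [coord_field M (U, \<phi>, E) a q, coord_field M (U, \<phi>, E) b q]"
        using ext_d_pullback[OF \<theta> s(2)[unfolded c(1)] c(2,3) _ ab] unfolding c(1) \<eta>_def neg_d_def by simp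
    qed
  qed
  have "smooth_fun_on N V (\<lambda>q. contact_sum (\<eta> q) (?\<beta> q) l (map (\<lambda>a. ?cf a q) as) / 2 ^ l)"
    if as: "length as = 2 * l + 1" "set as \<subseteq> F" for as
  proof -
    have \<sigma>: "\<sigma> k < length as \<and> as ! \<sigma> k \<in> F" if "\<sigma> permutes {..<2 * l + 1}" "k < 2 * l + 1" for \<sigma> k
    proof -
      have "\<sigma> k < length as" using permutes_in_image[OF that(1), of k] that(2) as(1) by simp
      then show ?thesis using as(2) nth_mem by blast
    qed
    have "smooth_fun_on N V (\<lambda>q. \<Sum>\<sigma> | \<sigma> permutes {..<2 * l + 1}. of_int (sign \<sigma>) * (\<eta> q [?cf (as ! \<sigma> 0) q] *
      (\<Prod>k<l. ?\<beta> q [?cf (as ! \<sigma> (2 * k + 1)) q, ?cf (as ! \<sigma> (2 * k + 2)) q])))"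
      using \<sigma> by (intro smooth_fun_on_sum smooth_fun_on_mult smooth_fun_on_const smooth_fun_on_prod \<eta>s \<beta>s) auto
    then have "smooth_fun_on N V (\<lambda>q. contact_sum (\<eta> q) (?\<beta> q) l (map (\<lambda>a. ?cf a q) as))"
    proof (rule smooth_fun_on_cong)
      fix q
      show "contact_sum (\<eta> q) (?\<beta> q) l (map (\<lambda>a. ?cf a q) as) = (\<Sum>\<sigma> | \<sigma> permutes {..<2 * l + 1}. of_int (sign \<sigma>) *
          (\<eta> q [?cf (as ! \<sigma> 0) q] * (\<Prod>k<l. ?\<beta> q [?cf (as ! \<sigma> (2 * k + 1)) q, ?cf (as ! \<sigma> (2 * k + 2)) q])))"
        unfolding contact_sum_def contact_term_def
        using \<sigma> by (intro sum.cong prod.cong arg_cong2[where f = "(*)"] refl) auto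
    qed
    from smooth_fun_on_mult[OF this smooth_fun_on_const[of _ _ "1 / 2 ^ l"]] show ?thesis by simp
  qed
  then show "case c of (U, \<phi>, E) \<Rightarrow> \<forall>as. length as = 2 * l + 1 \<and> set as \<subseteq> E \<longrightarrow> smooth_fun_on N U
      (\<lambda>q. contact_sum (\<eta> q) (?\<beta> q) l (map (\<lambda>a. coord_field N (U, \<phi>, E) a q) as) / 2 ^ l)"
    by (simp add: s(1))
qed

end

text \<open>A curve representing \<open>w\<close> runs inside \<open>S\<close>, so \<open>w\<close>
  cannot distinguish functions that agree on \<open>S\<close>. This is needed because
  \<open>tmap\<close> with \<open>id\<close> evaluates \<open>w\<close> on functions of the ambient
  manifold.\<close>

lemma tangent_space_submfd_cong:
  assumes w: "w \<in> tangent_space (submfd M S) p" and fg: "\<And>q. q \<in> S \<Longrightarrow> f q = g q"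
  shows "w f = w g"
proof -
  obtain \<gamma> \<epsilon> where \<gamma>: "w = velocity (submfd M S) \<gamma>" "\<gamma> 0 = p" "\<epsilon> > 0" "smooth_map (euclid_mfd {-\<epsilon><..<\<epsilon>}) (submfd M S) \<gamma>"
    using w by (auto simp: tangent_space_def)
  \<comment> \<open>Velocities are 0 on functions that are not smooth near the point, so both
    functions must fall into the same case; hence the use in both directions below.\<close>
  have near: "smooth_near (submfd M S) (\<gamma> 0) g'" if f': "smooth_near (submfd M S) (\<gamma> 0) f'" and eq: "\<And>q. q \<in> S \<Longrightarrow> f' q = g' q" for f' g'
  proof -
    obtain W where W: "openin (mtop (submfd M S)) W" "\<gamma> 0 \<in> W" "smooth_fun_on (submfd M S) W f'"
      using f' by (auto simp: smooth_near_def)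
    have "smooth_fun_on (submfd M S) W g'"
      unfolding smooth_fun_on_def
    proof clarify
      fix V \<phi> F assume s: "(V, \<phi>, F) \<in> charts (submfd M S)"
      then have "smooth_on (\<phi> ` (V \<inter> W)) (f' \<circ> inv_into V \<phi>)" using W(3) by (auto simp: smooth_fun_on_def)
      then show "smooth_on (\<phi> ` (V \<inter> W)) (g' \<circ> inv_into V \<phi>)"
      proof (rule smooth_on_cong)
        fix x assume "x \<in> \<phi> ` (V \<inter> W)"
        then have "inv_into V \<phi> x \<in> V" by (intro inv_into_into) blast
        then have "inv_into V \<phi> x \<in> S" using s by (auto simp: in_charts_submfd_iff)
        then show "(g' \<circ> inv_into V \<phi>) x = (f' \<circ> inv_into V \<phi>) x" using eq by simp
      qed
    qed
    then show ?thesis using W unfolding smooth_near_def by blast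
  qed
  have "\<gamma> t \<in> S" if "t \<in> {-\<epsilon><..<\<epsilon>}" for t
  proof -
    have "continuous_map (top_of_set {-\<epsilon><..<\<epsilon>}) (subtopology (mtop M) S) \<gamma>"
      using \<gamma>(4) by (simp add: smooth_map_curve_iff)
    then show ?thesis using that by (auto simp: continuous_map_in_subtopology)
  qed
  then have "\<forall>\<^sub>F t in nhds 0. f (\<gamma> t) = g (\<gamma> t)"
    using \<gamma>(3) fg unfolding eventually_nhds by (intro exI[of _ "{-\<epsilon><..<\<epsilon>}"]) auto
  then have "deriv (\<lambda>t. f (\<gamma> t)) 0 = deriv (\<lambda>t. g (\<gamma> t)) 0" by (rule deriv_cong_ev) simp
  then show ?thesis using near[of f g] near[of g f] fg unfolding \<gamma>(1) velocity_def by auto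
qed

lemma tangent_space_constant: "w \<in> tangent_space M p \<Longrightarrow> w (\<lambda>q. k) = 0"
  by (auto simp: tangent_space_def velocity_def)

lemma smooth_near_points:
  assumes "smooth_fun_on M (points M) h" "p \<in> points M"
  shows "smooth_near M p h"
  using assms unfolding smooth_near_def by (intro exI[of _ "points M"]) simp

lemma energy_hypersurfaceI:
  fixes M :: "('a, 'e::euclidean_space) mfd"
  assumes sys: "exact_symplectic_Hamiltonian_system M \<theta> X h"
    and nz: "\<And>q. q \<in> level_set M h k \<Longrightarrow> X q h \<noteq> 0"
  shows "energy_hypersurface M \<theta> X h (level_set M h k) (pullback M id \<theta>)"
proof -
  define S where "S = level_set M h k"
  let ?N = "submfd M S"
  have "smooth_manifold M" and \<theta>: "differential_form M 1 \<theta>" and "symplectic_form M (neg_d M \<theta>)"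
    and L: "Liouville_field M \<theta> X" and h: "smooth_fun_on M (points M) h"
    using sys by (auto simp: exact_symplectic_Hamiltonian_system_def exact_symplectic_manifold_def)
  then obtain n where "manifold_of_dim n M" by (auto simp: smooth_manifold_def)
  then interpret smooth_mfd M n by unfold_locales
  have \<omega>: "differential_form M 2 (neg_d M \<theta>)"
    and nondeg: "\<And>p u. p \<in> points M \<Longrightarrow> u \<in> tangent_space M p \<Longrightarrow> (\<And>v. v \<in> tangent_space M p \<Longrightarrow> neg_d M \<theta> p [u, v] = 0) \<Longrightarrow> u = tzero"
    using \<open>symplectic_form M (neg_d M \<theta>)\<close> by (auto simp: symplectic_form_def)
  have X: "\<And>p. p \<in> points M \<Longrightarrow> X p \<in> tangent_space M p"
    and \<omega>X: "\<And>p v. p \<in> points M \<Longrightarrow> v \<in> tangent_space M p \<Longrightarrow> neg_d M \<theta> p [X p, v] = \<theta> p [v]"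
    using L by (auto simp: Liouville_field_def vector_field_def form_eq_def)
  have SM: "p \<in> points M" if "p \<in> S" for p using that by (simp add: S_def level_set_def)
  have XS: "X q \<in> tangent_space M q" "X q h \<noteq> 0" if "q \<in> level_set M h k" for q
    using that X nz by (auto simp: level_set_def)
  have reg: "regular_value M h k" by (rule regular_valueI[OF h XS])
  have adapted: "\<exists>U \<phi> E e x. (U, \<phi>, E) \<in> maximal_atlas M \<and> q \<in> U \<and> dim E = n \<and> e \<in> E \<and> e \<bullet> e = 1 \<and>
      (\<forall>p\<in>U. \<phi> p \<bullet> e = h p - k) \<and> (U \<inter> S, \<phi>, {v \<in> E. v \<bullet> e = 0}) \<in> charts ?N \<and>
      x \<in> E \<and> X q = coord_field M (U, \<phi>, E) x q \<and> x \<bullet> e \<noteq> 0" if q: "q \<in> S" for q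
  proof -
    have qS: "q \<in> level_set M h k" using q by (simp add: S_def)
    obtain U \<phi> E e where c: "(U, \<phi>, E) \<in> maximal_atlas M" "q \<in> U" "dim E = n" and e: "e \<in> E" "e \<bullet> e = 1"
      and he: "\<And>p. p \<in> U \<Longrightarrow> \<phi> p \<bullet> e = h p - k"
      by (rule level_set_adapted_chart[OF h SM[OF q] XS[OF qS], where k = k]) blast
    obtain x where x: "x \<in> E" "X q = coord_field M (U, \<phi>, E) x q" by (rule tangent_coord[OF XS(1)[OF qS] c(1,2)])
    have "x \<bullet> e \<noteq> 0" using XS(2)[OF qS] adapted_chart_derivative[OF h c(1,2) x(1) he] x(2) by simp
    then show ?thesis using c e he x level_set_slice[OF c(1) e(1) he] unfolding S_def by blast
  qed
  define \<eta> where "\<eta> = pullback M id \<theta>"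
  \<comment> \<open>The dimension \<open>m'\<close> of the level set is left open: this is used
    first with \<open>n - 1\<close>, to learn the parity of \<open>n\<close>, and again once the
    dimension is in the form \<open>2 * m + 1\<close>.\<close>
  have basis: "\<exists>m vs. n = 2 * m + 2 \<and> length vs = 2 * m + 1 \<and> set vs \<subseteq> tangent_space ?N q \<and>
      \<eta> q [vs ! 0] \<noteq> 0 \<and> (\<forall>a. 1 \<le> a \<and> a < 2 * m + 1 \<longrightarrow> \<eta> q [vs ! a] = 0) \<and>
      (\<forall>a b. 1 \<le> a \<and> a < 2 * m + 1 \<and> 1 \<le> b \<and> b < 2 * m + 1 \<longrightarrow> ext_d ?N \<eta> q [vs ! a, vs ! b] = std_symplectic a b)"
    if q: "q \<in> S" and sub: "manifold_of_dim m' ?N" for q m'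
  proof -
    interpret smooth_submfd M n S m' using sub by unfold_locales
    obtain U \<phi> E e x where c: "(U, \<phi>, E) \<in> maximal_atlas M" "q \<in> U" "dim E = n" and e: "e \<in> E" "e \<bullet> e = 1"
      and s: "(U \<inter> S, \<phi>, {v \<in> E. v \<bullet> e = 0}) \<in> charts ?N"
      and x: "x \<in> E" "X q = coord_field M (U, \<phi>, E) x q" "x \<bullet> e \<noteq> 0"
      using adapted[OF q] by blast
    define F where "F = {v \<in> E. v \<bullet> e = 0}"
    have FE: "F \<subseteq> E" by (auto simp: F_def)
    have sF: "(U \<inter> S, \<phi>, F) \<in> charts ?N" using s by (simp add: F_def)
    have qUS: "q \<in> U \<inter> S" using q c by simp
    define cf where "cf a = coord_field M (U, \<phi>, E) a q" for a
    define cfS where "cfS a = coord_field ?N (U \<inter> S, \<phi>, F) a q" for a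
    \<comment> \<open>The symplectic form at \<open>q\<close> in coordinates; as the coordinate
      fields parametrise the tangent space by \<open>E\<close>, it is alternating and nondegenerate
      there.\<close>
    define B where "B a b = neg_d M \<theta> q [cf a, cf b]" for a b
    have E: "subspace E" by (rule maximalD(2)[OF c(1)])
    have cf: "cf a \<in> tangent_space M q" if "a \<in> E" for a unfolding cf_def by (rule coord_field_tangent[OF c(1,2) that])
    have alt: "alternating_on E B"
      unfolding alternating_on_def B_def
      using two_form_linear[OF \<omega> c(1,2), folded cf_def] cf differential_form_2_linear(3)[OF \<omega> SM[OF q]] by blast
    have nd: "nondegenerate_on E B"
      unfolding nondegenerate_on_def
    proof (intro ballI impI)
      fix u assume u: "u \<in> E" "\<forall>v\<in>E. B u v = 0"
      have "neg_d M \<theta> q [cf u, v] = 0" if v: "v \<in> tangent_space M q" for v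
      proof -
        obtain b where "b \<in> E" "v = cf b" unfolding cf_def by (rule tangent_coord[OF v c(1,2)])
        then show ?thesis using u(2) by (simp add: B_def)
      qed
      then have "cf u = tzero" by (rule nondeg[OF SM[OF q] cf[OF u(1)]])
      \<comment> \<open>Coordinates recover \<open>u\<close> from its tangent vector, which has just
        been shown to be zero.\<close>
      then have "coord_vec (U, \<phi>, E) tzero = u" using coord_vec_coord_field[OF c(1,2) u(1)] by (simp add: cf_def)
      then show "u = 0" by (simp add: coord_vec_def tzero_def)
    qed
    obtain m vs where vs: "dim E = 2 * m + 2" "length vs = 2 * m + 1" "set vs \<subseteq> F" "B x (vs ! 0) \<noteq> 0"
      "\<And>a. 1 \<le> a \<Longrightarrow> a < 2 * m + 1 \<Longrightarrow> B x (vs ! a) = 0"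
      "\<And>a b. 1 \<le> a \<Longrightarrow> a < 2 * m + 1 \<Longrightarrow> 1 \<le> b \<Longrightarrow> b < 2 * m + 1 \<Longrightarrow> - B (vs ! a) (vs ! b) = std_symplectic a b"
      using contact_basis[OF E alt nd e x(1,3)] unfolding F_def by blast
    have vF: "vs ! a \<in> F" if "a < 2 * m + 1" for a using vs(2,3) that nth_mem by fastforce
    \<comment> \<open>The Liouville identity makes the restricted one-form the contraction of
      \<open>B\<close> with \<open>x\<close>, the form in which \<open>contact_basis\<close>
      describes its values.\<close>
    have \<eta>B: "\<eta> q [cfS a] = B x a" if "a \<in> F" for a
    proof -
      have "\<eta> q [cfS a] = \<theta> q [cf a]"
        using pullback_coord_field[OF sF c(1) FE qUS, of "[a]" \<theta>] that by (simp add: \<eta>_def cfS_def cf_def)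
      also have "\<dots> = B x a"
        unfolding B_def using \<omega>X[OF SM[OF q] cf] x(2) that FE by (auto simp: cf_def)
      finally show ?thesis .
    qed
    have dB: "ext_d ?N \<eta> q [cfS a, cfS b] = - B a b" if "a \<in> F" "b \<in> F" for a b
      unfolding \<eta>_def cfS_def ext_d_pullback[OF \<theta> sF c(1) FE qUS that] by (simp add: B_def cf_def neg_d_def)
    have "set (map cfS vs) \<subseteq> tangent_space ?N q"
      using vs(3) sub.coord_field_tangent[OF sub.charts_maximal[OF sF] qUS] by (auto simp: cfS_def)
    then show ?thesis
      using vs vF \<eta>B dB c(3) by (intro exI[of _ m] exI[of _ "map cfS vs"]) (auto simp: nth_map)
  qed
  \<comment> \<open>At a point of \<open>S\<close> the unit vector \<open>e\<close> shows
    \<open>n\<close> to be positive, so \<open>S\<close> has dimension \<open>n - 1\<close>, and the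
    basis at that point shows that \<open>n\<close> is even. For empty \<open>S\<close> any
    \<open>m\<close> will do.\<close>
  have "\<exists>m. S \<noteq> {} \<longrightarrow> n = 2 * m + 2"
  proof (cases "S = {}")
    case False
    then obtain q where q: "q \<in> S" by blast
    then obtain E :: "'e set" and e where "dim E = n" "e \<in> E" "e \<bullet> e = 1" using adapted by blast
    then have "e \<noteq> 0" by auto
    then have "n \<noteq> 0" using \<open>dim E = n\<close> \<open>e \<in> E\<close> by (metis dim_eq_0 singletonD subsetD)
    then have "manifold_of_dim (n - 1) ?N"
      unfolding S_def by (intro level_set_submfd[OF h XS]) auto
    then show ?thesis using basis[OF q] by blast
  qed simp
  then obtain m where m: "S \<noteq> {} \<Longrightarrow> n = 2 * m + 2" by blast
  have sub: "manifold_of_dim (2 * m + 1) ?N"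
    unfolding S_def using m by (intro level_set_submfd[OF h XS]) (auto simp: S_def)
  interpret smooth_submfd M n S "2 * m + 1" using sub by unfold_locales
  have PS: "points ?N = S" using SM by auto
  have trans: "transverse M X S"
    unfolding transverse_def
  proof (intro ballI equalityI subsetI)
    fix p v assume p: "p \<in> S" and "v \<in> {tadd (tscale r (X p)) (tmap M id p w) |r w. w \<in> tangent_space ?N p}"
    then show "v \<in> tangent_space M p"
      using tangent_space_add_scale[OF SM[OF p] X[OF SM[OF p]]] tmap_inclusion_tangent PS by blast
  next
    fix p v assume p: "p \<in> S" and v: "v \<in> tangent_space M p"
    obtain U \<phi> E e x where c: "(U, \<phi>, E) \<in> maximal_atlas M" "p \<in> U" and e: "e \<in> E"
      and s: "(U \<inter> S, \<phi>, {v \<in> E. v \<bullet> e = 0}) \<in> charts ?N"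
      and x: "x \<in> E" "X p = coord_field M (U, \<phi>, E) x p" "x \<bullet> e \<noteq> 0"
      using adapted[OF p] by blast
    obtain a where a: "a \<in> E" "v = coord_field M (U, \<phi>, E) a p" by (rule tangent_coord[OF v c])
    \<comment> \<open>Chosen so that \<open>a - r *\<^sub>R x\<close> has no
      \<open>e\<close>-component and is therefore tangent to the level set.\<close>
    define r where "r = (a \<bullet> e) / (x \<bullet> e)"
    define b where "b = a - r *\<^sub>R x"
    have b: "b \<in> {v \<in> E. v \<bullet> e = 0}"
      using a(1) x maximalD(2)[OF c(1)] by (simp add: b_def r_def subspace_diff subspace_scale inner_diff_left)
    have pUS: "p \<in> U \<inter> S" using p c by simp
    define w where "w = coord_field ?N (U \<inter> S, \<phi>, {v \<in> E. v \<bullet> e = 0}) b p"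
    have "tmap M id p w = coord_field M (U, \<phi>, E) b p"
      unfolding w_def by (rule tmap_inclusion_coord_field[OF s c(1) _ pUS b]) blast
    moreover have "v = coord_field M (U, \<phi>, E) (r *\<^sub>R x + b) p" by (simp add: a(2) b_def)
    ultimately have "v = tadd (tscale r (X p)) (tmap M id p w)"
      using coord_field_add_scale[OF c x(1), of b r] b x(2) by simp
    moreover have "w \<in> tangent_space ?N p"
      unfolding w_def by (rule sub.coord_field_tangent[OF sub.charts_maximal[OF s] pUS b])
    ultimately show "v \<in> {tadd (tscale r (X p)) (tmap M id p w) |r w. w \<in> tangent_space ?N p}" by blast
  qed
  have "contact_manifold ?N \<eta>"
    unfolding contact_manifold_def
  \<comment> \<open>For nonempty \<open>S\<close>, \<open>Suc m\<close> is half the dimension of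
    \<open>M\<close>, so the contact dimension becomes \<open>2 * m + 1\<close> and the power of the
    differential is \<open>m\<close>.\<close>
  proof (intro exI[of _ "Suc m"] conjI)
    have m2: "2 * Suc m - 1 = 2 * m + 1" by simp
    show "1 \<le> Suc m" by simp
    show "manifold_of_dim (2 * Suc m - 1) ?N" using sub by (simp only: m2)
    show "differential_form ?N 1 \<eta>" unfolding \<eta>_def by (rule pullback_one_form[OF \<theta>])
    show "volume_form ?N (2 * Suc m - 1)
        (\<lambda>p. wedge 1 (2 * (Suc m - 1)) (\<eta> p) (wedge_power 2 (ext_d ?N \<eta> p) (Suc m - 1)))"
      unfolding volume_form_def m2 diff_Suc_1
    proof (intro conjI ballI sub)
      show "differential_form ?N (2 * m + 1) (\<lambda>p. wedge 1 (2 * m) (\<eta> p) (wedge_power 2 (ext_d ?N \<eta> p) m))"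
        unfolding \<eta>_def by (rule contact_form_differential_form[OF \<theta> \<omega>])
      fix p assume "p \<in> points ?N"
      then have p: "p \<in> S" by simp
      then obtain m' vs where vs: "n = 2 * m' + 2" "length vs = 2 * m' + 1" "set vs \<subseteq> tangent_space ?N p" "\<eta> p [vs ! 0] \<noteq> 0"
        "\<And>a. 1 \<le> a \<Longrightarrow> a < 2 * m' + 1 \<Longrightarrow> \<eta> p [vs ! a] = 0"
        "\<And>a b. 1 \<le> a \<Longrightarrow> a < 2 * m' + 1 \<Longrightarrow> 1 \<le> b \<Longrightarrow> b < 2 * m' + 1 \<Longrightarrow> ext_d ?N \<eta> p [vs ! a, vs ! b] = std_symplectic a b"
        using basis[OF p sub] by blast
      \<comment> \<open>The basis comes with its own length parameter; both parameters are
        determined by \<open>n\<close>.\<close>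
      have mm: "m' = m" using vs(1) m p by auto
      have "wedge 1 (2 * m) (\<eta> p) (wedge_power 2 (ext_d ?N \<eta> p) m) vs \<noteq> 0"
        unfolding wedge_wedge_power_eq using contact_sum_nonzero[of "\<eta> p" vs m "ext_d ?N \<eta> p"] vs(4-6) by (simp add: mm)
      then show "\<exists>vs. length vs = 2 * m + 1 \<and> set vs \<subseteq> tangent_space ?N p \<and>
          wedge 1 (2 * m) (\<eta> p) (wedge_power 2 (ext_d ?N \<eta> p) m) vs \<noteq> 0"
        using vs(2,3) by (auto simp: mm)
    qed
  qed
  moreover have "embedded_submanifold M S"
    using SM sub by (auto simp: embedded_submanifold_def smooth_manifold_def)
  ultimately show ?thesis
    unfolding energy_hypersurface_def using reg trans by (auto simp: S_def \<eta>_def)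
qed

lemma transverse_derivative_nonzero:
  assumes h: "smooth_fun_on M (points M) h" and reg: "regular_value M h k" and tr: "transverse M X (level_set M h k)"
    and p: "p \<in> level_set M h k"
  shows "X p h \<noteq> 0"
proof
  assume X0: "X p h = 0"
  have pM: "p \<in> points M" using p by (simp add: level_set_def)
  \<comment> \<open>Regularity supplies a vector on which the differential is 1, while under the
    assumption both summands of its transverse decomposition annihilate \<open>h\<close>.\<close>
  have "(1::real) \<in> (\<lambda>v. v h) ` tangent_space M p" using reg p by (simp add: regular_value_def)
  then obtain v where v: "v \<in> tangent_space M p" "v h = 1" by force
  have "v \<in> {tadd (tscale r (X p)) (tmap M id p w) |r w. w \<in> tangent_space (submfd M (level_set M h k)) p}"
    using tr p v(1) unfolding transverse_def by blast
  then obtain r w where w: "w \<in> tangent_space (submfd M (level_set M h k)) p" "v = tadd (tscale r (X p)) (tmap M id p w)"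
    by blast
  \<comment> \<open>On the level set \<open>h\<close> agrees with a constant function, and tangent
    vectors of the level set see no more than that.\<close>
  have "w h = w (\<lambda>q. k)" by (rule tangent_space_submfd_cong[OF w(1)]) (simp add: level_set_def)
  then have "w h = 0" using tangent_space_constant[OF w(1)] by simp
  then have "tmap M id p w h = 0" by (simp add: tmap_def)
  then show False using v(2) w(2) X0 by (simp add: tadd_def tscale_def)
qed

theorem corollary4p2:
  fixes P :: "('p, 'e::euclidean_space) mfd"
    and \<theta> :: "'p form"
    and X :: "'p \<Rightarrow> 'p tvec"
    and h :: "'p \<Rightarrow> real"
    and L :: "('g, 'd::euclidean_space) mfd"
    and G :: "'g monoid"
    and \<Phi> :: "'g \<Rightarrow> 'p \<Rightarrow> 'p"
    and J :: "'p \<Rightarrow> 'g tvec \<Rightarrow> real"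
    and \<mu> :: "'g tvec \<Rightarrow> real"
    and K :: "'g set"
    and N :: "'p set"
    and Q :: "('p set, 'q::euclidean_space) mfd"
    and \<theta>Q :: "'p set form"
    and XQ :: "'p set \<Rightarrow> 'p set tvec"
    and hQ :: "'p set \<Rightarrow> real"
    and c :: real
  defines "J \<equiv> momentum_map L G P \<theta> \<Phi>"
    and "N \<equiv> momentum_level P J \<mu>"
  assumes "lie_group L G" and "connected_space (mtop L)"
    and "exact_symplectic_Hamiltonian_system P \<theta> X h" and "connected_space (mtop P)"
    and "exact_symplectic_action L G P \<theta> \<Phi>"
    and "invariant_function G P \<Phi> h"
    and "regular_value_dual L G P J \<mu>"
    and "embedded_submanifold P N"
    and "connected_lie_subgroup L G K (k_ray L G \<mu>)"
    and "quotient_manifold P N \<Phi> K Q"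
    and "regular_value P h c"
    and "transverse P X (level_set P h c)"
    and "reduced_system P \<theta> X h N \<Phi> K Q \<theta>Q XQ hQ"
  shows "energy_hypersurface Q \<theta>Q XQ hQ (level_set Q hQ c) (pullback Q id \<theta>Q)"
proof (rule energy_hypersurfaceI)
  let ?\<tau> = "orbit_proj \<Phi> K"
  show sysQ: "exact_symplectic_Hamiltonian_system Q \<theta>Q XQ hQ"
    using \<open>reduced_system P \<theta> X h N \<Phi> K Q \<theta>Q XQ hQ\<close> by (simp add: reduced_system_def)
  have hP: "smooth_fun_on P (points P) h" and smooth_hQ: "smooth_fun_on Q (points Q) hQ"
    using \<open>exact_symplectic_Hamiltonian_system P \<theta> X h\<close> sysQ by (simp_all add: exact_symplectic_Hamiltonian_system_def)
  fix q assume q: "q \<in> level_set Q hQ c"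
  then have qQ: "q \<in> points Q" by (simp add: level_set_def)
  \<comment> \<open>Points of the quotient are orbits of points of \<open>N\<close>, so the question
    at \<open>q\<close> is moved to a representative upstairs.\<close>
  then obtain p where p: "p \<in> N" "q = ?\<tau> p"
    using \<open>quotient_manifold P N \<Phi> K Q\<close> by (auto simp: quotient_manifold_def)
  have pP: "p \<in> points P" using p(1) by (simp add: N_def momentum_level_def)
  have h\<tau>: "hQ (?\<tau> p) = h p" if "p \<in> N" for p
    using \<open>reduced_system P \<theta> X h N \<Phi> K Q \<theta>Q XQ hQ\<close> that by (simp add: reduced_system_def)
  obtain w where w: "w \<in> tangent_space (submfd P N) p" "tmap P id p w = X p" "tmap Q ?\<tau> p w = XQ (?\<tau> p)"
    using \<open>reduced_system P \<theta> X h N \<Phi> K Q \<theta>Q XQ hQ\<close> p(1) unfolding reduced_system_def by blast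
  \<comment> \<open>Smoothness of \<open>hQ\<close> near \<open>q\<close> excludes the default value
    in \<open>tmap\<close>, so the pushed-forward vector acts by composition with the
    projection.\<close>
  have "XQ q hQ = w (\<lambda>p. hQ (?\<tau> p))"
    using smooth_near_points[OF smooth_hQ qQ] unfolding p(2) w(3)[symmetric] by (simp add: tmap_def)
  \<comment> \<open>The two functions are known to agree only on \<open>N\<close>, which is enough
    for a tangent vector of \<open>N\<close>.\<close>
  also have "\<dots> = w h" by (rule tangent_space_submfd_cong[OF w(1) h\<tau>])
  also have "\<dots> = X p h"
    using smooth_near_points[OF hP pP] unfolding w(2)[symmetric] by (simp add: tmap_def)
  also have "\<dots> \<noteq> 0"
  proof (rule transverse_derivative_nonzero[OF hP \<open>regular_value P h c\<close> \<open>transverse P X (level_set P h c)\<close>])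
    show "p \<in> level_set P h c" using q h\<tau>[OF p(1)] pP by (simp add: p(2) level_set_def)
  qed
  finally show "XQ q hQ \<noteq> 0" .
qed

end
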